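(* Let $\Lambda$ and $\Lambda'$ be Artin algebras. If $\mathcal{P}(\Lambda)\simeq\mathcal{P}(\Lambda')$ as exact categories, then $\mathrm{mod}\text{-}\Lambda\simeq\mathrm{mod}\text{-}\Lambda'$.
   Context: $\mathrm{mod}\text{-}\Lambda$ is the category of finitely generated $\Lambda$-modules. $\mathcal{H}(\Lambda)$ is the morphism category of $\mathrm{mod}\text{-}\Lambda$: objects are morphisms $f:X\to Y$ in $\mathrm{mod}\text{-}\Lambda$, and a morphism from $(X\xrightarrow{f}Y)$ to $(X'\xrightarrow{f'}Y')$ is a pair $(\sigma_1,\sigma_2)$ with $\sigma_1:X\to X'$, $\sigma_2:Y\to Y'$ and $\sigma_2f=f'\sigma_1$. It is abelian, with exactness computed componentwise. $\mathcal{P}(\Lambda)$ is the full subcategory of $\mathcal{H}(\Lambda)$ of objects $(P\xrightarrow{f}Q)$ with $P,Q$ projective; it is extension-closed and carries the exact structure inherited from $\mathcal{H}(\Lambda)$. An equivalence of exact categories is an equivalence that preserves and reflects the conflations. *)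

theory Defs
  imports "HOL-Algebra.Module" "HOL-Algebra.Ideal" "HOL-Library.FuncSet"
begin

section \<open>Categories, exact categories and their equivalences\<close>

text \<open>
  Hom-sets are indexed by objects and need not be disjoint, so composition and the action of a
  functor on morphisms take the objects involved as arguments.
  \<^term>\<open>cat_comp C X Y Z g f\<close> is the composite of \<open>f : X \<rightarrow> Y\<close> and \<open>g : Y \<rightarrow> Z\<close>.
\<close>

record ('o, 'm) category =
  cat_obj :: "'o set"
  cat_hom :: "'o \<Rightarrow> 'o \<Rightarrow> 'm set"
  cat_comp :: "'o \<Rightarrow> 'o \<Rightarrow> 'o \<Rightarrow> 'm \<Rightarrow> 'm \<Rightarrow> 'm"
  cat_id :: "'o \<Rightarrow> 'm"

definition is_category :: "('o, 'm, 'z) category_scheme \<Rightarrow> bool" where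
  "is_category C \<longleftrightarrow>
    (\<forall>X\<in>cat_obj C. cat_id C X \<in> cat_hom C X X) \<and>
    (\<forall>X\<in>cat_obj C. \<forall>Y\<in>cat_obj C. \<forall>Z\<in>cat_obj C. \<forall>f\<in>cat_hom C X Y. \<forall>g\<in>cat_hom C Y Z.
       cat_comp C X Y Z g f \<in> cat_hom C X Z) \<and>
    (\<forall>X\<in>cat_obj C. \<forall>Y\<in>cat_obj C. \<forall>f\<in>cat_hom C X Y.
       cat_comp C X X Y f (cat_id C X) = f \<and> cat_comp C X Y Y (cat_id C Y) f = f) \<and>
    (\<forall>W\<in>cat_obj C. \<forall>X\<in>cat_obj C. \<forall>Y\<in>cat_obj C. \<forall>Z\<in>cat_obj C.
     \<forall>f\<in>cat_hom C W X. \<forall>g\<in>cat_hom C X Y. \<forall>h\<in>cat_hom C Y Z.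
       cat_comp C W X Z (cat_comp C X Y Z h g) f = cat_comp C W Y Z h (cat_comp C W X Y g f))"

definition cat_iso :: "('o, 'm, 'z) category_scheme \<Rightarrow> 'o \<Rightarrow> 'o \<Rightarrow> 'm \<Rightarrow> bool" where
  "cat_iso C X Y f \<longleftrightarrow> f \<in> cat_hom C X Y \<and>
    (\<exists>g\<in>cat_hom C Y X. cat_comp C X Y X g f = cat_id C X \<and> cat_comp C Y X Y f g = cat_id C Y)"

record ('o, 'm, 'p, 'n) cat_map =
  on_obj :: "'o \<Rightarrow> 'p"
  on_hom :: "'o \<Rightarrow> 'o \<Rightarrow> 'm \<Rightarrow> 'n"

definition is_functor ::
    "('o, 'm, 'y) category_scheme \<Rightarrow> ('p, 'n, 'z) category_scheme \<Rightarrow> ('o, 'm, 'p, 'n) cat_map \<Rightarrow> bool"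
  where
  "is_functor C D F \<longleftrightarrow>
    (\<forall>X\<in>cat_obj C. on_obj F X \<in> cat_obj D) \<and>
    (\<forall>X\<in>cat_obj C. \<forall>Y\<in>cat_obj C. \<forall>f\<in>cat_hom C X Y.
       on_hom F X Y f \<in> cat_hom D (on_obj F X) (on_obj F Y)) \<and>
    (\<forall>X\<in>cat_obj C. on_hom F X X (cat_id C X) = cat_id D (on_obj F X)) \<and>
    (\<forall>X\<in>cat_obj C. \<forall>Y\<in>cat_obj C. \<forall>Z\<in>cat_obj C. \<forall>f\<in>cat_hom C X Y. \<forall>g\<in>cat_hom C Y Z.
       on_hom F X Z (cat_comp C X Y Z g f) =
       cat_comp D (on_obj F X) (on_obj F Y) (on_obj F Z) (on_hom F Y Z g) (on_hom F X Y f))"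

definition functor_id :: "('o, 'm, 'o, 'm) cat_map" where
  "functor_id = \<lparr>on_obj = (\<lambda>X. X), on_hom = (\<lambda>X Y f. f)\<rparr>"

definition functor_comp ::
    "('p, 'n, 'q, 'l) cat_map \<Rightarrow> ('o, 'm, 'p, 'n) cat_map \<Rightarrow> ('o, 'm, 'q, 'l) cat_map" where
  "functor_comp G F =
    \<lparr>on_obj = (\<lambda>X. on_obj G (on_obj F X)),
     on_hom = (\<lambda>X Y f. on_hom G (on_obj F X) (on_obj F Y) (on_hom F X Y f))\<rparr>"

definition natural_iso ::
    "('o, 'm, 'y) category_scheme \<Rightarrow> ('p, 'n, 'z) category_scheme \<Rightarrow>
     ('o, 'm, 'p, 'n) cat_map \<Rightarrow> ('o, 'm, 'p, 'n) cat_map \<Rightarrow> ('o \<Rightarrow> 'n) \<Rightarrow> bool" where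
  "natural_iso C D F G t \<longleftrightarrow>
    (\<forall>X\<in>cat_obj C. cat_iso D (on_obj F X) (on_obj G X) (t X)) \<and>
    (\<forall>X\<in>cat_obj C. \<forall>Y\<in>cat_obj C. \<forall>f\<in>cat_hom C X Y.
       cat_comp D (on_obj F X) (on_obj F Y) (on_obj G Y) (t Y) (on_hom F X Y f) =
       cat_comp D (on_obj F X) (on_obj G X) (on_obj G Y) (on_hom G X Y f) (t X))"

definition is_equivalence ::
    "('o, 'm, 'y) category_scheme \<Rightarrow> ('p, 'n, 'z) category_scheme \<Rightarrow> ('o, 'm, 'p, 'n) cat_map \<Rightarrow> bool"
  where
  "is_equivalence C D F \<longleftrightarrow> is_functor C D F \<and>
    (\<exists>G \<eta> \<epsilon>. is_functor D C G \<and>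
       natural_iso C C functor_id (functor_comp G F) \<eta> \<and>
       natural_iso D D (functor_comp F G) functor_id \<epsilon>)"

definition equivalent_categories ::
    "('o, 'm, 'y) category_scheme \<Rightarrow> ('p, 'n, 'z) category_scheme \<Rightarrow> bool" where
  "equivalent_categories C D \<longleftrightarrow> (\<exists>F. is_equivalence C D F)"

text \<open>
  \<^term>\<open>conflation E A i B p C\<close> says that \<open>A \<rightarrow> B \<rightarrow> C\<close>, with maps \<open>i\<close> and \<open>p\<close>, is a conflation of \<open>E\<close>.
\<close>

record ('o, 'm) exact_category = "('o, 'm) category" +
  conflation :: "'o \<Rightarrow> 'm \<Rightarrow> 'o \<Rightarrow> 'm \<Rightarrow> 'o \<Rightarrow> bool"

definition is_exact_equivalence ::
    "('o, 'm, 'y) exact_category_scheme \<Rightarrow> ('p, 'n, 'z) exact_category_scheme \<Rightarrow>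
     ('o, 'm, 'p, 'n) cat_map \<Rightarrow> bool" where
  "is_exact_equivalence C D F \<longleftrightarrow> is_equivalence C D F \<and>
    (\<forall>X\<in>cat_obj C. \<forall>Y\<in>cat_obj C. \<forall>Z\<in>cat_obj C. \<forall>i\<in>cat_hom C X Y. \<forall>p\<in>cat_hom C Y Z.
       conflation C X i Y p Z \<longleftrightarrow>
       conflation D (on_obj F X) (on_hom F X Y i) (on_obj F Y) (on_hom F Y Z p) (on_obj F Z))"

definition equivalent_exact_categories ::
    "('o, 'm, 'y) exact_category_scheme \<Rightarrow> ('p, 'n, 'z) exact_category_scheme \<Rightarrow> bool" where
  "equivalent_exact_categories C D \<longleftrightarrow> (\<exists>F. is_exact_equivalence C D F)"

definition full_exact_subcategory ::
    "('o, 'm) exact_category \<Rightarrow> 'o set \<Rightarrow> ('o, 'm) exact_category" where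
  "full_exact_subcategory E S = E\<lparr>cat_obj := cat_obj E \<inter> S,
     conflation := (\<lambda>A i B p C. A \<in> S \<and> B \<in> S \<and> C \<in> S \<and> conflation E A i B p C)\<rparr>"


section \<open>Artin algebras and their finitely generated modules\<close>

text \<open>
  The record \<^typ>\<open>('a, 'm) module\<close> extends the ring record; for modules proper, the fields
  \<open>mult\<close> and \<open>one\<close> are unused. The library locale \<^locale>\<open>module\<close> requires a commutative ring of
  scalars, hence the separate notion below. Modules are right modules, so
  \<open>a \<odot>\<^bsub>M\<^esub> x\<close> stands for what is usually written \<open>x a\<close>.
\<close>

definition right_module :: "('a, 'y) ring_scheme \<Rightarrow> ('a, 'm, 'z) module_scheme \<Rightarrow> bool" where
  "right_module L M \<longleftrightarrow> ring L \<and> abelian_group M \<and>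
    (\<forall>a\<in>carrier L. \<forall>x\<in>carrier M. a \<odot>\<^bsub>M\<^esub> x \<in> carrier M) \<and>
    (\<forall>a\<in>carrier L. \<forall>b\<in>carrier L. \<forall>x\<in>carrier M.
       (a \<oplus>\<^bsub>L\<^esub> b) \<odot>\<^bsub>M\<^esub> x = (a \<odot>\<^bsub>M\<^esub> x) \<oplus>\<^bsub>M\<^esub> (b \<odot>\<^bsub>M\<^esub> x)) \<and>
    (\<forall>a\<in>carrier L. \<forall>x\<in>carrier M. \<forall>y\<in>carrier M.
       a \<odot>\<^bsub>M\<^esub> (x \<oplus>\<^bsub>M\<^esub> y) = (a \<odot>\<^bsub>M\<^esub> x) \<oplus>\<^bsub>M\<^esub> (a \<odot>\<^bsub>M\<^esub> y)) \<and>
    (\<forall>a\<in>carrier L. \<forall>b\<in>carrier L. \<forall>x\<in>carrier M.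
       (a \<otimes>\<^bsub>L\<^esub> b) \<odot>\<^bsub>M\<^esub> x = b \<odot>\<^bsub>M\<^esub> (a \<odot>\<^bsub>M\<^esub> x)) \<and>
    (\<forall>x\<in>carrier M. \<one>\<^bsub>L\<^esub> \<odot>\<^bsub>M\<^esub> x = x)"

definition finitely_generated_module ::
    "('a, 'y) ring_scheme \<Rightarrow> ('a, 'm, 'z) module_scheme \<Rightarrow> bool" where
  "finitely_generated_module L M \<longleftrightarrow>
    (\<exists>S. finite S \<and> S \<subseteq> carrier M \<and>
      (\<forall>x\<in>carrier M. \<exists>c\<in>S \<rightarrow> carrier L. x = (\<Oplus>\<^bsub>M\<^esub>s\<in>S. c s \<odot>\<^bsub>M\<^esub> s)))"

definition artinian_cring :: "('r, 'y) ring_scheme \<Rightarrow> bool" where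
  "artinian_cring R \<longleftrightarrow> cring R \<and>
    (\<forall>I :: nat \<Rightarrow> 'r set. (\<forall>n. ideal (I n) R \<and> I (Suc n) \<subseteq> I n) \<longrightarrow> (\<exists>N. \<forall>n\<ge>N. I n = I N))"

text \<open>
  The library locale \<open>algebra\<close> is not used because it requires a commutative multiplication.
\<close>

definition artin_algebra :: "('r, 'y) ring_scheme \<Rightarrow> ('r, 'a, 'z) module_scheme \<Rightarrow> bool" where
  "artin_algebra R L \<longleftrightarrow> artinian_cring R \<and> ring L \<and> module R L \<and>
    (\<forall>r\<in>carrier R. \<forall>x\<in>carrier L. \<forall>y\<in>carrier L.
       (r \<odot>\<^bsub>L\<^esub> x) \<otimes>\<^bsub>L\<^esub> y = r \<odot>\<^bsub>L\<^esub> (x \<otimes>\<^bsub>L\<^esub> y) \<and> x \<otimes>\<^bsub>L\<^esub> (r \<odot>\<^bsub>L\<^esub> y) = r \<odot>\<^bsub>L\<^esub> (x \<otimes>\<^bsub>L\<^esub> y)) \<and>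
    finitely_generated_module R L"

definition module_hom ::
    "('a, 'y) ring_scheme \<Rightarrow> ('a, 'm, 'u) module_scheme \<Rightarrow> ('a, 'n, 'v) module_scheme \<Rightarrow> ('m \<Rightarrow> 'n) set"
  where
  "module_hom L M N = {f \<in> carrier M \<rightarrow>\<^sub>E carrier N.
    (\<forall>x\<in>carrier M. \<forall>y\<in>carrier M. f (x \<oplus>\<^bsub>M\<^esub> y) = f x \<oplus>\<^bsub>N\<^esub> f y) \<and>
    (\<forall>a\<in>carrier L. \<forall>x\<in>carrier M. f (a \<odot>\<^bsub>M\<^esub> x) = a \<odot>\<^bsub>N\<^esub> f x)}"

text \<open>
  A finitely generated module over a ring with elements in \<open>'a\<close> is a quotient of some power of
  the ring, so choosing coset representatives gives an isomorphic module whose elements are lists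
  over \<open>'a\<close> (lemma \<open>mod_cat_universe\<close> below). Restricting the carriers to subsets of
  \<^typ>\<open>'a list\<close> therefore gives the category of all finitely generated modules up to equivalence.
\<close>

definition mod_cat ::
    "('a, 'y) ring_scheme \<Rightarrow> (('a, 'a list) module, 'a list \<Rightarrow> 'a list) category" where
  "mod_cat L =
    \<lparr>cat_obj = {M. right_module L M \<and> finitely_generated_module L M},
     cat_hom = module_hom L,
     cat_comp = (\<lambda>X Y Z g f. compose (carrier X) g f),
     cat_id = (\<lambda>X. restrict id (carrier X))\<rparr>"

definition short_exact ::
    "('a, 'y) ring_scheme \<Rightarrow> ('a, 'a list) module \<Rightarrow> ('a list \<Rightarrow> 'a list) \<Rightarrow> ('a, 'a list) module \<Rightarrow>
     ('a list \<Rightarrow> 'a list) \<Rightarrow> ('a, 'a list) module \<Rightarrow> bool" where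
  "short_exact L A i B p C \<longleftrightarrow>
    A \<in> cat_obj (mod_cat L) \<and> B \<in> cat_obj (mod_cat L) \<and> C \<in> cat_obj (mod_cat L) \<and>
    i \<in> module_hom L A B \<and> p \<in> module_hom L B C \<and>
    inj_on i (carrier A) \<and> i ` carrier A = {b \<in> carrier B. p b = \<zero>\<^bsub>C\<^esub>} \<and> p ` carrier B = carrier C"

definition projective_module :: "('a, 'y) ring_scheme \<Rightarrow> ('a, 'a list) module \<Rightarrow> bool" where
  "projective_module L P \<longleftrightarrow> P \<in> cat_obj (mod_cat L) \<and>
    (\<forall>M\<in>cat_obj (mod_cat L). \<forall>N\<in>cat_obj (mod_cat L). \<forall>g\<in>module_hom L M N. \<forall>f\<in>module_hom L P N.
       g ` carrier M = carrier N \<longrightarrow> (\<exists>h\<in>module_hom L P M. compose (carrier P) g h = f))"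


section \<open>The morphism category and its subcategory of projectives\<close>

text \<open>A triple \<open>(X, Y, f)\<close> is the object \<open>f : X \<rightarrow> Y\<close>.\<close>

type_synonym 'a morphism_obj =
  "('a, 'a list) module \<times> ('a, 'a list) module \<times> ('a list \<Rightarrow> 'a list)"

type_synonym 'a morphism_hom = "('a list \<Rightarrow> 'a list) \<times> ('a list \<Rightarrow> 'a list)"

definition morphism_cat ::
    "('a, 'y) ring_scheme \<Rightarrow> ('a morphism_obj, 'a morphism_hom) exact_category" where
  "morphism_cat L =
    \<lparr>cat_obj = {(X, Y, f). X \<in> cat_obj (mod_cat L) \<and> Y \<in> cat_obj (mod_cat L) \<and> f \<in> module_hom L X Y},
     cat_hom = (\<lambda>(X, Y, f) (X', Y', f').
       {(\<sigma>\<^sub>1, \<sigma>\<^sub>2). \<sigma>\<^sub>1 \<in> module_hom L X X' \<and> \<sigma>\<^sub>2 \<in> module_hom L Y Y' \<and>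
          compose (carrier X) \<sigma>\<^sub>2 f = compose (carrier X) f' \<sigma>\<^sub>1}),
     cat_comp = (\<lambda>(X, Y, f) _ _ (\<tau>\<^sub>1, \<tau>\<^sub>2) (\<sigma>\<^sub>1, \<sigma>\<^sub>2).
       (compose (carrier X) \<tau>\<^sub>1 \<sigma>\<^sub>1, compose (carrier Y) \<tau>\<^sub>2 \<sigma>\<^sub>2)),
     cat_id = (\<lambda>(X, Y, f). (restrict id (carrier X), restrict id (carrier Y))),
     conflation = (\<lambda>(X, Y, f) (i\<^sub>1, i\<^sub>2) (X', Y', f') (p\<^sub>1, p\<^sub>2) (X'', Y'', f'').
       f \<in> module_hom L X Y \<and> f' \<in> module_hom L X' Y' \<and> f'' \<in> module_hom L X'' Y'' \<and>
       compose (carrier X) i\<^sub>2 f = compose (carrier X) f' i\<^sub>1 \<and>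
       compose (carrier X') p\<^sub>2 f' = compose (carrier X') f'' p\<^sub>1 \<and>
       short_exact L X i\<^sub>1 X' p\<^sub>1 X'' \<and> short_exact L Y i\<^sub>2 Y' p\<^sub>2 Y'')\<rparr>"

definition proj_cat ::
    "('a, 'y) ring_scheme \<Rightarrow> ('a morphism_obj, 'a morphism_hom) exact_category" where
  "proj_cat L = full_exact_subcategory (morphism_cat L)
     {(P, Q, f). projective_module L P \<and> projective_module L Q}"


section \<open>Consistency checks\<close>

lemma module_hom_compose:
  assumes "right_module L X" "f \<in> module_hom L X Y" "g \<in> module_hom L Y Z"
  shows "compose (carrier X) g f \<in> module_hom L X Z"
proof -
  interpret X: abelian_group X using assms(1) by (simp add: right_module_def)
  have f: "f x \<in> carrier Y" if "x \<in> carrier X" for x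
    using assms(2) that by (auto simp: module_hom_def)
  show ?thesis
    using assms f by (auto simp: module_hom_def compose_def right_module_def PiE_iff)
qed

lemma module_hom_id: "right_module L X \<Longrightarrow> restrict id (carrier X) \<in> module_hom L X X"
proof -
  assume X: "right_module L X"
  then interpret X: abelian_group X by (simp add: right_module_def)
  show ?thesis using X by (auto simp: module_hom_def right_module_def)
qed

lemma module_hom_compose_id:
  assumes "f \<in> module_hom L X Y"
  shows "compose (carrier X) f (restrict id (carrier X)) = f"
    and "compose (carrier X) (restrict id (carrier Y)) f = f"
  using assms by (auto simp: module_hom_def compose_def PiE_iff extensional_def fun_eq_iff)

lemma module_hom_compose_assoc:
  assumes "f \<in> module_hom L W X"
  shows "compose (carrier W) (compose (carrier X) h g) f = compose (carrier W) h (compose (carrier W) g f)"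
  using assms by (auto simp: module_hom_def compose_def PiE_iff fun_eq_iff)

lemma is_category_mod_cat: "is_category (mod_cat L)"
  unfolding is_category_def mod_cat_def
  by (simp add: module_hom_compose module_hom_id module_hom_compose_id module_hom_compose_assoc)

lemma compose_square:
  assumes "f \<in> module_hom L X Y" "\<sigma>\<^sub>1 \<in> module_hom L X X'"
    and "compose (carrier X) \<sigma>\<^sub>2 f = compose (carrier X) f' \<sigma>\<^sub>1"
    and "compose (carrier X') \<tau>\<^sub>2 f' = compose (carrier X') f'' \<tau>\<^sub>1"
  shows "compose (carrier X) (compose (carrier Y) \<tau>\<^sub>2 \<sigma>\<^sub>2) f =
    compose (carrier X) f'' (compose (carrier X) \<tau>\<^sub>1 \<sigma>\<^sub>1)"
  using assms(3,4)
  by (metis module_hom_compose_assoc[OF assms(1)] module_hom_compose_assoc[OF assms(2)])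

lemma is_category_morphism_cat: "is_category (morphism_cat L)"
proof -
  let ?M = "morphism_cat L"
  have id: "cat_id ?M A \<in> cat_hom ?M A A" if "A \<in> cat_obj ?M" for A
    using that by (auto simp: morphism_cat_def mod_cat_def module_hom_id module_hom_compose_id)
  have comp: "cat_comp ?M A B C g f \<in> cat_hom ?M A C"
    if "A \<in> cat_obj ?M" "f \<in> cat_hom ?M A B" "g \<in> cat_hom ?M B C" for A B C f g
    using that
    by (cases A; cases B; cases C)
      (auto simp: morphism_cat_def mod_cat_def intro: module_hom_compose compose_square)
  have unit: "cat_comp ?M A A B f (cat_id ?M A) = f" "cat_comp ?M A B B (cat_id ?M B) f = f"
    if "f \<in> cat_hom ?M A B" for A B f
    using that by (cases A; cases B; auto simp: morphism_cat_def module_hom_compose_id)+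
  have assoc: "cat_comp ?M A B D (cat_comp ?M B C D h g) f = cat_comp ?M A C D h (cat_comp ?M A B C g f)"
    if "f \<in> cat_hom ?M A B" for A B C D f g h
    using that
    by (cases A; cases B; cases C; cases f; cases g; cases h)
      (auto simp: morphism_cat_def module_hom_compose_assoc)
  show ?thesis
    unfolding is_category_def
    by (intro conjI ballI) (rule id comp unit assoc; assumption)+
qed

lemma is_category_proj_cat: "is_category (proj_cat L)"
proof -
  have sel: "cat_obj (proj_cat L) \<subseteq> cat_obj (morphism_cat L)"
    "cat_hom (proj_cat L) = cat_hom (morphism_cat L)"
    "cat_comp (proj_cat L) = cat_comp (morphism_cat L)"
    "cat_id (proj_cat L) = cat_id (morphism_cat L)"
    by (simp_all add: proj_cat_def full_exact_subcategory_def)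
  show ?thesis
    using is_category_morphism_cat[of L] unfolding is_category_def sel(2-4)
    by (simp add: subsetD[OF sel(1)])
qed

text \<open>
  Every finitely generated module, with carrier in any type, is isomorphic to an object of \<open>mod_cat\<close>.
\<close>

lemma mod_cat_universe:
  fixes M :: "('a, 'm, 'z) module_scheme" and L :: "('a, 'y) ring_scheme"
  assumes M: "right_module L M" and fg: "finitely_generated_module L M"
  shows "\<exists>N \<in> cat_obj (mod_cat L). \<exists>f \<in> module_hom L M N. bij_betw f (carrier M) (carrier N)"
proof -
  interpret M: abelian_group M using M by (simp add: right_module_def)
  from fg obtain S where S: "finite S" "S \<subseteq> carrier M"
    and gen: "\<And>x. x \<in> carrier M \<Longrightarrow> \<exists>c\<in>S \<rightarrow> carrier L. x = (\<Oplus>\<^bsub>M\<^esub>s\<in>S. c s \<odot>\<^bsub>M\<^esub> s)"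
    unfolding finitely_generated_module_def by blast
  obtain ss where ss: "set ss = S" "distinct ss" using S(1) finite_distinct_list by blast
  from gen obtain c where c: "\<And>x. x \<in> carrier M \<Longrightarrow> c x \<in> S \<rightarrow> carrier L"
    and xc: "\<And>x. x \<in> carrier M \<Longrightarrow> x = (\<Oplus>\<^bsub>M\<^esub>s\<in>S. c x s \<odot>\<^bsub>M\<^esub> s)" by metis
  define e where "e x = map (c x) ss" for x
  have clos: "a \<odot>\<^bsub>M\<^esub> x \<in> carrier M" if "a \<in> carrier L" "x \<in> carrier M" for a x
    using M that by (auto simp: right_module_def)
  have inj: "inj_on e (carrier M)"
  proof (rule inj_onI)
    fix x y assume x: "x \<in> carrier M" and y: "y \<in> carrier M" and "e x = e y"
    then have eq: "\<And>s. s \<in> S \<Longrightarrow> c x s = c y s" using ss by (auto simp: e_def)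
    have "(\<Oplus>\<^bsub>M\<^esub>s\<in>S. c x s \<odot>\<^bsub>M\<^esub> s) = (\<Oplus>\<^bsub>M\<^esub>s\<in>S. c y s \<odot>\<^bsub>M\<^esub> s)"
      using c[OF y] S(2) clos by (intro M.finsum_cong') (auto simp: eq Pi_iff)
    then show "x = y" using xc x y by metis
  qed
  define d where "d = inv_into (carrier M) e"
  have de: "d (e x) = x" if "x \<in> carrier M" for x using inj that by (simp add: d_def)
  define N :: "('a, 'a list) module" where
    "N = \<lparr>carrier = e ` carrier M, mult = undefined, one = undefined, zero = e \<zero>\<^bsub>M\<^esub>,
          add = (\<lambda>x y. e (d x \<oplus>\<^bsub>M\<^esub> d y)), smult = (\<lambda>a x. e (a \<odot>\<^bsub>M\<^esub> d x))\<rparr>"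
  have N: "carrier N = e ` carrier M" "zero N = e \<zero>\<^bsub>M\<^esub>"
    "\<And>x y. x \<oplus>\<^bsub>N\<^esub> y = e (d x \<oplus>\<^bsub>M\<^esub> d y)" "\<And>a x. a \<odot>\<^bsub>N\<^esub> x = e (a \<odot>\<^bsub>M\<^esub> d x)"
    by (simp_all add: N_def)
  have abN: "abelian_group N"
  proof (rule abelian_groupI)
    show "\<exists>y\<in>carrier N. y \<oplus>\<^bsub>N\<^esub> x = \<zero>\<^bsub>N\<^esub>" if x: "x \<in> carrier N" for x
    proof -
      from x obtain z where z: "z \<in> carrier M" "x = e z" by (auto simp: N)
      then show ?thesis
        by (intro bexI[of _ "e (\<ominus>\<^bsub>M\<^esub> z)"]) (auto simp: N de M.l_neg)
    qed
  qed (auto simp: N de M.a_ac)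
  then interpret N: abelian_group N .
  have rN: "right_module L N"
    using M abN by (auto simp: right_module_def N de)
  define f where "f = restrict e (carrier M)"
  have f: "f \<in> module_hom L M N"
    using clos by (auto simp: f_def module_hom_def N de)
  have fsum: "e (\<Oplus>\<^bsub>M\<^esub>s\<in>T. g s) = (\<Oplus>\<^bsub>N\<^esub>s\<in>T. e (g s))" if "finite T" "g \<in> T \<rightarrow> carrier M" for T :: "'m set" and g
    using that
  proof (induction T rule: finite_induct)
    case empty then show ?case by (simp add: N)
  next
    case (insert t T)
    then have g: "g \<in> T \<rightarrow> carrier M" "g t \<in> carrier M" by auto
    have eg: "(\<lambda>s. e (g s)) \<in> T \<rightarrow> carrier N" "e (g t) \<in> carrier N" using g by (auto simp: N)
    show ?case
      using insert g eg by (simp add: M.finsum_insert N.finsum_insert) (simp add: N de flip: insert.IH[OF g(1)])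
  qed
  have "finitely_generated_module L N"
    unfolding finitely_generated_module_def
  proof (intro exI[of _ "e ` S"] conjI ballI)
    fix x assume "x \<in> carrier N"
    then obtain z where z: "z \<in> carrier M" "x = e z" by (auto simp: N)
    have injS: "inj_on e S" using inj S(2) inj_on_subset by blast
    have dS: "\<And>s. s \<in> S \<Longrightarrow> d (e s) = s" using S(2) de by auto
    have "x = e (\<Oplus>\<^bsub>M\<^esub>s\<in>S. c z s \<odot>\<^bsub>M\<^esub> s)" using xc z by metis
    also have "\<dots> = (\<Oplus>\<^bsub>N\<^esub>s\<in>S. e (c z s \<odot>\<^bsub>M\<^esub> s))"
      using c[OF z(1)] S clos by (intro fsum) (auto simp: Pi_iff)
    also have "\<dots> = (\<Oplus>\<^bsub>N\<^esub>s\<in>S. c z (d (e s)) \<odot>\<^bsub>N\<^esub> e s)"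
      using c[OF z(1)] S(2) clos by (intro N.finsum_cong') (auto simp: N dS Pi_iff)
    also have "\<dots> = (\<Oplus>\<^bsub>N\<^esub>t\<in>e ` S. c z (d t) \<odot>\<^bsub>N\<^esub> t)"
    proof (rule N.finsum_reindex[OF _ injS, symmetric])
      show "(\<lambda>t. c z (d t) \<odot>\<^bsub>N\<^esub> t) \<in> e ` S \<rightarrow> carrier N"
        using c[OF z(1)] S(2) clos by (auto simp: N dS Pi_iff)
    qed
    finally show "\<exists>c\<in>e ` S \<rightarrow> carrier L. x = (\<Oplus>\<^bsub>N\<^esub>t\<in>e ` S. c t \<odot>\<^bsub>N\<^esub> t)"
      using c[OF z(1)] dS by (intro bexI[of _ "\<lambda>t. c z (d t)"]) auto
  qed (use S in \<open>auto simp: N\<close>)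
  moreover have "bij_betw f (carrier M) (carrier N)"
    using inj by (auto simp: f_def N bij_betw_def inj_on_def)
  ultimately show ?thesis using rN f by (auto simp: mod_cat_def)
qed

end

theory Submission
  imports Defs
begin

text \<open>
  The cokernel functor \<open>\<P>(\<Lambda>) \<rightarrow> mod-\<Lambda>\<close> is full, and it is dense because finitely generated modules
  over an Artin algebra are finitely presented. A morphism of \<open>\<P>(\<Lambda>)\<close> has zero cokernel iff it factors
  through an object \<open>(P \<rightarrow> 0) \<oplus> (Q = Q)\<close>, and the summands of these are exactly the injective objects
  of the exact category \<open>\<P>(\<Lambda>)\<close>, i.e. the objects \<open>f\<close> with \<open>f\<close> surjective. So mod-\<open>\<Lambda>\<close> is the quotient of
  \<open>\<P>(\<Lambda>)\<close> by the morphisms that factor through injectives, which depends only on the exact structure.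
  An equivalence is not assumed to be additive, so the congruence is expressed without subtraction.
\<close>

section \<open>Full dense functors and equivalences\<close>

text \<open>Suppose a map (a1, a2) from f : P -> Q to f' : P' -> Q' has zero cokernel. Then a2 maps
  into the image of f' and, Q being projective, a2 = f' l for some l. What remains in the first
  component, a1 - l f, has values in the kernel of f'. So the map is the sum of one through P -> 0
  and one through Q = Q. Surjective f are injective objects because conflations split componentwise,
  and the failure of the two retractions to commute with the structure maps can be lifted along f
  and subtracted.

  Hom-sets are bare sets, and an equivalence is only known to respect composites, identities and
  conflations. Hence injectivity is expressed by the splitting of conflations, and the quotient
  category is never built: two full dense functors on the same category that identify the same pairs
  of morphisms have equivalent targets. The chain condition enters through density, where the kernel
  of a surjection Q -> M has to be finitely generated; this is why artinian commutative rings are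
  shown to be noetherian.\<close>

locale cat =
  fixes C :: "('o, 'm, 'z) category_scheme"
  assumes is_category: "is_category C"
begin

lemma id_in [simp]: "X \<in> cat_obj C \<Longrightarrow> cat_id C X \<in> cat_hom C X X"
  using is_category by (simp add: is_category_def)

lemma comp_in [simp]:
  "X \<in> cat_obj C \<Longrightarrow> Y \<in> cat_obj C \<Longrightarrow> Z \<in> cat_obj C \<Longrightarrow> f \<in> cat_hom C X Y \<Longrightarrow> g \<in> cat_hom C Y Z \<Longrightarrow>
   cat_comp C X Y Z g f \<in> cat_hom C X Z"
  using is_category by (simp add: is_category_def)

lemma comp_id [simp]:
  assumes "X \<in> cat_obj C" "Y \<in> cat_obj C" "f \<in> cat_hom C X Y"
  shows "cat_comp C X X Y f (cat_id C X) = f" "cat_comp C X Y Y (cat_id C Y) f = f"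
  using is_category assms by (simp_all add: is_category_def)

lemma assoc:
  "W \<in> cat_obj C \<Longrightarrow> X \<in> cat_obj C \<Longrightarrow> Y \<in> cat_obj C \<Longrightarrow> Z \<in> cat_obj C \<Longrightarrow>
   f \<in> cat_hom C W X \<Longrightarrow> g \<in> cat_hom C X Y \<Longrightarrow> h \<in> cat_hom C Y Z \<Longrightarrow>
   cat_comp C W X Z (cat_comp C X Y Z h g) f = cat_comp C W Y Z h (cat_comp C W X Y g f)"
  using is_category by (simp add: is_category_def)

text \<open>Rewriting with \<open>assoc\<close> moves all brackets to the right, which hides an
  inverse pair inside a longer composite. This is the inverse law in that nested shape.\<close>

lemma comp_cancel:
  assumes "W \<in> cat_obj C" "X \<in> cat_obj C" "Y \<in> cat_obj C"
    and "f \<in> cat_hom C W X" "u \<in> cat_hom C X Y" "v \<in> cat_hom C Y X"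
    and "cat_comp C X Y X v u = cat_id C X"
  shows "cat_comp C W Y X v (cat_comp C W X Y u f) = f"
  using assms assoc[of W X Y X f u v] by simp

lemma isoE:
  assumes "cat_iso C X Y f"
  obtains g where "f \<in> cat_hom C X Y" "g \<in> cat_hom C Y X"
    "cat_comp C X Y X g f = cat_id C X" "cat_comp C Y X Y f g = cat_id C Y"
  using assms by (auto simp: cat_iso_def)

lemma iso_comp:
  assumes "X \<in> cat_obj C" "Y \<in> cat_obj C" "Z \<in> cat_obj C" "cat_iso C X Y f" "cat_iso C Y Z g"
  shows "cat_iso C X Z (cat_comp C X Y Z g f)"
proof -
  obtain f' where f: "f \<in> cat_hom C X Y" "f' \<in> cat_hom C Y X"
    "cat_comp C X Y X f' f = cat_id C X" "cat_comp C Y X Y f f' = cat_id C Y"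
    using assms(4) by (rule isoE)
  obtain g' where g: "g \<in> cat_hom C Y Z" "g' \<in> cat_hom C Z Y"
    "cat_comp C Y Z Y g' g = cat_id C Y" "cat_comp C Z Y Z g g' = cat_id C Z"
    using assms(5) by (rule isoE)
  show ?thesis
    unfolding cat_iso_def
    using assms(1-3) f g by (intro conjI bexI[of _ "cat_comp C Z Y X f' g'"]) (simp_all add: assoc comp_cancel)
qed

end

definition full_functor ::
    "('o, 'm, 'y) category_scheme \<Rightarrow> ('p, 'n, 'z) category_scheme \<Rightarrow> ('o, 'm, 'p, 'n) cat_map \<Rightarrow> bool" where
  "full_functor C D F \<longleftrightarrow> (\<forall>X\<in>cat_obj C. \<forall>Y\<in>cat_obj C. \<forall>h\<in>cat_hom D (on_obj F X) (on_obj F Y).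
     \<exists>f\<in>cat_hom C X Y. on_hom F X Y f = h)"

definition faithful_functor :: "('o, 'm, 'y) category_scheme \<Rightarrow> ('o, 'm, 'p, 'n) cat_map \<Rightarrow> bool" where
  "faithful_functor C F \<longleftrightarrow> (\<forall>X\<in>cat_obj C. \<forall>Y\<in>cat_obj C. \<forall>f\<in>cat_hom C X Y. \<forall>g\<in>cat_hom C X Y.
     on_hom F X Y f = on_hom F X Y g \<longrightarrow> f = g)"

definition dense_functor ::
    "('o, 'm, 'y) category_scheme \<Rightarrow> ('p, 'n, 'z) category_scheme \<Rightarrow> ('o, 'm, 'p, 'n) cat_map \<Rightarrow> bool" where
  "dense_functor C D F \<longleftrightarrow> (\<forall>N\<in>cat_obj D. \<exists>X\<in>cat_obj C. \<exists>u. cat_iso D (on_obj F X) N u)"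

locale cat_functor = C: cat C + D: cat D
  for C :: "('o, 'm, 'y) category_scheme" and D :: "('p, 'n, 'z) category_scheme" +
  fixes F :: "('o, 'm, 'p, 'n) cat_map"
  assumes is_functor: "is_functor C D F"
begin

lemma obj_in [simp]: "X \<in> cat_obj C \<Longrightarrow> on_obj F X \<in> cat_obj D"
  using is_functor by (simp add: is_functor_def)

lemma hom_in [simp]:
  "X \<in> cat_obj C \<Longrightarrow> Y \<in> cat_obj C \<Longrightarrow> f \<in> cat_hom C X Y \<Longrightarrow>
   on_hom F X Y f \<in> cat_hom D (on_obj F X) (on_obj F Y)"
  using is_functor by (simp add: is_functor_def)

lemma map_id: "X \<in> cat_obj C \<Longrightarrow> on_hom F X X (cat_id C X) = cat_id D (on_obj F X)"
  using is_functor by (simp add: is_functor_def)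

lemma map_comp:
  "X \<in> cat_obj C \<Longrightarrow> Y \<in> cat_obj C \<Longrightarrow> Z \<in> cat_obj C \<Longrightarrow> f \<in> cat_hom C X Y \<Longrightarrow> g \<in> cat_hom C Y Z \<Longrightarrow>
   on_hom F X Z (cat_comp C X Y Z g f) =
   cat_comp D (on_obj F X) (on_obj F Y) (on_obj F Z) (on_hom F Y Z g) (on_hom F X Y f)"
  using is_functor by (simp add: is_functor_def)

lemma map_iso:
  assumes "X \<in> cat_obj C" "Y \<in> cat_obj C" "cat_iso C X Y f"
  shows "cat_iso D (on_obj F X) (on_obj F Y) (on_hom F X Y f)"
proof -
  obtain g where g: "f \<in> cat_hom C X Y" "g \<in> cat_hom C Y X"
    "cat_comp C X Y X g f = cat_id C X" "cat_comp C Y X Y f g = cat_id C Y"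
    using assms(3) by (rule C.isoE)
  show ?thesis
    unfolding cat_iso_def using assms(1,2) g
    by (intro conjI bexI[of _ "on_hom F Y X g"]) (simp_all flip: map_comp map_id)
qed

text \<open>Uniqueness of lifts along a full and faithful \<open>F\<close> reduces every functor law
  of the inverse and the laws of the unit to identities in \<open>D\<close>, checked after applying
  \<open>F\<close>.\<close>

lemma equivalence_if_full_faithful_dense:
  assumes full: "full_functor C D F" and faithful: "faithful_functor C F" and dense: "dense_functor C D F"
  shows "is_equivalence C D F"
proof -
  have "\<forall>N\<in>cat_obj D. \<exists>X u v. X \<in> cat_obj C \<and> u \<in> cat_hom D (on_obj F X) N \<and> v \<in> cat_hom D N (on_obj F X) \<and>
      cat_comp D (on_obj F X) N (on_obj F X) v u = cat_id D (on_obj F X) \<and>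
      cat_comp D N (on_obj F X) N u v = cat_id D N"
    using dense unfolding dense_functor_def cat_iso_def by blast
  then obtain G e e' where G [simp]: "\<And>N. N \<in> cat_obj D \<Longrightarrow> G N \<in> cat_obj C"
    and e [simp]: "\<And>N. N \<in> cat_obj D \<Longrightarrow> e N \<in> cat_hom D (on_obj F (G N)) N"
      "\<And>N. N \<in> cat_obj D \<Longrightarrow> e' N \<in> cat_hom D N (on_obj F (G N))"
    and ee: "\<And>N. N \<in> cat_obj D \<Longrightarrow> cat_comp D (on_obj F (G N)) N (on_obj F (G N)) (e' N) (e N) = cat_id D (on_obj F (G N))"
      "\<And>N. N \<in> cat_obj D \<Longrightarrow> cat_comp D N (on_obj F (G N)) N (e N) (e' N) = cat_id D N"
    by metis
  define lft where "lft X Y h = (SOME f. f \<in> cat_hom C X Y \<and> on_hom F X Y f = h)" for X Y h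
  have lft: "lft X Y h \<in> cat_hom C X Y" "on_hom F X Y (lft X Y h) = h"
    if "X \<in> cat_obj C" "Y \<in> cat_obj C" "h \<in> cat_hom D (on_obj F X) (on_obj F Y)" for X Y h
    using someI_ex[of "\<lambda>f. f \<in> cat_hom C X Y \<and> on_hom F X Y f = h"] full that
    unfolding full_functor_def lft_def by blast+
  have inj: "f = g" if "X \<in> cat_obj C" "Y \<in> cat_obj C" "f \<in> cat_hom C X Y" "g \<in> cat_hom C X Y"
    "on_hom F X Y f = on_hom F X Y g" for X Y f g
    using faithful that unfolding faithful_functor_def by blast
  \<comment> \<open>Conjugation with the chosen isomorphisms turns \<open>h\<close> into a map
    between objects in the image of \<open>F\<close>, where fullness applies.\<close>
  define c where "c N N' h = cat_comp D (on_obj F (G N)) N' (on_obj F (G N')) (e' N')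
      (cat_comp D (on_obj F (G N)) N N' h (e N))" for N N' h
  have c [simp]: "c N N' h \<in> cat_hom D (on_obj F (G N)) (on_obj F (G N'))"
    if "N \<in> cat_obj D" "N' \<in> cat_obj D" "h \<in> cat_hom D N N'" for N N' h
    using that by (simp add: c_def)
  define GG where "GG = \<lparr>on_obj = G, on_hom = (\<lambda>N N' h. lft (G N) (G N') (c N N' h))\<rparr>"
  have GG: "on_obj GG N = G N" "on_hom GG N N' h = lft (G N) (G N') (c N N' h)" for N N' h
    by (simp_all add: GG_def)
  have functor_GG: "is_functor D C GG"
    unfolding is_functor_def GG
  proof (intro conjI ballI)
    fix N assume N: "N \<in> cat_obj D"
    show "lft (G N) (G N) (c N N (cat_id D N)) = cat_id C (G N)"
      using N by (intro inj[of "G N" "G N"]) (simp_all add: lft map_id, simp add: c_def ee)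
  next
    fix X Y Z f g assume a: "X \<in> cat_obj D" "Y \<in> cat_obj D" "Z \<in> cat_obj D"
      "f \<in> cat_hom D X Y" "g \<in> cat_hom D Y Z"
    show "lft (G X) (G Z) (c X Z (cat_comp D X Y Z g f)) =
      cat_comp C (G X) (G Y) (G Z) (lft (G Y) (G Z) (c Y Z g)) (lft (G X) (G Y) (c X Y f))"
      using a by (intro inj[of "G X" "G Z"]) (simp_all add: lft map_comp, simp add: c_def D.assoc D.comp_cancel ee)
  qed (simp_all add: lft)
  \<comment> \<open>The unit at \<open>X\<close> is the lift of the inverse of the isomorphism
    chosen for \<open>F X\<close>; its own inverse will be the lift of that isomorphism.\<close>
  define \<eta> where "\<eta> X = lft X (G (on_obj F X)) (e' (on_obj F X))" for X
  have \<eta>: "\<eta> X \<in> cat_hom C X (G (on_obj F X))" "on_hom F X (G (on_obj F X)) (\<eta> X) = e' (on_obj F X)"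
    if "X \<in> cat_obj C" for X
    using that by (simp_all add: \<eta>_def lft)
  have 1: "natural_iso C C functor_id (functor_comp GG F) \<eta>"
    unfolding natural_iso_def
  proof (intro conjI ballI)
    fix X assume X: "X \<in> cat_obj C"
    let ?G = "G (on_obj F X)"
    let ?v = "lft ?G X (e (on_obj F X))"
    have v: "?v \<in> cat_hom C ?G X" "on_hom F ?G X ?v = e (on_obj F X)"
      using X by (simp_all add: lft)
    have "cat_iso C X ?G (\<eta> X)"
      unfolding cat_iso_def
    proof (intro conjI bexI)
      show "cat_comp C X ?G X ?v (\<eta> X) = cat_id C X"
        using X v \<eta> by (intro inj[of X X]) (simp_all add: map_comp map_id ee)
      show "cat_comp C ?G X ?G (\<eta> X) ?v = cat_id C ?G"
        using X v \<eta> by (intro inj[of ?G ?G]) (simp_all add: map_comp map_id ee)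
    qed (use X v \<eta> in simp_all)
    then show "cat_iso C (on_obj functor_id X) (on_obj (functor_comp GG F) X) (\<eta> X)"
      by (simp add: functor_id_def functor_comp_def GG)
  next
    fix X Y f assume a: "X \<in> cat_obj C" "Y \<in> cat_obj C" "f \<in> cat_hom C X Y"
    let ?G = "\<lambda>X. G (on_obj F X)"
    have "cat_comp C X Y (?G Y) (\<eta> Y) f =
      cat_comp C X (?G X) (?G Y) (lft (?G X) (?G Y) (c (on_obj F X) (on_obj F Y) (on_hom F X Y f))) (\<eta> X)"
      using a \<eta> by (intro inj[of X "?G Y"]) (simp_all add: lft map_comp, simp add: c_def D.assoc ee)
    then show "cat_comp C (on_obj functor_id X) (on_obj functor_id Y) (on_obj (functor_comp GG F) Y) (\<eta> Y)
        (on_hom functor_id X Y f) =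
      cat_comp C (on_obj functor_id X) (on_obj (functor_comp GG F) X) (on_obj (functor_comp GG F) Y)
        (on_hom (functor_comp GG F) X Y f) (\<eta> X)"
      by (simp add: functor_id_def functor_comp_def GG)
  qed
  have 2: "natural_iso D D (functor_comp F GG) functor_id e"
    unfolding natural_iso_def
  proof (intro conjI ballI)
    fix N assume "N \<in> cat_obj D"
    then show "cat_iso D (on_obj (functor_comp F GG) N) (on_obj functor_id N) (e N)"
      unfolding cat_iso_def
      by (intro conjI bexI[of _ "e' N"]) (simp_all add: functor_comp_def functor_id_def GG ee)
  next
    fix X Y f assume a: "X \<in> cat_obj D" "Y \<in> cat_obj D" "f \<in> cat_hom D X Y"
    then show "cat_comp D (on_obj (functor_comp F GG) X) (on_obj (functor_comp F GG) Y) (on_obj functor_id Y) (e Y)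
        (on_hom (functor_comp F GG) X Y f) =
      cat_comp D (on_obj (functor_comp F GG) X) (on_obj functor_id X) (on_obj functor_id Y)
        (on_hom functor_id X Y f) (e X)"
      by (simp add: functor_comp_def functor_id_def GG lft) (simp add: c_def D.comp_cancel[OF _ _ _ _ _ _ ee(2)])
  qed
  show ?thesis
    unfolding is_equivalence_def using is_functor functor_GG 1 2 by blast
qed

end

text \<open>Both \<open>D\<close> and \<open>E\<close> are the quotient of \<open>C\<close> by one
  congruence. The comparison functor lifts along \<open>K\<close> and applies \<open>J\<close>: one
  direction of \<open>ker\<close> makes the result independent of the lift, the other makes the
  functor faithful.\<close>

lemma equivalent_if_same_kernel:
  assumes "cat_functor C D K" "cat_functor C E J"
    and fullK: "full_functor C D K" and denseK: "dense_functor C D K"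
    and fullJ: "full_functor C E J" and denseJ: "dense_functor C E J"
    and ker: "\<And>X Y a b. \<lbrakk>X \<in> cat_obj C; Y \<in> cat_obj C; a \<in> cat_hom C X Y; b \<in> cat_hom C X Y\<rbrakk> \<Longrightarrow>
      on_hom K X Y a = on_hom K X Y b \<longleftrightarrow> on_hom J X Y a = on_hom J X Y b"
  shows "equivalent_categories D E"
proof -
  interpret K: cat_functor C D K by fact
  interpret J: cat_functor C E J by fact
  have "\<forall>N\<in>cat_obj D. \<exists>X u v. X \<in> cat_obj C \<and> u \<in> cat_hom D (on_obj K X) N \<and> v \<in> cat_hom D N (on_obj K X) \<and>
      cat_comp D (on_obj K X) N (on_obj K X) v u = cat_id D (on_obj K X) \<and>
      cat_comp D N (on_obj K X) N u v = cat_id D N"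
    using denseK unfolding dense_functor_def cat_iso_def by blast
  then obtain G e e' where G [simp]: "\<And>N. N \<in> cat_obj D \<Longrightarrow> G N \<in> cat_obj C"
    and e [simp]: "\<And>N. N \<in> cat_obj D \<Longrightarrow> e N \<in> cat_hom D (on_obj K (G N)) N"
      "\<And>N. N \<in> cat_obj D \<Longrightarrow> e' N \<in> cat_hom D N (on_obj K (G N))"
    and ee: "\<And>N. N \<in> cat_obj D \<Longrightarrow> cat_comp D (on_obj K (G N)) N (on_obj K (G N)) (e' N) (e N) = cat_id D (on_obj K (G N))"
      "\<And>N. N \<in> cat_obj D \<Longrightarrow> cat_comp D N (on_obj K (G N)) N (e N) (e' N) = cat_id D N"
    by metis
  define lft where "lft X Y h = (SOME f. f \<in> cat_hom C X Y \<and> on_hom K X Y f = h)" for X Y h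
  have lft: "lft X Y h \<in> cat_hom C X Y" "on_hom K X Y (lft X Y h) = h"
    if "X \<in> cat_obj C" "Y \<in> cat_obj C" "h \<in> cat_hom D (on_obj K X) (on_obj K Y)" for X Y h
    using someI_ex[of "\<lambda>f. f \<in> cat_hom C X Y \<and> on_hom K X Y f = h"] fullK that
    unfolding full_functor_def lft_def by blast+
  define c where "c N N' h = cat_comp D (on_obj K (G N)) N' (on_obj K (G N')) (e' N')
      (cat_comp D (on_obj K (G N)) N N' h (e N))" for N N' h
  have c [simp]: "c N N' h \<in> cat_hom D (on_obj K (G N)) (on_obj K (G N'))"
    if "N \<in> cat_obj D" "N' \<in> cat_obj D" "h \<in> cat_hom D N N'" for N N' h
    using that by (simp add: c_def)
  \<comment> \<open>\<open>d\<close> inverts the conjugation \<open>c\<close>; it turns maps between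
    \<open>K\<close>-images back into maps of \<open>D\<close> and yields the preimages for
    fullness.\<close>
  define d where "d N N' k = cat_comp D N (on_obj K (G N)) N' 
      (cat_comp D (on_obj K (G N)) (on_obj K (G N')) N' (e N') k) (e' N)" for N N' k
  have d [simp]: "d N N' k \<in> cat_hom D N N'"
    if "N \<in> cat_obj D" "N' \<in> cat_obj D" "k \<in> cat_hom D (on_obj K (G N)) (on_obj K (G N'))" for N N' k
    using that by (simp add: d_def)
  have dc: "d N N' (c N N' h) = h"
    if "N \<in> cat_obj D" "N' \<in> cat_obj D" "h \<in> cat_hom D N N'" for N N' h
    using that by (simp add: c_def d_def K.D.assoc ee K.D.comp_cancel[OF _ _ _ _ _ _ ee(2)])
  have cd: "c N N' (d N N' k) = k"
    if "N \<in> cat_obj D" "N' \<in> cat_obj D" "k \<in> cat_hom D (on_obj K (G N)) (on_obj K (G N'))" for N N' k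
    using that by (simp add: c_def d_def K.D.assoc ee K.D.comp_cancel[OF _ _ _ _ _ _ ee(1)])
  define H where "H = \<lparr>on_obj = (\<lambda>N. on_obj J (G N)),
    on_hom = (\<lambda>N N' h. on_hom J (G N) (G N') (lft (G N) (G N') (c N N' h)))\<rparr>"
  have H: "on_obj H N = on_obj J (G N)"
    "on_hom H N N' h = on_hom J (G N) (G N') (lft (G N) (G N') (c N N' h))" for N N' h
    by (simp_all add: H_def)
  have "is_functor D E H"
    unfolding is_functor_def H
  proof (intro conjI ballI)
    fix N assume N: "N \<in> cat_obj D"
    \<comment> \<open>The chosen lift of an identity need not be an identity. Both have the same
      image under \<open>K\<close>, and \<open>ker\<close> carries this equality over to
      \<open>J\<close>.\<close>
    have "on_hom J (G N) (G N) (lft (G N) (G N) (c N N (cat_id D N))) = on_hom J (G N) (G N) (cat_id C (G N))"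
      using N by (subst ker[symmetric]) (simp_all add: lft K.map_id, simp add: c_def ee)
    then show "on_hom J (G N) (G N) (lft (G N) (G N) (c N N (cat_id D N))) = cat_id E (on_obj J (G N))"
      using N by (simp add: J.map_id)
  next
    fix X Y Z f g assume a: "X \<in> cat_obj D" "Y \<in> cat_obj D" "Z \<in> cat_obj D"
      "f \<in> cat_hom D X Y" "g \<in> cat_hom D Y Z"
    have "on_hom J (G X) (G Z) (lft (G X) (G Z) (c X Z (cat_comp D X Y Z g f))) =
      on_hom J (G X) (G Z) (cat_comp C (G X) (G Y) (G Z) (lft (G Y) (G Z) (c Y Z g)) (lft (G X) (G Y) (c X Y f)))"
      using a by (subst ker[symmetric]) (simp_all add: lft K.map_comp, simp add: c_def K.D.assoc K.D.comp_cancel ee)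
    then show "on_hom J (G X) (G Z) (lft (G X) (G Z) (c X Z (cat_comp D X Y Z g f))) =
      cat_comp E (on_obj J (G X)) (on_obj J (G Y)) (on_obj J (G Z))
        (on_hom J (G Y) (G Z) (lft (G Y) (G Z) (c Y Z g))) (on_hom J (G X) (G Y) (lft (G X) (G Y) (c X Y f)))"
      using a by (simp add: J.map_comp lft)
  qed (simp_all add: lft)
  then interpret H: cat_functor D E H by unfold_locales
  have "full_functor D E H"
    unfolding full_functor_def H
  proof (intro ballI)
    fix X Y k assume a: "X \<in> cat_obj D" "Y \<in> cat_obj D" "k \<in> cat_hom E (on_obj J (G X)) (on_obj J (G Y))"
    then obtain f where f: "f \<in> cat_hom C (G X) (G Y)" "on_hom J (G X) (G Y) f = k"
      using fullJ unfolding full_functor_def by (meson G)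
    have "on_hom J (G X) (G Y) (lft (G X) (G Y) (c X Y (d X Y (on_hom K (G X) (G Y) f)))) = on_hom J (G X) (G Y) f"
      using a f by (subst ker[symmetric]) (simp_all add: lft cd)
    then show "\<exists>h\<in>cat_hom D X Y. on_hom J (G X) (G Y) (lft (G X) (G Y) (c X Y h)) = k"
      using a f by (intro bexI[of _ "d X Y (on_hom K (G X) (G Y) f)"]) simp_all
  qed
  moreover have "faithful_functor D H"
    unfolding faithful_functor_def H
  proof (intro ballI impI)
    fix X Y f g assume a: "X \<in> cat_obj D" "Y \<in> cat_obj D" "f \<in> cat_hom D X Y" "g \<in> cat_hom D X Y"
      and "on_hom J (G X) (G Y) (lft (G X) (G Y) (c X Y f)) = on_hom J (G X) (G Y) (lft (G X) (G Y) (c X Y g))"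
    then have "c X Y f = c X Y g"
      by (subst (asm) ker[symmetric]) (simp_all add: lft)
    then show "f = g" using a dc by metis
  qed
  moreover have "dense_functor D E H"
    unfolding dense_functor_def H
  proof
    fix N assume N: "N \<in> cat_obj E"
    then obtain Y u where Y: "Y \<in> cat_obj C" and u: "cat_iso E (on_obj J Y) N u"
      using denseJ unfolding dense_functor_def by blast
    define M where "M = on_obj K Y"
    have M: "M \<in> cat_obj D" using Y by (simp add: M_def)
    \<comment> \<open>These lift inverse isomorphisms between the \<open>K\<close>-images of
      \<open>G M\<close> and \<open>Y\<close>. They need not be inverse to each other in
      \<open>C\<close>, but they become so under \<open>K\<close> and hence under
      \<open>J\<close>.\<close>
    let ?f = "lft (G M) Y (e M)" and ?g = "lft Y (G M) (e' M)"
    have f: "?f \<in> cat_hom C (G M) Y" "on_hom K (G M) Y ?f = e M"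
      using Y e(1)[OF M] M lft by (simp_all add: M_def)
    have g: "?g \<in> cat_hom C Y (G M)" "on_hom K Y (G M) ?g = e' M"
      using Y e(2)[OF M] M lft by (simp_all add: M_def)
    have K1: "on_hom K (G M) (G M) (cat_comp C (G M) Y (G M) ?g ?f) = on_hom K (G M) (G M) (cat_id C (G M))"
      using Y M f g ee(1)[OF M] by (simp add: K.map_comp K.map_id) (simp add: M_def)
    have K2: "on_hom K Y Y (cat_comp C Y (G M) Y ?f ?g) = on_hom K Y Y (cat_id C Y)"
      using Y M f g ee(2)[OF M] by (simp add: K.map_comp K.map_id) (simp add: M_def)
    have "on_hom J (G M) (G M) (cat_comp C (G M) Y (G M) ?g ?f) = on_hom J (G M) (G M) (cat_id C (G M))"
      "on_hom J Y Y (cat_comp C Y (G M) Y ?f ?g) = on_hom J Y Y (cat_id C Y)"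
      using K1 K2 Y M f g by (simp_all add: ker)
    then have "cat_iso E (on_obj J (G M)) (on_obj J Y) (on_hom J (G M) Y ?f)"
      using Y M f g unfolding cat_iso_def
      by (intro conjI bexI[of _ "on_hom J Y (G M) ?g"]) (simp_all flip: J.map_comp J.map_id)
    then have "cat_iso E (on_obj J (G M)) N (cat_comp E (on_obj J (G M)) (on_obj J Y) N u (on_hom J (G M) Y ?f))"
      using J.D.iso_comp u Y M N by auto
    then show "\<exists>X\<in>cat_obj D. \<exists>u. cat_iso E (on_obj J (G X)) N u" using M by blast
  qed
  ultimately have "is_equivalence D E H"
    by (rule H.equivalence_if_full_faithful_dense)
  then show ?thesis unfolding equivalent_categories_def by blast
qed

section \<open>Inverse equivalences; equivalences are full, faithful and dense\<close>

text \<open>\<open>is_equivalence\<close> fixes the directions of unit and counit; exchanging the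
  two functors requires both to be reversed.\<close>

lemma natural_iso_inverse:
  assumes "is_category C" "is_category D" "is_functor C D F" "is_functor C D G" "natural_iso C D F G t"
  shows "\<exists>s. natural_iso C D G F s"
proof -
  interpret F: cat_functor C D F by unfold_locales fact+
  interpret G: cat_functor C D G by unfold_locales fact+
  have t: "t X \<in> cat_hom D (on_obj F X) (on_obj G X)"
    "\<exists>s. s \<in> cat_hom D (on_obj G X) (on_obj F X) \<and>
      cat_comp D (on_obj F X) (on_obj G X) (on_obj F X) s (t X) = cat_id D (on_obj F X) \<and>
      cat_comp D (on_obj G X) (on_obj F X) (on_obj G X) (t X) s = cat_id D (on_obj G X)"
    if "X \<in> cat_obj C" for X
    using assms(5) that unfolding natural_iso_def cat_iso_def by blast+
  then obtain s where s: "\<And>X. X \<in> cat_obj C \<Longrightarrow> s X \<in> cat_hom D (on_obj G X) (on_obj F X)"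
    "\<And>X. X \<in> cat_obj C \<Longrightarrow> cat_comp D (on_obj F X) (on_obj G X) (on_obj F X) (s X) (t X) = cat_id D (on_obj F X)"
    "\<And>X. X \<in> cat_obj C \<Longrightarrow> cat_comp D (on_obj G X) (on_obj F X) (on_obj G X) (t X) (s X) = cat_id D (on_obj G X)"
    by metis
  have "natural_iso C D G F s"
    unfolding natural_iso_def
  proof (intro conjI ballI)
    fix X assume "X \<in> cat_obj C"
    then show "cat_iso D (on_obj G X) (on_obj F X) (s X)"
      unfolding cat_iso_def using t(1) s by blast
  next
    fix X Y f assume a: "X \<in> cat_obj C" "Y \<in> cat_obj C" "f \<in> cat_hom C X Y"
    let ?GX = "on_obj G X" and ?FX = "on_obj F X" and ?GY = "on_obj G Y" and ?FY = "on_obj F Y"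
    have nat: "cat_comp D ?FX ?FY ?GY (t Y) (on_hom F X Y f) = cat_comp D ?FX ?GX ?GY (on_hom G X Y f) (t X)"
      using assms(5) a unfolding natural_iso_def by blast
    have "cat_comp D ?GX ?GY ?FY (s Y) (on_hom G X Y f) =
        cat_comp D ?GX ?GY ?FY (s Y) (cat_comp D ?GX ?FX ?GY (cat_comp D ?FX ?GX ?GY (on_hom G X Y f) (t X)) (s X))"
      using a t s by (simp add: F.D.assoc)
    also have "\<dots> = cat_comp D ?GX ?FX ?FY (on_hom F X Y f) (s X)"
      using a t s by (simp add: F.D.assoc F.D.comp_cancel flip: nat)
    finally show "cat_comp D ?GX ?GY ?FY (s Y) (on_hom G X Y f) = cat_comp D ?GX ?FX ?FY (on_hom F X Y f) (s X)" .
  qed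
  then show ?thesis by blast
qed

lemma is_functor_id: "is_functor C C functor_id"
  by (simp add: is_functor_def functor_id_def)

lemma is_functor_comp: "is_functor C D F \<Longrightarrow> is_functor D E G \<Longrightarrow> is_functor C E (functor_comp G F)"
  by (simp add: is_functor_def functor_comp_def)

text \<open>By naturality the composite of \<open>f\<close> with \<open>\<eta> Y\<close> can be
  written with \<open>G (F f)\<close>, so it depends on \<open>F f\<close> alone, and
  \<open>\<eta> Y\<close> can be cancelled.\<close>

lemma faithful_if_left_inverse:
  assumes "is_category C" "is_functor C D F" "is_functor D C G"
    and "natural_iso C C functor_id (functor_comp G F) \<eta>"
  shows "faithful_functor C F"
  unfolding faithful_functor_def
proof (intro ballI impI)
  fix X Y f g assume a: "X \<in> cat_obj C" "Y \<in> cat_obj C" "f \<in> cat_hom C X Y" "g \<in> cat_hom C X Y"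
    "on_hom F X Y f = on_hom F X Y g"
  interpret C: cat C by unfold_locales fact
  let ?GY = "on_obj G (on_obj F Y)"
  have GY: "?GY \<in> cat_obj C"
    using is_functor_comp[OF assms(2,3)] a by (simp add: is_functor_def functor_comp_def)
  have eq: "cat_comp C X Y ?GY (\<eta> Y) f = cat_comp C X Y ?GY (\<eta> Y) g"
    using assms(4) a unfolding natural_iso_def by (simp add: functor_id_def functor_comp_def)
  have "cat_iso C Y ?GY (\<eta> Y)"
    using assms(4) a unfolding natural_iso_def by (simp add: functor_id_def functor_comp_def)
  then obtain s where s: "\<eta> Y \<in> cat_hom C Y ?GY" "s \<in> cat_hom C ?GY Y" "cat_comp C Y ?GY Y s (\<eta> Y) = cat_id C Y"
    by (auto simp: cat_iso_def)
  show "f = g" using C.comp_cancel[OF a(1,2) GY _ s(1,2,3)] a(3,4) eq by metis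
qed

lemma equivalence_sym:
  assumes "is_category C" "is_category D" "is_functor C D F" "is_functor D C G"
    and "natural_iso C C functor_id (functor_comp G F) \<eta>"
    and "natural_iso D D (functor_comp F G) functor_id \<epsilon>"
  shows "is_equivalence D C G"
proof -
  obtain s where s: "natural_iso C C (functor_comp G F) functor_id s"
    using natural_iso_inverse[OF assms(1,1) is_functor_id is_functor_comp[OF assms(3,4)] assms(5)] ..
  obtain t where t: "natural_iso D D functor_id (functor_comp F G) t"
    using natural_iso_inverse[OF assms(2,2) is_functor_comp[OF assms(4,3)] is_functor_id assms(6)] ..
  show ?thesis
    unfolding is_equivalence_def
    by (intro conjI exI[of _ F] exI[of _ t] exI[of _ s]) (rule assms s t)+
qed

text \<open>Fullness is obtained from faithfulness of the quasi-inverse \<open>G\<close>: a preimage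
  \<open>f\<close> of \<open>h\<close> only has to satisfy \<open>G (F f) = G h\<close>.\<close>

lemma equivalence_full_faithful_dense:
  assumes "is_category C" "is_category D" "is_equivalence C D F"
  shows "full_functor C D F" "faithful_functor C F" "dense_functor C D F"
proof -
  obtain G \<eta> \<epsilon> where F: "is_functor C D F" and G: "is_functor D C G"
    and \<eta>: "natural_iso C C functor_id (functor_comp G F) \<eta>"
    and \<epsilon>: "natural_iso D D (functor_comp F G) functor_id \<epsilon>"
    using assms(3) unfolding is_equivalence_def by blast
  interpret F: cat_functor C D F by unfold_locales fact+
  interpret G: cat_functor D C G by unfold_locales fact+
  show "faithful_functor C F" using faithful_if_left_inverse[OF assms(1) F G \<eta>] .
  obtain t where "natural_iso D D functor_id (functor_comp F G) t"
    using natural_iso_inverse[OF assms(2,2) is_functor_comp[OF G F] is_functor_id \<epsilon>] ..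
  then have faithfulG: "faithful_functor D G"
    by (rule faithful_if_left_inverse[OF assms(2) G F])
  show "dense_functor C D F"
    unfolding dense_functor_def
    using \<epsilon> unfolding natural_iso_def by (auto simp: functor_comp_def functor_id_def intro: G.obj_in)
  show "full_functor C D F"
    unfolding full_functor_def
  proof (intro ballI)
    fix X Y h assume a: "X \<in> cat_obj C" "Y \<in> cat_obj C" "h \<in> cat_hom D (on_obj F X) (on_obj F Y)"
    let ?GX = "on_obj G (on_obj F X)" and ?GY = "on_obj G (on_obj F Y)"
    have iso: "cat_iso C X ?GX (\<eta> X)" "cat_iso C Y ?GY (\<eta> Y)"
      using \<eta> a unfolding natural_iso_def by (simp_all add: functor_id_def functor_comp_def)
    obtain s where X: "\<eta> X \<in> cat_hom C X ?GX" "s \<in> cat_hom C ?GX X" "cat_comp C ?GX X ?GX (\<eta> X) s = cat_id C ?GX"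
      using iso(1) by (auto simp: cat_iso_def)
    obtain t where Y: "\<eta> Y \<in> cat_hom C Y ?GY" "t \<in> cat_hom C ?GY Y" "cat_comp C ?GY Y ?GY (\<eta> Y) t = cat_id C ?GY"
      using iso(2) by (auto simp: cat_iso_def)
    \<comment> \<open>The formula is forced: by naturality, \<open>\<eta> Y\<close> after
      \<open>f\<close> has to equal \<open>G h\<close> after \<open>\<eta> X\<close>.\<close>
    define f where "f = cat_comp C X ?GY Y t (cat_comp C X ?GX ?GY (on_hom G (on_obj F X) (on_obj F Y) h) (\<eta> X))"
    have f: "f \<in> cat_hom C X Y" using a X Y by (simp add: f_def)
    let ?GFf = "on_hom G (on_obj F X) (on_obj F Y) (on_hom F X Y f)"
    have "cat_comp C X Y ?GY (\<eta> Y) f = cat_comp C X ?GX ?GY ?GFf (\<eta> X)"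
      using \<eta> a f unfolding natural_iso_def by (simp add: functor_id_def functor_comp_def)
    moreover have "cat_comp C X Y ?GY (\<eta> Y) f = cat_comp C X ?GX ?GY (on_hom G (on_obj F X) (on_obj F Y) h) (\<eta> X)"
      using a X Y by (simp add: f_def F.C.comp_cancel)
    ultimately have eq: "cat_comp C X ?GX ?GY ?GFf (\<eta> X) = cat_comp C X ?GX ?GY (on_hom G (on_obj F X) (on_obj F Y) h) (\<eta> X)"
      by simp
    have cancel: "cat_comp C ?GX X ?GY (cat_comp C X ?GX ?GY k (\<eta> X)) s = k" if "k \<in> cat_hom C ?GX ?GY" for k
      using a X that by (simp add: F.C.assoc)
    have "?GFf = cat_comp C ?GX X ?GY (cat_comp C X ?GX ?GY ?GFf (\<eta> X)) s"
      using a f by (intro cancel[symmetric]) simp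
    also have "\<dots> = on_hom G (on_obj F X) (on_obj F Y) h"
      unfolding eq using a by (intro cancel) simp
    finally have "?GFf = on_hom G (on_obj F X) (on_obj F Y) h" .
    then have "on_hom F X Y f = h"
      using faithfulG a f unfolding faithful_functor_def by (meson F.hom_in F.obj_in)
    then show "\<exists>f\<in>cat_hom C X Y. on_hom F X Y f = h" using f by blast
  qed
qed

section \<open>The stable congruence of an exact category\<close>

text \<open>Injectivity phrased as the splitting of every inflation out of \<open>I\<close>. In an
  exact category this agrees with the extension of maps along inflations, by pushouts; the present
  form speaks of conflations, composites and identities only, which exact equivalences
  respect.\<close>

definition weakly_injective :: "('o, 'm, 'z) exact_category_scheme \<Rightarrow> 'o \<Rightarrow> bool" where
  "weakly_injective E I \<longleftrightarrow> I \<in> cat_obj E \<and>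
    (\<forall>B i p C. conflation E I i B p C \<longrightarrow> (\<exists>r\<in>cat_hom E B I. cat_comp E I B I r i = cat_id E I))"

text \<open>
  In an additive setting this says that \<open>a - b\<close> factors through a weakly injective object: \<open>E\<close> is then
  \<open>X \<oplus> I\<close>, and two sections of its projection differ by a map \<open>X \<rightarrow> I\<close>. Stated in this form, the
  relation is preserved by exact equivalences that are not known to be additive.
\<close>

definition stably_equal :: "('o, 'm, 'z) exact_category_scheme \<Rightarrow> 'o \<Rightarrow> 'o \<Rightarrow> 'm \<Rightarrow> 'm \<Rightarrow> bool" where
  "stably_equal \<E> X Y a b \<longleftrightarrow> (\<exists>I i E p s t g. weakly_injective \<E> I \<and> conflation \<E> I i E p X \<and>
     s \<in> cat_hom \<E> X E \<and> t \<in> cat_hom \<E> X E \<and> g \<in> cat_hom \<E> E Y \<and>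
     cat_comp \<E> X E X p s = cat_id \<E> X \<and> cat_comp \<E> X E X p t = cat_id \<E> X \<and>
     cat_comp \<E> X E Y g s = a \<and> cat_comp \<E> X E Y g t = b)"

text \<open>An exact equivalence compares conflations on objects and maps in the image of the
  functor. Closure under isomorphism is what reaches the remaining conflations of the
  target.\<close>

locale conflation_cat = cat C for C :: "('o, 'm, 'z) exact_category_scheme" +
  assumes conflation_in: "conflation C X i Y p Z \<Longrightarrow>
      X \<in> cat_obj C \<and> Y \<in> cat_obj C \<and> Z \<in> cat_obj C \<and> i \<in> cat_hom C X Y \<and> p \<in> cat_hom C Y Z"
    and conflation_iso: "\<lbrakk>conflation C X i Y p Z; X' \<in> cat_obj C; Y' \<in> cat_obj C; Z' \<in> cat_obj C;
      cat_iso C X X' u; cat_iso C Y Y' v; cat_iso C Z Z' w; i' \<in> cat_hom C X' Y'; p' \<in> cat_hom C Y' Z';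
      cat_comp C X Y Y' v i = cat_comp C X X' Y' i' u; cat_comp C Y Z Z' w p = cat_comp C Y Y' Z' p' v\<rbrakk>
      \<Longrightarrow> conflation C X' i' Y' p' Z'"

section \<open>Transport along exact equivalences\<close>

text \<open>A conflation starting at \<open>F I\<close> need not come from \<open>C\<close>. Density
  and fullness replace it by an isomorphic one that does; the splitting found in \<open>C\<close> is
  then mapped back along the isomorphism.\<close>

lemma exact_equivalence_weakly_injective:
  assumes "conflation_cat C" "conflation_cat D" "is_exact_equivalence C D F" "weakly_injective C I"
  shows "weakly_injective D (on_obj F I)"
proof -
  interpret C: conflation_cat C by fact
  interpret D: conflation_cat D by fact
  have equiv: "is_equivalence C D F" using assms(3) by (simp add: is_exact_equivalence_def)
  interpret F: cat_functor C D F using equiv by unfold_locales (simp add: is_equivalence_def)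
  note ffd = equivalence_full_faithful_dense[OF C.is_category D.is_category equiv]
  have I: "I \<in> cat_obj C" using assms(4) by (simp add: weakly_injective_def)
  show ?thesis
    unfolding weakly_injective_def
  proof (intro conjI allI impI)
    fix B' i' p' Z' assume conf: "conflation D (on_obj F I) i' B' p' Z'"
    then have in': "B' \<in> cat_obj D" "Z' \<in> cat_obj D" "i' \<in> cat_hom D (on_obj F I) B'" "p' \<in> cat_hom D B' Z'"
      using D.conflation_in by blast+
    obtain B u where B: "B \<in> cat_obj C" "cat_iso D (on_obj F B) B' u"
      using ffd(3) in' unfolding dense_functor_def by blast
    obtain Z w where Z: "Z \<in> cat_obj C" "cat_iso D (on_obj F Z) Z' w"
      using ffd(3) in' unfolding dense_functor_def by blast
    obtain u' where u: "u \<in> cat_hom D (on_obj F B) B'" "u' \<in> cat_hom D B' (on_obj F B)"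
      "cat_comp D (on_obj F B) B' (on_obj F B) u' u = cat_id D (on_obj F B)" "cat_comp D B' (on_obj F B) B' u u' = cat_id D B'"
      using B(2) by (rule D.isoE)
    obtain w' where w: "w \<in> cat_hom D (on_obj F Z) Z'" "w' \<in> cat_hom D Z' (on_obj F Z)"
      "cat_comp D (on_obj F Z) Z' (on_obj F Z) w' w = cat_id D (on_obj F Z)" "cat_comp D Z' (on_obj F Z) Z' w w' = cat_id D Z'"
      using Z(2) by (rule D.isoE)
    \<comment> \<open>\<open>i\<close> and \<open>p\<close> will be lifts of the given maps
      conjugated with \<open>u\<close> and \<open>w\<close>, so that \<open>conflation_iso\<close>
      applies with the identity at \<open>F I\<close>.\<close>
    have "cat_comp D (on_obj F I) B' (on_obj F B) u' i' \<in> cat_hom D (on_obj F I) (on_obj F B)"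
      using I B in' u by simp
    then obtain i where i: "i \<in> cat_hom C I B" "on_hom F I B i = cat_comp D (on_obj F I) B' (on_obj F B) u' i'"
      using ffd(1) I B unfolding full_functor_def by blast
    have "cat_comp D (on_obj F B) Z' (on_obj F Z) w' (cat_comp D (on_obj F B) B' Z' p' u) \<in> cat_hom D (on_obj F B) (on_obj F Z)"
      using Z B in' u w by simp
    then obtain p where p: "p \<in> cat_hom C B Z"
      "on_hom F B Z p = cat_comp D (on_obj F B) Z' (on_obj F Z) w' (cat_comp D (on_obj F B) B' Z' p' u)"
      using ffd(1) Z B unfolding full_functor_def by blast
    have iso: "cat_iso D (on_obj F I) (on_obj F I) (cat_id D (on_obj F I))"
      "cat_iso D B' (on_obj F B) u'" "cat_iso D Z' (on_obj F Z) w'"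
      using I u w by (auto simp: cat_iso_def)
    have "conflation D (on_obj F I) (on_hom F I B i) (on_obj F B) (on_hom F B Z p) (on_obj F Z)"
      by (rule D.conflation_iso[OF conf _ _ _ iso])
        (use I B Z in' u w i p in \<open>simp_all add: D.assoc\<close>)
    then have "conflation C I i B p Z"
      using assms(3) I B Z i p unfolding is_exact_equivalence_def by blast
    then obtain r where r: "r \<in> cat_hom C B I" "cat_comp C I B I r i = cat_id C I"
      using assms(4) unfolding weakly_injective_def by blast
    have "cat_comp D (on_obj F I) B' (on_obj F I) (cat_comp D B' (on_obj F B) (on_obj F I) (on_hom F B I r) u') i' =
        cat_comp D (on_obj F I) (on_obj F B) (on_obj F I) (on_hom F B I r) (on_hom F I B i)"
      using I B in' u r i by (simp add: D.assoc)
    also have "\<dots> = cat_id D (on_obj F I)"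
      using I B r i(1) F.map_comp[of I B I i r] by (simp add: F.map_id)
    finally show "\<exists>r\<in>cat_hom D B' (on_obj F I). cat_comp D (on_obj F I) B' (on_obj F I) r i' = cat_id D (on_obj F I)"
      using I B in' u r by (intro bexI[of _ "cat_comp D B' (on_obj F B) (on_obj F I) (on_hom F B I r) u'"]) simp_all
  qed (use I in simp)
qed

lemma exact_equivalence_stably_equal:
  assumes "conflation_cat C" "conflation_cat D" "is_exact_equivalence C D F"
    and XY: "X \<in> cat_obj C" "Y \<in> cat_obj C" and ab: "stably_equal C X Y a b"
  shows "stably_equal D (on_obj F X) (on_obj F Y) (on_hom F X Y a) (on_hom F X Y b)"
proof -
  interpret C: conflation_cat C by fact
  interpret D: conflation_cat D by fact
  have equiv: "is_equivalence C D F" using assms(3) by (simp add: is_exact_equivalence_def)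
  interpret F: cat_functor C D F using equiv by unfold_locales (simp add: is_equivalence_def)
  obtain I i E p s t g where h: "weakly_injective C I" "conflation C I i E p X"
     "s \<in> cat_hom C X E" "t \<in> cat_hom C X E" "g \<in> cat_hom C E Y"
     "cat_comp C X E X p s = cat_id C X" "cat_comp C X E X p t = cat_id C X"
     "cat_comp C X E Y g s = a" "cat_comp C X E Y g t = b"
    using ab unfolding stably_equal_def by blast
  note in_C = C.conflation_in[OF h(2)]
  have "conflation D (on_obj F I) (on_hom F I E i) (on_obj F E) (on_hom F E X p) (on_obj F X)"
    using assms(3) h(2) in_C unfolding is_exact_equivalence_def by blast
  moreover have "weakly_injective D (on_obj F I)"
    using exact_equivalence_weakly_injective[OF assms(1-3) h(1)] .
  moreover have "on_hom F X E s \<in> cat_hom D (on_obj F X) (on_obj F E)"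
    "on_hom F X E t \<in> cat_hom D (on_obj F X) (on_obj F E)"
    "on_hom F E Y g \<in> cat_hom D (on_obj F E) (on_obj F Y)"
    using XY in_C h by simp_all
  moreover have
    "cat_comp D (on_obj F X) (on_obj F E) (on_obj F X) (on_hom F E X p) (on_hom F X E s) = cat_id D (on_obj F X)"
    "cat_comp D (on_obj F X) (on_obj F E) (on_obj F X) (on_hom F E X p) (on_hom F X E t) = cat_id D (on_obj F X)"
    "cat_comp D (on_obj F X) (on_obj F E) (on_obj F Y) (on_hom F E Y g) (on_hom F X E s) = on_hom F X Y a"
    "cat_comp D (on_obj F X) (on_obj F E) (on_obj F Y) (on_hom F E Y g) (on_hom F X E t) = on_hom F X Y b"
    using XY in_C h(3-) by (simp_all flip: F.map_comp F.map_id)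
  ultimately show ?thesis
    unfolding stably_equal_def by blast
qed

text \<open>A conflation of \<open>D\<close> is isomorphic to its image under \<open>F\<close> after
  \<open>G\<close>, and \<open>F\<close> preserves and reflects conflations, so it can be tested on
  its image under \<open>G\<close>. The unit is returned as well because it has to belong to this
  particular \<open>G\<close>.\<close>

lemma exact_equivalence_sym:
  assumes "conflation_cat C" "conflation_cat D" "is_exact_equivalence C D F"
  shows "\<exists>G \<eta>. is_exact_equivalence D C G \<and> natural_iso C C functor_id (functor_comp G F) \<eta>"
proof -
  interpret C: conflation_cat C by fact
  interpret D: conflation_cat D by fact
  obtain G \<eta> \<epsilon> where F: "is_functor C D F" and G: "is_functor D C G"
    and \<eta>: "natural_iso C C functor_id (functor_comp G F) \<eta>"
    and \<epsilon>: "natural_iso D D (functor_comp F G) functor_id \<epsilon>"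
    using assms(3) unfolding is_exact_equivalence_def is_equivalence_def by blast
  interpret F: cat_functor C D F by unfold_locales fact
  interpret G: cat_functor D C G by unfold_locales fact
  obtain \<delta> where \<delta>: "natural_iso D D functor_id (functor_comp F G) \<delta>"
    using natural_iso_inverse[OF D.is_category D.is_category is_functor_comp[OF G F] is_functor_id \<epsilon>] ..
  have iso: "cat_iso D (on_obj F (on_obj G X)) X (\<epsilon> X)" "cat_iso D X (on_obj F (on_obj G X)) (\<delta> X)"
    if "X \<in> cat_obj D" for X
    using \<epsilon> \<delta> that unfolding natural_iso_def by (simp_all add: functor_id_def functor_comp_def)
  have nat: "cat_comp D (on_obj F (on_obj G X)) (on_obj F (on_obj G Y)) Y (\<epsilon> Y)
        (on_hom F (on_obj G X) (on_obj G Y) (on_hom G X Y f)) = cat_comp D (on_obj F (on_obj G X)) X Y f (\<epsilon> X)"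
    "cat_comp D X Y (on_obj F (on_obj G Y)) (\<delta> Y) f = cat_comp D X (on_obj F (on_obj G X)) (on_obj F (on_obj G Y))
        (on_hom F (on_obj G X) (on_obj G Y) (on_hom G X Y f)) (\<delta> X)"
    if "X \<in> cat_obj D" "Y \<in> cat_obj D" "f \<in> cat_hom D X Y" for X Y f
    using \<epsilon> \<delta> that unfolding natural_iso_def by (simp_all add: functor_id_def functor_comp_def)
  have "conflation D X i Y p Z \<longleftrightarrow> conflation C (on_obj G X) (on_hom G X Y i) (on_obj G Y) (on_hom G Y Z p) (on_obj G Z)"
    if a: "X \<in> cat_obj D" "Y \<in> cat_obj D" "Z \<in> cat_obj D" "i \<in> cat_hom D X Y" "p \<in> cat_hom D Y Z" for X Y Z i p
  proof -
    have "conflation D X i Y p Z \<longleftrightarrow> conflation D (on_obj F (on_obj G X)) (on_hom F (on_obj G X) (on_obj G Y) (on_hom G X Y i))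
        (on_obj F (on_obj G Y)) (on_hom F (on_obj G Y) (on_obj G Z) (on_hom G Y Z p)) (on_obj F (on_obj G Z))"
    proof
      assume "conflation D X i Y p Z"
      then show "conflation D (on_obj F (on_obj G X)) (on_hom F (on_obj G X) (on_obj G Y) (on_hom G X Y i))
        (on_obj F (on_obj G Y)) (on_hom F (on_obj G Y) (on_obj G Z) (on_hom G Y Z p)) (on_obj F (on_obj G Z))"
        by (rule D.conflation_iso[OF _ _ _ _ iso(2) iso(2) iso(2)]) (use a nat(2) in simp_all)
    next
      assume "conflation D (on_obj F (on_obj G X)) (on_hom F (on_obj G X) (on_obj G Y) (on_hom G X Y i))
        (on_obj F (on_obj G Y)) (on_hom F (on_obj G Y) (on_obj G Z) (on_hom G Y Z p)) (on_obj F (on_obj G Z))"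
      then show "conflation D X i Y p Z"
        by (rule D.conflation_iso[OF _ _ _ _ iso(1) iso(1) iso(1)]) (use a nat(1) in simp_all)
    qed
    also have "\<dots> \<longleftrightarrow> conflation C (on_obj G X) (on_hom G X Y i) (on_obj G Y) (on_hom G Y Z p) (on_obj G Z)"
      using assms(3) a unfolding is_exact_equivalence_def by (meson G.obj_in G.hom_in)
    finally show ?thesis .
  qed
  then have "is_exact_equivalence D C G"
    unfolding is_exact_equivalence_def using equivalence_sym[OF C.is_category D.is_category F G \<eta> \<epsilon>] by blast
  then show ?thesis using \<eta> by blast
qed

lemma full_functor_comp:
  assumes "is_functor C D F" "full_functor C D F" "full_functor D E G"
  shows "full_functor C E (functor_comp G F)"
  using assms unfolding full_functor_def is_functor_def functor_comp_def by simp metis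

lemma dense_functor_comp:
  assumes "cat_functor C D F" "cat_functor D E G" "dense_functor C D F" "dense_functor D E G"
  shows "dense_functor C E (functor_comp G F)"
  unfolding dense_functor_def
proof
  interpret F: cat_functor C D F by fact
  interpret G: cat_functor D E G by fact
  fix N assume N: "N \<in> cat_obj E"
  then obtain Y u where Y: "Y \<in> cat_obj D" "cat_iso E (on_obj G Y) N u"
    using assms(4) unfolding dense_functor_def by blast
  then obtain X v where X: "X \<in> cat_obj C" "cat_iso D (on_obj F X) Y v"
    using assms(3) unfolding dense_functor_def by blast
  have "cat_iso E (on_obj G (on_obj F X)) N
      (cat_comp E (on_obj G (on_obj F X)) (on_obj G Y) N u (on_hom G (on_obj F X) Y v))"
    using X Y N by (intro G.D.iso_comp G.map_iso) simp_all
  then show "\<exists>X\<in>cat_obj C. \<exists>u. cat_iso E (on_obj (functor_comp G F) X) N u"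
    using X by (auto simp: functor_comp_def)
qed

text \<open>\<open>K\<close> and the composite of \<open>K'\<close> with \<open>F\<close> are full
  dense functors on the same category. They identify the same pairs because stable equality passes
  along \<open>F\<close> and also back along \<open>G\<close>: it then holds for
  \<open>G (F a)\<close> and \<open>G (F b)\<close>, from which \<open>a\<close> and
  \<open>b\<close> are recovered with the unit and its inverse.\<close>

lemma equivalent_stable_quotients:
  assumes "conflation_cat C" "conflation_cat C'" and equiv: "is_exact_equivalence C C' F"
    and K: "cat_functor C D K" "full_functor C D K" "dense_functor C D K"
    and K': "cat_functor C' D' K'" "full_functor C' D' K'" "dense_functor C' D' K'"
    and ker: "\<And>X Y a b. \<lbrakk>X \<in> cat_obj C; Y \<in> cat_obj C; a \<in> cat_hom C X Y; b \<in> cat_hom C X Y\<rbrakk> \<Longrightarrow>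
      on_hom K X Y a = on_hom K X Y b \<longleftrightarrow> stably_equal C X Y a b"
    and ker': "\<And>X Y a b. \<lbrakk>X \<in> cat_obj C'; Y \<in> cat_obj C'; a \<in> cat_hom C' X Y; b \<in> cat_hom C' X Y\<rbrakk> \<Longrightarrow>
      on_hom K' X Y a = on_hom K' X Y b \<longleftrightarrow> stably_equal C' X Y a b"
  shows "equivalent_categories D D'"
proof -
  interpret C: conflation_cat C by fact
  interpret C': conflation_cat C' by fact
  interpret K: cat_functor C D K by fact
  interpret K': cat_functor C' D' K' by fact
  have equiv': "is_equivalence C C' F" using equiv by (simp add: is_exact_equivalence_def)
  interpret F: cat_functor C C' F using equiv' by unfold_locales (simp add: is_equivalence_def)
  note ffd = equivalence_full_faithful_dense[OF C.is_category C'.is_category equiv']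
  obtain G \<eta> where G: "is_exact_equivalence C' C G" and \<eta>: "natural_iso C C functor_id (functor_comp G F) \<eta>"
    using exact_equivalence_sym[OF assms(1-3)] by blast
  interpret G: cat_functor C' C G
    using G by unfold_locales (simp add: is_exact_equivalence_def is_equivalence_def)
  have eq_iff: "on_hom K X Y a = on_hom K X Y b \<longleftrightarrow>
      on_hom (functor_comp K' F) X Y a = on_hom (functor_comp K' F) X Y b"
    if a: "X \<in> cat_obj C" "Y \<in> cat_obj C" "a \<in> cat_hom C X Y" "b \<in> cat_hom C X Y" for X Y a b
  proof
    assume "on_hom K X Y a = on_hom K X Y b"
    then have "stably_equal C X Y a b" using ker a by simp
    then show "on_hom (functor_comp K' F) X Y a = on_hom (functor_comp K' F) X Y b"
      using exact_equivalence_stably_equal[OF assms(1-3) a(1,2)] ker' a by (simp add: functor_comp_def)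
  next
    assume "on_hom (functor_comp K' F) X Y a = on_hom (functor_comp K' F) X Y b"
    then have "stably_equal C' (on_obj F X) (on_obj F Y) (on_hom F X Y a) (on_hom F X Y b)"
      using ker' a by (simp add: functor_comp_def)
    then have "stably_equal C (on_obj G (on_obj F X)) (on_obj G (on_obj F Y))
        (on_hom G (on_obj F X) (on_obj F Y) (on_hom F X Y a)) (on_hom G (on_obj F X) (on_obj F Y) (on_hom F X Y b))"
      using exact_equivalence_stably_equal[OF assms(2,1) G] a by simp
    then have eq: "on_hom K (on_obj G (on_obj F X)) (on_obj G (on_obj F Y)) (on_hom G (on_obj F X) (on_obj F Y) (on_hom F X Y a)) =
        on_hom K (on_obj G (on_obj F X)) (on_obj G (on_obj F Y)) (on_hom G (on_obj F X) (on_obj F Y) (on_hom F X Y b))"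
      using ker a by simp
    let ?GX = "on_obj G (on_obj F X)" and ?GY = "on_obj G (on_obj F Y)"
    have iso: "cat_iso C X ?GX (\<eta> X)" "cat_iso C Y ?GY (\<eta> Y)"
      using \<eta> a unfolding natural_iso_def by (simp_all add: functor_id_def functor_comp_def)
    obtain t where Y: "\<eta> Y \<in> cat_hom C Y ?GY" "t \<in> cat_hom C ?GY Y" "cat_comp C Y ?GY Y t (\<eta> Y) = cat_id C Y"
      using iso(2) by (auto simp: cat_iso_def)
    have X: "\<eta> X \<in> cat_hom C X ?GX" using iso(1) by (auto simp: cat_iso_def)
    have "f = cat_comp C X ?GY Y t (cat_comp C X ?GX ?GY (on_hom G (on_obj F X) (on_obj F Y) (on_hom F X Y f)) (\<eta> X))"
      if f: "f \<in> cat_hom C X Y" for f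
    proof -
      have "cat_comp C X Y ?GY (\<eta> Y) f = cat_comp C X ?GX ?GY (on_hom G (on_obj F X) (on_obj F Y) (on_hom F X Y f)) (\<eta> X)"
        using \<eta> a f unfolding natural_iso_def by (simp add: functor_id_def functor_comp_def)
      then show ?thesis using C.comp_cancel[of X Y ?GY f "\<eta> Y" t] a f Y by simp
    qed
    \<comment> \<open>Consequently \<open>K f\<close> depends only on the image of
      \<open>G (F f)\<close> under \<open>K\<close>, and these images agree for \<open>a\<close> and
      \<open>b\<close>.\<close>
    then have "on_hom K X Y f = cat_comp D (on_obj K X) (on_obj K ?GY) (on_obj K Y) (on_hom K ?GY Y t)
        (cat_comp D (on_obj K X) (on_obj K ?GX) (on_obj K ?GY)
          (on_hom K ?GX ?GY (on_hom G (on_obj F X) (on_obj F Y) (on_hom F X Y f))) (on_hom K X ?GX (\<eta> X)))"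
      if f: "f \<in> cat_hom C X Y" for f
      using a X Y f K.map_comp C.comp_in F.hom_in F.obj_in G.hom_in G.obj_in by metis
    then show "on_hom K X Y a = on_hom K X Y b" using eq a by simp
  qed
  have "cat_functor C D' (functor_comp K' F)"
    using is_functor_comp[OF F.is_functor K'.is_functor] by unfold_locales
  then show ?thesis
    using equivalent_if_same_kernel[OF K(1) _ K(2,3) full_functor_comp[OF F.is_functor ffd(1) K'(2)]
        dense_functor_comp[OF _ K'(1) ffd(3) K'(3)] eq_iff] F.cat_functor_axioms by blast
qed

section \<open>Submodules and finite generation\<close>

locale rmod = L: ring L + M: abelian_group M
  for L :: "('a, 'y) ring_scheme" and M :: "('a, 'm, 'z) module_scheme" +
  assumes smult_closed [simp, intro]: "a \<in> carrier L \<Longrightarrow> x \<in> carrier M \<Longrightarrow> a \<odot>\<^bsub>M\<^esub> x \<in> carrier M"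
    and smult_l_distr: "a \<in> carrier L \<Longrightarrow> b \<in> carrier L \<Longrightarrow> x \<in> carrier M \<Longrightarrow>
      (a \<oplus>\<^bsub>L\<^esub> b) \<odot>\<^bsub>M\<^esub> x = (a \<odot>\<^bsub>M\<^esub> x) \<oplus>\<^bsub>M\<^esub> (b \<odot>\<^bsub>M\<^esub> x)"
    and smult_r_distr: "a \<in> carrier L \<Longrightarrow> x \<in> carrier M \<Longrightarrow> y \<in> carrier M \<Longrightarrow>
      a \<odot>\<^bsub>M\<^esub> (x \<oplus>\<^bsub>M\<^esub> y) = (a \<odot>\<^bsub>M\<^esub> x) \<oplus>\<^bsub>M\<^esub> (a \<odot>\<^bsub>M\<^esub> y)"
    and smult_assoc: "a \<in> carrier L \<Longrightarrow> b \<in> carrier L \<Longrightarrow> x \<in> carrier M \<Longrightarrow>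
      (a \<otimes>\<^bsub>L\<^esub> b) \<odot>\<^bsub>M\<^esub> x = b \<odot>\<^bsub>M\<^esub> (a \<odot>\<^bsub>M\<^esub> x)"
    and smult_one [simp]: "x \<in> carrier M \<Longrightarrow> \<one>\<^bsub>L\<^esub> \<odot>\<^bsub>M\<^esub> x = x"

lemma right_module_iff: "right_module L M \<longleftrightarrow> rmod L M"
  by (auto simp: right_module_def rmod_def rmod_axioms_def)

definition submod :: "('a, 'y) ring_scheme \<Rightarrow> ('a, 'm, 'z) module_scheme \<Rightarrow> 'm set \<Rightarrow> bool" where
  "submod L M H \<longleftrightarrow> H \<subseteq> carrier M \<and> \<zero>\<^bsub>M\<^esub> \<in> H \<and> (\<forall>x\<in>H. \<forall>y\<in>H. x \<oplus>\<^bsub>M\<^esub> y \<in> H) \<and>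
    (\<forall>a\<in>carrier L. \<forall>x\<in>H. a \<odot>\<^bsub>M\<^esub> x \<in> H)"

lemma submodD:
  assumes "submod L M H"
  shows "x \<in> H \<Longrightarrow> x \<in> carrier M" "\<zero>\<^bsub>M\<^esub> \<in> H" "x \<in> H \<Longrightarrow> y \<in> H \<Longrightarrow> x \<oplus>\<^bsub>M\<^esub> y \<in> H"
    "a \<in> carrier L \<Longrightarrow> x \<in> H \<Longrightarrow> a \<odot>\<^bsub>M\<^esub> x \<in> H"
  using assms unfolding submod_def by blast+

text \<open>Multiples are added one at a time, repetitions allowed, instead of summing over
  coefficient functions. Closure properties become inductions, and since the carrier does not occur,
  the span does not change when computed in a submodule.\<close>

inductive_set span for L :: "('a, 'y) ring_scheme" and M :: "('a, 'm, 'z) module_scheme" and S where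
  zero: "\<zero>\<^bsub>M\<^esub> \<in> span L M S"
| step: "s \<in> S \<Longrightarrow> a \<in> carrier L \<Longrightarrow> x \<in> span L M S \<Longrightarrow> (a \<odot>\<^bsub>M\<^esub> s) \<oplus>\<^bsub>M\<^esub> x \<in> span L M S"

definition fg_submod :: "('a, 'y) ring_scheme \<Rightarrow> ('a, 'm, 'z) module_scheme \<Rightarrow> 'm set \<Rightarrow> bool" where
  "fg_submod L M H \<longleftrightarrow> (\<exists>S. finite S \<and> S \<subseteq> carrier M \<and> H = span L M S)"

lemma span_mono: "S \<subseteq> T \<Longrightarrow> span L M S \<subseteq> span L M T"
proof
  fix x assume "S \<subseteq> T" "x \<in> span L M S"
  from this(2,1) show "x \<in> span L M T" by induction (auto intro: span.intros)
qed

lemma span_empty [simp]: "span L M {} = {\<zero>\<^bsub>M\<^esub>}"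
proof -
  have "x = \<zero>\<^bsub>M\<^esub>" if "x \<in> span L M {}" for x
    using that by cases auto
  then show ?thesis by (auto intro: span.zero)
qed

lemma span_subset_submod:
  assumes "submod L M H" "S \<subseteq> H"
  shows "span L M S \<subseteq> H"
proof
  fix x assume "x \<in> span L M S"
  then show "x \<in> H" by induction (use assms in \<open>auto simp: submod_def\<close>)
qed

text \<open>Each derivation mentions only finitely many generators. This is needed where an infinite
  tail of a sequence is spanned.\<close>

lemma span_finite_support:
  "x \<in> span L M S \<Longrightarrow> \<exists>F. finite F \<and> F \<subseteq> S \<and> x \<in> span L M F"
proof (induction rule: span.induct)
  case zero
  then show ?case by (intro exI[of _ "{}"]) auto
next
  case (step s a x)
  then obtain F where F: "finite F" "F \<subseteq> S" "x \<in> span L M F" by blast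
  have "x \<in> span L M (insert s F)" using F(3) span_mono[of F "insert s F"] by blast
  then show ?case using F step(1,2) by (intro exI[of _ "insert s F"]) (auto intro: span.step)
qed

context rmod
begin

lemma smult_zero [simp]: "a \<in> carrier L \<Longrightarrow> a \<odot>\<^bsub>M\<^esub> \<zero>\<^bsub>M\<^esub> = \<zero>\<^bsub>M\<^esub>"
  using smult_r_distr[of a "\<zero>\<^bsub>M\<^esub>" "\<zero>\<^bsub>M\<^esub>"] M.add.r_cancel_one'[of "a \<odot>\<^bsub>M\<^esub> \<zero>\<^bsub>M\<^esub>" "a \<odot>\<^bsub>M\<^esub> \<zero>\<^bsub>M\<^esub>"] by simp

lemma zero_smult [simp]: "x \<in> carrier M \<Longrightarrow> \<zero>\<^bsub>L\<^esub> \<odot>\<^bsub>M\<^esub> x = \<zero>\<^bsub>M\<^esub>"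
  using smult_l_distr[of "\<zero>\<^bsub>L\<^esub>" "\<zero>\<^bsub>L\<^esub>" x] M.add.r_cancel_one'[of "\<zero>\<^bsub>L\<^esub> \<odot>\<^bsub>M\<^esub> x" "\<zero>\<^bsub>L\<^esub> \<odot>\<^bsub>M\<^esub> x"] by simp

lemma smult_neg: "a \<in> carrier L \<Longrightarrow> x \<in> carrier M \<Longrightarrow> a \<odot>\<^bsub>M\<^esub> (\<ominus>\<^bsub>M\<^esub> x) = \<ominus>\<^bsub>M\<^esub> (a \<odot>\<^bsub>M\<^esub> x)"
  using smult_r_distr[of a "\<ominus>\<^bsub>M\<^esub> x" x] M.minus_equality[of "a \<odot>\<^bsub>M\<^esub> (\<ominus>\<^bsub>M\<^esub> x)" "a \<odot>\<^bsub>M\<^esub> x"]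
  by (simp add: M.l_neg)

lemma neg_smult: "a \<in> carrier L \<Longrightarrow> x \<in> carrier M \<Longrightarrow> (\<ominus>\<^bsub>L\<^esub> a) \<odot>\<^bsub>M\<^esub> x = \<ominus>\<^bsub>M\<^esub> (a \<odot>\<^bsub>M\<^esub> x)"
  using smult_l_distr[of "\<ominus>\<^bsub>L\<^esub> a" a x] M.minus_equality[of "(\<ominus>\<^bsub>L\<^esub> a) \<odot>\<^bsub>M\<^esub> x" "a \<odot>\<^bsub>M\<^esub> x"]
  by (simp add: L.l_neg)

lemma submod_neg: "submod L M H \<Longrightarrow> x \<in> H \<Longrightarrow> \<ominus>\<^bsub>M\<^esub> x \<in> H"
  using neg_smult[of "\<one>\<^bsub>L\<^esub>" x] submodD(1,4)[of L M H] by (metis L.add.inv_closed L.one_closed smult_one)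

lemma submod_minus: "submod L M H \<Longrightarrow> x \<in> H \<Longrightarrow> y \<in> H \<Longrightarrow> x \<ominus>\<^bsub>M\<^esub> y \<in> H"
  using submod_neg submodD(3)[of L M H] by (simp add: M.minus_eq)

lemma submod_carrier: "submod L M (carrier M)"
  by (simp add: submod_def)

lemma add_minus_cancel: "x \<in> carrier M \<Longrightarrow> y \<in> carrier M \<Longrightarrow> y \<oplus>\<^bsub>M\<^esub> (x \<ominus>\<^bsub>M\<^esub> y) = x"
  by (metis M.a_comm M.add.inv_closed M.add.inv_solve_right M.minus_closed M.minus_eq)

lemma add_diff_eq: "x \<in> carrier M \<Longrightarrow> y \<in> carrier M \<Longrightarrow> x \<oplus>\<^bsub>M\<^esub> y \<ominus>\<^bsub>M\<^esub> x = y"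
  by (metis M.a_comm M.add.inv_solve_right' M.add.m_closed M.minus_eq)

lemma minus_eq_zero_iff: "x \<in> carrier M \<Longrightarrow> y \<in> carrier M \<Longrightarrow> x \<ominus>\<^bsub>M\<^esub> y = \<zero>\<^bsub>M\<^esub> \<longleftrightarrow> x = y"
  by (metis M.r_zero M.r_neg M.minus_eq add_minus_cancel)

lemma span_in_carrier: "S \<subseteq> carrier M \<Longrightarrow> span L M S \<subseteq> carrier M"
  by (rule span_subset_submod[OF submod_carrier])

lemma submod_span:
  assumes "S \<subseteq> carrier M"
  shows "submod L M (span L M S)"
  unfolding submod_def
proof (intro conjI ballI)
  show "span L M S \<subseteq> carrier M" "\<zero>\<^bsub>M\<^esub> \<in> span L M S"
    using span_in_carrier[OF assms] by (auto intro: span.zero)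
  fix x assume x: "x \<in> span L M S"
  show "x \<oplus>\<^bsub>M\<^esub> y \<in> span L M S" if y: "y \<in> span L M S" for y
    using x
  proof induction
    case zero
    then show ?case using y span_in_carrier[OF assms] by auto
  next
    case (step s a x)
    then have "(a \<odot>\<^bsub>M\<^esub> s) \<oplus>\<^bsub>M\<^esub> (x \<oplus>\<^bsub>M\<^esub> y) \<in> span L M S" by (intro span.step)
    moreover have "x \<in> carrier M" "y \<in> carrier M" "s \<in> carrier M" using step y span_in_carrier[OF assms] assms by auto
    ultimately show ?case using step by (simp add: M.a_assoc)
  qed
  fix b assume b: "b \<in> carrier L"
  show "b \<odot>\<^bsub>M\<^esub> x \<in> span L M S"
    using x
  proof induction
    case zero
    then show ?case using b by (simp add: span.zero)
  next
    case (step s a x)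
    then have "((a \<otimes>\<^bsub>L\<^esub> b) \<odot>\<^bsub>M\<^esub> s) \<oplus>\<^bsub>M\<^esub> (b \<odot>\<^bsub>M\<^esub> x) \<in> span L M S" using b by (intro span.step) auto
    moreover have "x \<in> carrier M" "s \<in> carrier M" using step span_in_carrier[OF assms] assms by auto
    ultimately show ?case using step b by (simp add: smult_assoc smult_r_distr)
  qed
qed

lemma span_superset:
  assumes "S \<subseteq> carrier M" "s \<in> S"
  shows "s \<in> span L M S"
proof -
  have "(\<one>\<^bsub>L\<^esub> \<odot>\<^bsub>M\<^esub> s) \<oplus>\<^bsub>M\<^esub> \<zero>\<^bsub>M\<^esub> \<in> span L M S" using assms(2) by (intro span.intros) auto
  then show ?thesis using assms by (simp add: subset_eq)
qed

text \<open>All multiples of \<open>s\<close> in a linear combination merge into one coefficient;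
  this is what induction on a finite generating set runs on.\<close>

lemma span_insertE:
  assumes "x \<in> span L M (insert s S)" "insert s S \<subseteq> carrier M"
  obtains a y where "a \<in> carrier L" "y \<in> span L M S" "x = (a \<odot>\<^bsub>M\<^esub> s) \<oplus>\<^bsub>M\<^esub> y"
proof -
  have S: "S \<subseteq> carrier M" and s: "s \<in> carrier M" using assms(2) by auto
  have "\<exists>a\<in>carrier L. \<exists>y\<in>span L M S. x = (a \<odot>\<^bsub>M\<^esub> s) \<oplus>\<^bsub>M\<^esub> y"
    using assms(1)
  proof induction
    case zero
    show ?case by (intro bexI[of _ "\<zero>\<^bsub>L\<^esub>"] bexI[of _ "\<zero>\<^bsub>M\<^esub>"]) (auto simp: s span.zero)
  next
    case (step t b x)
    then obtain a y where ay: "a \<in> carrier L" "y \<in> span L M S" "x = (a \<odot>\<^bsub>M\<^esub> s) \<oplus>\<^bsub>M\<^esub> y" by blast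
    have y: "y \<in> carrier M" using ay span_in_carrier[OF S] by auto
    show ?case
    proof (cases "t \<in> S")
      case True
      then have "t \<in> carrier M" using S by auto
      then show ?thesis using True ay step s y
        by (intro bexI[of _ a] bexI[of _ "(b \<odot>\<^bsub>M\<^esub> t) \<oplus>\<^bsub>M\<^esub> y"]) (auto simp: M.a_lcomm intro: span.step)
    next
      case False
      then have "t = s" using step by simp
      then show ?thesis using ay step s y
        by (intro bexI[of _ "b \<oplus>\<^bsub>L\<^esub> a"] bexI[of _ y]) (auto simp: smult_l_distr M.a_assoc)
    qed
  qed
  then show ?thesis using that by blast
qed

lemma fg_submodI:
  assumes "submod L M H" "finite S" "S \<subseteq> H" "H \<subseteq> span L M S"
  shows "fg_submod L M H"
proof -
  have "H = span L M S" using assms span_subset_submod[OF assms(1,3)] by (intro equalityI)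
  moreover have "S \<subseteq> carrier M" using assms submodD(1) by (metis subset_iff)
  ultimately show ?thesis unfolding fg_submod_def using assms(2) by (intro exI[of _ S]) simp
qed

lemma fg_submodE:
  assumes "fg_submod L M H"
  obtains S where "finite S" "S \<subseteq> H" "S \<subseteq> carrier M" "H = span L M S"
proof -
  obtain S where "finite S" "S \<subseteq> carrier M" "H = span L M S"
    using assms unfolding fg_submod_def by blast
  moreover have "S \<subseteq> H" using calculation span_superset by auto
  ultimately show ?thesis using that by blast
qed

text \<open>Induction on the generating set matches the stepwise span with a sum over coefficient
  functions; \<open>span_insertE\<close> provides the coefficient of each new generator.\<close>

lemma finitely_generated_module_iff: "finitely_generated_module L M \<longleftrightarrow> fg_submod L M (carrier M)"
proof
  assume "finitely_generated_module L M"
  then obtain S where S: "finite S" "S \<subseteq> carrier M"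
    and gen: "\<And>x. x \<in> carrier M \<Longrightarrow> \<exists>c\<in>S \<rightarrow> carrier L. x = (\<Oplus>\<^bsub>M\<^esub>s\<in>S. c s \<odot>\<^bsub>M\<^esub> s)"
    unfolding finitely_generated_module_def by blast
  have sum: "(\<Oplus>\<^bsub>M\<^esub>s\<in>T. c s \<odot>\<^bsub>M\<^esub> s) \<in> span L M T" if "finite T" "T \<subseteq> carrier M" "c \<in> T \<rightarrow> carrier L" for T c
    using that
  proof (induction T rule: finite_induct)
    case empty
    then show ?case by simp
  next
    case (insert t T)
    then have 1: "(\<Oplus>\<^bsub>M\<^esub>s\<in>T. c s \<odot>\<^bsub>M\<^esub> s) \<in> span L M (insert t T)" "c t \<in> carrier L"
      using span_mono[of T "insert t T" L M] by auto
    have "(\<Oplus>\<^bsub>M\<^esub>s\<in>insert t T. c s \<odot>\<^bsub>M\<^esub> s) = (c t \<odot>\<^bsub>M\<^esub> t) \<oplus>\<^bsub>M\<^esub> (\<Oplus>\<^bsub>M\<^esub>s\<in>T. c s \<odot>\<^bsub>M\<^esub> s)"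
      using insert by (intro M.finsum_insert) (auto simp: Pi_iff)
    then show ?case using span.step[of t "insert t T", OF _ 1(2,1)] by simp
  qed
  show "fg_submod L M (carrier M)"
  proof (rule fg_submodI[OF submod_carrier S])
    show "carrier M \<subseteq> span L M S" using gen sum[OF S] by (metis subsetI)
  qed
next
  assume "fg_submod L M (carrier M)"
  then obtain S where S: "finite S" "S \<subseteq> carrier M" "carrier M = span L M S"
    unfolding fg_submod_def by blast
  have "\<exists>c\<in>T \<rightarrow> carrier L. x = (\<Oplus>\<^bsub>M\<^esub>s\<in>T. c s \<odot>\<^bsub>M\<^esub> s)"
    if "finite T" "T \<subseteq> carrier M" "x \<in> span L M T" for T x
    using that
  proof (induction T arbitrary: x rule: finite_induct)
    case empty
    then show ?case by simp
  next
    case (insert t T)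
    obtain a y where ay: "a \<in> carrier L" "y \<in> span L M T" "x = (a \<odot>\<^bsub>M\<^esub> t) \<oplus>\<^bsub>M\<^esub> y"
      using insert.prems by (auto elim: span_insertE)
    then obtain c where c: "c \<in> T \<rightarrow> carrier L" "y = (\<Oplus>\<^bsub>M\<^esub>s\<in>T. c s \<odot>\<^bsub>M\<^esub> s)"
      using insert by blast
    define c' where "c' = c(t := a)"
    have c': "c' \<in> insert t T \<rightarrow> carrier L" using c ay by (auto simp: c'_def)
    have "(\<Oplus>\<^bsub>M\<^esub>s\<in>T. c' s \<odot>\<^bsub>M\<^esub> s) = y"
      unfolding c(2) using c insert by (intro M.finsum_cong') (auto simp: c'_def Pi_iff)
    moreover have "(\<Oplus>\<^bsub>M\<^esub>s\<in>insert t T. c' s \<odot>\<^bsub>M\<^esub> s) = (c' t \<odot>\<^bsub>M\<^esub> t) \<oplus>\<^bsub>M\<^esub> (\<Oplus>\<^bsub>M\<^esub>s\<in>T. c' s \<odot>\<^bsub>M\<^esub> s)"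
      using insert c' by (intro M.finsum_insert) (auto simp: Pi_iff)
    ultimately have "x = (\<Oplus>\<^bsub>M\<^esub>s\<in>insert t T. c' s \<odot>\<^bsub>M\<^esub> s)" unfolding ay(3) by (simp add: c'_def)
    then show ?case using c' by (intro bexI[of _ c'])
  qed
  from this[OF S(1,2)] show "finitely_generated_module L M"
    unfolding finitely_generated_module_def using S by (intro exI[of _ S] conjI ballI) simp_all
qed

end

text \<open>
  The linear relation \<open>\<rho>\<close> takes the place of the projection to a quotient, so that no quotient has to be formed.
\<close>

lemma fg_submod_extension:
  assumes "rmod L M" "rmod L M'" and N: "submod L M N" and fgJ: "fg_submod L M' J"
    and \<rho>: "\<And>x y r s. x \<in> N \<Longrightarrow> y \<in> N \<Longrightarrow> \<rho> x r \<Longrightarrow> \<rho> y s \<Longrightarrow> \<rho> (x \<oplus>\<^bsub>M\<^esub> y) (r \<oplus>\<^bsub>M'\<^esub> s)"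
      "\<And>x r a. x \<in> N \<Longrightarrow> a \<in> carrier L \<Longrightarrow> \<rho> x r \<Longrightarrow> \<rho> (a \<odot>\<^bsub>M\<^esub> x) (a \<odot>\<^bsub>M'\<^esub> r)"
      "\<rho> \<zero>\<^bsub>M\<^esub> \<zero>\<^bsub>M'\<^esub>"
    and total: "\<And>x. x \<in> N \<Longrightarrow> \<exists>r\<in>J. \<rho> x r" and surj: "\<And>r. r \<in> J \<Longrightarrow> \<exists>x\<in>N. \<rho> x r"
    and fgker: "fg_submod L M {x \<in> N. \<rho> x \<zero>\<^bsub>M'\<^esub>}"
  shows "fg_submod L M N"
proof -
  interpret M: rmod L M by fact
  interpret M': rmod L M' by fact
  obtain T' where T': "finite T'" "T' \<subseteq> J" "T' \<subseteq> carrier M'" "J = span L M' T'"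
    using fgJ by (rule M'.fg_submodE)
  obtain K where K: "finite K" "K \<subseteq> {x \<in> N. \<rho> x \<zero>\<^bsub>M'\<^esub>}" "{x \<in> N. \<rho> x \<zero>\<^bsub>M'\<^esub>} = span L M K"
    using fgker by (rule M.fg_submodE)
  obtain f where f: "\<And>t. t \<in> T' \<Longrightarrow> f t \<in> N" "\<And>t. t \<in> T' \<Longrightarrow> \<rho> (f t) t"
    using surj T' by (metis subsetD)
  let ?T = "f ` T'"
  have NM: "\<And>x. x \<in> N \<Longrightarrow> x \<in> carrier M" using N submodD(1) by metis
  have TN: "?T \<subseteq> N" using f by auto
  have lift: "\<exists>y\<in>span L M ?T. \<rho> y r" if "r \<in> span L M' T'" for r
    using that
  proof induction
    case zero
    then show ?case using \<rho>(3) span.zero by metis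
  next
    case (step t a r)
    then obtain y where y: "y \<in> span L M ?T" "\<rho> y r" by blast
    have "y \<in> N" using y span_subset_submod[OF N TN] by auto
    then show ?case
      using step y f by (intro bexI[of _ "(a \<odot>\<^bsub>M\<^esub> f t) \<oplus>\<^bsub>M\<^esub> y"] \<rho> span.step) (auto intro: submodD(4)[OF N])
  qed
  have TKN: "?T \<union> K \<subseteq> N" using TN K(2) by blast
  then have TKM: "?T \<union> K \<subseteq> carrier M" using NM by blast
  show ?thesis
  proof (rule M.fg_submodI[OF N, of "?T \<union> K"])
    show "N \<subseteq> span L M (?T \<union> K)"
    proof
      fix x assume x: "x \<in> N"
      then obtain r where r: "r \<in> J" "\<rho> x r" using total by blast
      then obtain y where y: "y \<in> span L M ?T" "\<rho> y r" using lift T' by blast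
      have yN: "y \<in> N" using y span_subset_submod[OF N TN] by auto
      have rM: "r \<in> carrier M'" using r T' M'.span_in_carrier by auto
      have m1: "\<ominus>\<^bsub>L\<^esub> \<one>\<^bsub>L\<^esub> \<in> carrier L" by simp
      \<comment> \<open>\<open>x\<close> and \<open>y\<close> are related to the same
        \<open>r\<close>. Closure of the relation under sums and under the scalar -1 relates their
        difference to zero.\<close>
      have "\<rho> (x \<oplus>\<^bsub>M\<^esub> ((\<ominus>\<^bsub>L\<^esub> \<one>\<^bsub>L\<^esub>) \<odot>\<^bsub>M\<^esub> y)) (r \<oplus>\<^bsub>M'\<^esub> ((\<ominus>\<^bsub>L\<^esub> \<one>\<^bsub>L\<^esub>) \<odot>\<^bsub>M'\<^esub> r))"
        using r y yN x m1 submodD(4)[OF N m1] by (intro \<rho>)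
      then have "\<rho> (x \<ominus>\<^bsub>M\<^esub> y) \<zero>\<^bsub>M'\<^esub>"
        using rM NM[OF yN] by (simp add: M.neg_smult M'.neg_smult M.M.minus_eq M'.M.r_neg)
      then have "x \<ominus>\<^bsub>M\<^esub> y \<in> span L M K" using M.submod_minus[OF N x yN] K(3) by blast
      then have "x \<ominus>\<^bsub>M\<^esub> y \<in> span L M (?T \<union> K)" "y \<in> span L M (?T \<union> K)"
        using y span_mono[of _ "?T \<union> K"] by blast+
      then have "y \<oplus>\<^bsub>M\<^esub> (x \<ominus>\<^bsub>M\<^esub> y) \<in> span L M (?T \<union> K)"
        by (intro submodD(3)[OF M.submod_span[OF TKM]])
      then show "x \<in> span L M (?T \<union> K)" using M.add_minus_cancel NM x yN by simp
    qed
  qed (use TKN K(1) T'(1) in simp_all)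
qed

section \<open>Noetherian rings\<close>

definition regular_module :: "('a, 'y) ring_scheme \<Rightarrow> ('a, 'a) module" where
  "regular_module L = \<lparr>carrier = carrier L, mult = mult L, one = one L, zero = zero L, add = add L,
     smult = (\<lambda>a x. x \<otimes>\<^bsub>L\<^esub> a)\<rparr>"

lemma regular_module_simps [simp]:
  "carrier (regular_module L) = carrier L" "zero (regular_module L) = zero L"
  "add (regular_module L) = add L" "a \<odot>\<^bsub>regular_module L\<^esub> x = x \<otimes>\<^bsub>L\<^esub> a"
  by (simp_all add: regular_module_def)

lemma rmod_regular:
  assumes "ring L"
  shows "rmod L (regular_module L)"
proof -
  interpret ring L by fact
  have "abelian_group (regular_module L)"
    by (rule abelian_groupI) (auto simp: a_ac intro: l_neg exI[of _ "\<ominus>\<^bsub>L\<^esub> _"] bexI[of _ "\<ominus>\<^bsub>L\<^esub> _"])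
  then show ?thesis
    unfolding rmod_def rmod_axioms_def using assms by (auto simp: r_distr l_distr m_assoc)
qed

text \<open>Submodules of the regular module are the right ideals of \<open>L\<close>, so this is
  the usual condition.\<close>

definition right_noetherian :: "('a, 'y) ring_scheme \<Rightarrow> bool" where
  "right_noetherian L \<longleftrightarrow> ring L \<and> (\<forall>H. submod L (regular_module L) H \<longrightarrow> fg_submod L (regular_module L) H)"

text \<open>Induction on the generators. Modulo \<open>span L M S\<close> an element of
  \<open>N\<close> is a multiple of \<open>s\<close>; the coefficients that occur form a right
  ideal, finitely generated by assumption, and the elements with coefficient zero form
  \<open>N \<inter> span L M S\<close>.\<close>

lemma fg_submod_of_noetherian:
  assumes "right_noetherian L" "rmod L M" "finite S" "S \<subseteq> carrier M" "submod L M N" "N \<subseteq> span L M S"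
  shows "fg_submod L M N"
  using assms(3-)
proof (induction S arbitrary: N rule: finite_induct)
  case empty
  then have "N = span L M {}" by (auto simp: submod_def)
  then show ?case unfolding fg_submod_def by blast
next
  case (insert s S)
  interpret M: rmod L M by fact
  have "ring L" using assms(1) by (simp add: right_noetherian_def)
  interpret R: rmod L "regular_module L" by (rule rmod_regular) fact
  have s: "s \<in> carrier M" and S: "S \<subseteq> carrier M" using insert.prems by auto
  note N = submodD[OF insert.prems(2)] and sp = submodD[OF M.submod_span[OF S]]
  \<comment> \<open>The relation collects every possible coefficient of \<open>s\<close> in
    \<open>x\<close>. It may be multivalued, since a multiple of \<open>s\<close> can lie in the
    span of \<open>S\<close>; the elements related to zero are nevertheless exactly that
    span.\<close>
  define \<rho> where "\<rho> x r \<longleftrightarrow> r \<in> carrier L \<and> (\<exists>y\<in>span L M S. x = (r \<odot>\<^bsub>M\<^esub> s) \<oplus>\<^bsub>M\<^esub> y)" for x r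
  define J where "J = {r. \<exists>x\<in>N. \<rho> x r}"
  have \<rho>: "\<rho> (x \<oplus>\<^bsub>M\<^esub> y) (r \<oplus>\<^bsub>L\<^esub> r')" if h: "\<rho> x r" "\<rho> y r'" for x y r r'
  proof -
    obtain x' y' where "x' \<in> span L M S" "y' \<in> span L M S" "x = (r \<odot>\<^bsub>M\<^esub> s) \<oplus>\<^bsub>M\<^esub> x'" "y = (r' \<odot>\<^bsub>M\<^esub> s) \<oplus>\<^bsub>M\<^esub> y'"
      "r \<in> carrier L" "r' \<in> carrier L"
      using h unfolding \<rho>_def by blast
    then show ?thesis
      using s sp(1) unfolding \<rho>_def
      by (intro conjI bexI[of _ "x' \<oplus>\<^bsub>M\<^esub> y'"] sp) (simp_all add: M.smult_l_distr M.M.a_ac)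
  qed
  have \<rho>': "\<rho> (a \<odot>\<^bsub>M\<^esub> x) (r \<otimes>\<^bsub>L\<^esub> a)" if h: "\<rho> x r" "a \<in> carrier L" for x r a
  proof -
    obtain x' where "x' \<in> span L M S" "x = (r \<odot>\<^bsub>M\<^esub> s) \<oplus>\<^bsub>M\<^esub> x'" "r \<in> carrier L"
      using h unfolding \<rho>_def by blast
    then show ?thesis
      using s sp(1) h unfolding \<rho>_def
      by (intro conjI bexI[of _ "a \<odot>\<^bsub>M\<^esub> x'"] sp) (simp_all add: M.smult_r_distr M.smult_assoc)
  qed
  have \<rho>0: "\<rho> x \<zero>\<^bsub>L\<^esub> \<longleftrightarrow> x \<in> span L M S" for x
    using s sp(1) by (auto simp: \<rho>_def)
  have J: "submod L (regular_module L) J"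
    unfolding submod_def
  proof (intro conjI ballI)
    show "J \<subseteq> carrier (regular_module L)" by (auto simp: J_def \<rho>_def)
    show "\<zero>\<^bsub>regular_module L\<^esub> \<in> J" using N(2) sp(2) \<rho>0 by (auto simp: J_def)
    show "x \<oplus>\<^bsub>regular_module L\<^esub> y \<in> J" if "x \<in> J" "y \<in> J" for x y
      using that \<rho> N(3) unfolding J_def by simp metis
    show "a \<odot>\<^bsub>regular_module L\<^esub> x \<in> J" if "a \<in> carrier L" "x \<in> J" for a x
      using that \<rho>' N(4) unfolding J_def by simp metis
  qed
  have K: "submod L M (N \<inter> span L M S)"
    using N sp by (auto simp: submod_def)
  show ?case
  proof (rule fg_submod_extension[where \<rho> = \<rho> and J = J, OF assms(2) R.rmod_axioms insert.prems(2)])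
    show "fg_submod L (regular_module L) J" using J assms(1) by (simp add: right_noetherian_def)
    show "\<exists>r\<in>J. \<rho> x r" if "x \<in> N" for x
    proof -
      have "x \<in> span L M (insert s S)" using insert.prems that by auto
      then have "\<exists>r. \<rho> x r" unfolding \<rho>_def
        by (rule M.span_insertE[OF _ insert.prems(1)]) blast
      then show ?thesis using that by (auto simp: J_def)
    qed
    have "{x \<in> N. \<rho> x \<zero>\<^bsub>regular_module L\<^esub>} = N \<inter> span L M S" using \<rho>0 by auto
    then show "fg_submod L M {x \<in> N. \<rho> x \<zero>\<^bsub>regular_module L\<^esub>}"
      using insert.IH[OF S K] by simp
  qed (use \<rho> \<rho>' \<rho>0 span.zero in \<open>auto simp: J_def\<close>)
qed

section \<open>Artinian commutative rings are noetherian\<close>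

text \<open>Negatives arise from multiplication by -1, and commutativity makes a right ideal
  two-sided. The descending chain condition speaks of \<open>ideal\<close>, so chains of submodules
  have to be converted.\<close>

lemma ideal_if_submod_regular:
  assumes "cring R" "submod R (regular_module R) I"
  shows "ideal I R"
proof -
  interpret cring R by fact
  interpret R: rmod R "regular_module R" by (rule rmod_regular) (rule ring_axioms)
  have I: "I \<subseteq> carrier R" "\<zero>\<^bsub>R\<^esub> \<in> I" "\<And>x y. x \<in> I \<Longrightarrow> y \<in> I \<Longrightarrow> x \<oplus>\<^bsub>R\<^esub> y \<in> I"
    "\<And>a x. a \<in> carrier R \<Longrightarrow> x \<in> I \<Longrightarrow> x \<otimes>\<^bsub>R\<^esub> a \<in> I"
    using assms(2) by (auto simp: submod_def)
  have neg: "\<ominus>\<^bsub>R\<^esub> x \<in> I" if "x \<in> I" for x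
    using I(1) I(4)[of "\<ominus>\<^bsub>R\<^esub> \<one>\<^bsub>R\<^esub>" x] that by (auto simp: r_minus subset_eq)
  show ?thesis
  proof (rule idealI)
    show "subgroup I (add_monoid R)"
      by (rule subgroup.intro) (use I neg in \<open>auto simp: a_inv_def\<close>)
    show "a \<otimes>\<^bsub>R\<^esub> x \<in> I" if "a \<in> I" "x \<in> carrier R" for a x using I that by simp
    then show "x \<otimes>\<^bsub>R\<^esub> a \<in> I" if "a \<in> I" "x \<in> carrier R" for a x
      using I that m_comm[of x a] by auto
  qed (rule ring_axioms)
qed

text \<open>Dependent choice along the order of the natural numbers: each term avoids the span of
  its finitely many predecessors.\<close>

lemma infinite_independent_sequence:
  fixes M :: "('a, 'm, 'z) module_scheme"
  assumes "\<And>F. finite F \<Longrightarrow> F \<subseteq> N \<Longrightarrow> \<exists>x\<in>N. x \<notin> span L M F"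
  shows "\<exists>f :: nat \<Rightarrow> 'm. \<forall>n. f n \<in> N \<and> f n \<notin> span L M (f ` {..<n})"
proof -
  \<comment> \<open>The inclusion guard makes the choice step solvable for an arbitrary
    \<open>f\<close>. It holds for the sequence found, because all its values lie in
    \<open>N\<close>.\<close>
  have "\<exists>f :: nat \<Rightarrow> 'm. \<forall>n. f n \<in> N \<and> (f ` {..<n} \<subseteq> N \<longrightarrow> f n \<notin> span L M (f ` {..<n}))"
  proof (rule dependent_wf_choice[OF wf_less])
    fix f g :: "nat \<Rightarrow> 'm" and x r
    assume "\<And>z. (z, r) \<in> {(x, y). x < y} \<Longrightarrow> f z = g z"
    then have "f ` {..<r} = g ` {..<r}" by (intro image_cong) auto
    then show "(x \<in> N \<and> (f ` {..<r} \<subseteq> N \<longrightarrow> x \<notin> span L M (f ` {..<r}))) =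
        (x \<in> N \<and> (g ` {..<r} \<subseteq> N \<longrightarrow> x \<notin> span L M (g ` {..<r})))" by simp
  next
    fix f :: "nat \<Rightarrow> 'm" and n
    show "\<exists>x. x \<in> N \<and> (f ` {..<n} \<subseteq> N \<longrightarrow> x \<notin> span L M (f ` {..<n}))"
    proof (cases "f ` {..<n} \<subseteq> N")
      case True
      then show ?thesis using assms[of "f ` {..<n}"] by blast
    next
      case False
      then show ?thesis using assms[of "{}"] by blast
    qed
  qed
  then obtain f where f: "\<And>n::nat. f n \<in> N" "\<And>n. f ` {..<n} \<subseteq> N \<Longrightarrow> f n \<notin> span L M (f ` {..<n})" by blast
  then have "f n \<notin> span L M (f ` {..<n})" for n by blast
  then show ?thesis using f(1) by blast
qed

text \<open>
  If the conclusion fails, choose an ideal \<open>N\<close> minimal among those that are not finitely generated. Every ring element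
  annihilates \<open>N\<close> or acts invertibly on it, so that \<open>N\<close> is an infinite-dimensional vector space, which
  contradicts the descending chain condition.
\<close>

lemma artinian_imp_noetherian:
  assumes "artinian_cring R"
  shows "right_noetherian R"
proof (rule ccontr)
  assume not_noeth: "\<not> right_noetherian R"
  have "cring R" and dcc: "\<And>I :: nat \<Rightarrow> _. (\<And>n. ideal (I n) R) \<Longrightarrow> (\<And>n. I (Suc n) \<subseteq> I n) \<Longrightarrow> \<exists>N. \<forall>n\<ge>N. I n = I N"
    using assms unfolding artinian_cring_def by blast+
  interpret cring R by fact
  let ?R = "regular_module R"
  interpret R: rmod R ?R by (rule rmod_regular) (rule ring_axioms)
  note to_ideal = ideal_if_submod_regular[OF \<open>cring R\<close>]
  \<comment> \<open>The descending chain condition as well-foundedness of strict inclusion, from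
    which the minimal \<open>N\<close> is drawn.\<close>
  have "wf {(I, J). submod R ?R I \<and> submod R ?R J \<and> I \<subset> J}"
    unfolding wf_iff_no_infinite_down_chain
  proof
    assume "\<exists>f. \<forall>i. (f (Suc i), f i) \<in> {(I, J). submod R ?R I \<and> submod R ?R J \<and> I \<subset> J}"
    then obtain f where f: "\<And>i::nat. submod R ?R (f i)" "\<And>i. f (Suc i) \<subset> f i" by blast
    obtain N where "\<forall>n\<ge>N. f n = f N" using dcc[of f] to_ideal f by blast
    then show False using f(2)[of N] by (metis le_Suc_eq order.refl psubset_eq)
  qed
  moreover obtain H where "H \<in> {H. submod R ?R H \<and> \<not> fg_submod R ?R H}"
    using not_noeth ring_axioms unfolding right_noetherian_def by blast
  ultimately obtain N where N: "submod R ?R N" "\<not> fg_submod R ?R N"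
    and min: "\<And>H. submod R ?R H \<Longrightarrow> H \<subset> N \<Longrightarrow> fg_submod R ?R H"
    using wfE_min[of "{(I, J). submod R ?R I \<and> submod R ?R J \<and> I \<subset> J}" H "{H. submod R ?R H \<and> \<not> fg_submod R ?R H}"]
    by simp metis
  have NR: "\<And>x. x \<in> N \<Longrightarrow> x \<in> carrier R" using submodD(1)[OF N(1)] by simp
  have N0: "\<zero>\<^bsub>R\<^esub> \<in> N" and Nadd: "\<And>x y. x \<in> N \<Longrightarrow> y \<in> N \<Longrightarrow> x \<oplus>\<^bsub>R\<^esub> y \<in> N"
    and Nmult: "\<And>a x. a \<in> carrier R \<Longrightarrow> x \<in> N \<Longrightarrow> x \<otimes>\<^bsub>R\<^esub> a \<in> N"
    using submodD(2-4)[OF N(1)] by simp_all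
  \<comment> \<open>Otherwise image and kernel of multiplication by \<open>r\<close> on
    \<open>N\<close> are both strictly smaller than \<open>N\<close>, hence finitely generated by
    minimality, and \<open>N\<close> is an extension of the two.\<close>
  have image_or_zero: "(\<lambda>x. x \<otimes>\<^bsub>R\<^esub> r) ` N = N \<or> (\<forall>x\<in>N. x \<otimes>\<^bsub>R\<^esub> r = \<zero>\<^bsub>R\<^esub>)" if r: "r \<in> carrier R" for r
  proof (rule ccontr)
    assume neg: "\<not> ?thesis"
    let ?J = "(\<lambda>x. x \<otimes>\<^bsub>R\<^esub> r) ` N" and ?K = "{x \<in> N. x \<otimes>\<^bsub>R\<^esub> r = \<zero>\<^bsub>R\<^esub>}"
    have "submod R ?R ?J"
      unfolding submod_def
    proof (intro conjI ballI)
      show "?J \<subseteq> carrier ?R" using r NR by auto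
      show "\<zero>\<^bsub>?R\<^esub> \<in> ?J" using r N0 by (auto intro!: rev_image_eqI[of "\<zero>\<^bsub>R\<^esub>"])
      show "x \<oplus>\<^bsub>?R\<^esub> y \<in> ?J" if "x \<in> ?J" "y \<in> ?J" for x y
        using that r NR Nadd by (auto simp flip: l_distr)
      show "a \<odot>\<^bsub>?R\<^esub> x \<in> ?J" if a: "a \<in> carrier R" "x \<in> ?J" for a x
      proof -
        obtain y where y: "y \<in> N" "x = y \<otimes>\<^bsub>R\<^esub> r" using a by blast
        then have "a \<odot>\<^bsub>?R\<^esub> x = (y \<otimes>\<^bsub>R\<^esub> a) \<otimes>\<^bsub>R\<^esub> r" using a r NR by (simp add: m_ac)
        then show ?thesis using y a Nmult by blast
      qed
    qed
    moreover have "?J \<subset> N" using neg r Nmult by auto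
    ultimately have fgJ: "fg_submod R ?R ?J" by (rule min)
    have swap: "x \<otimes>\<^bsub>R\<^esub> a \<otimes>\<^bsub>R\<^esub> r = x \<otimes>\<^bsub>R\<^esub> r \<otimes>\<^bsub>R\<^esub> a" if "x \<in> N" "a \<in> carrier R" for x a
      using that r NR by (simp add: m_ac)
    then have "submod R ?R ?K"
      using r NR N0 Nadd Nmult by (auto simp: submod_def l_distr)
    moreover have "?K \<subset> N" using neg by auto
    ultimately have fgK: "fg_submod R ?R ?K" by (rule min)
    have "fg_submod R ?R N"
      by (rule fg_submod_extension[where \<rho> = "\<lambda>x y. y = x \<otimes>\<^bsub>R\<^esub> r", OF R.rmod_axioms R.rmod_axioms N(1) fgJ])
        (use r NR fgK in \<open>auto simp: l_distr swap eq_commute[of "\<zero>\<^bsub>R\<^esub>"]\<close>)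
    then show False using N(2) by blast
  qed
  \<comment> \<open>The chain of ideals generated by the powers of \<open>r\<close> stabilises,
    which gives \<open>r^n = r^(n+1) b\<close>. Since \<open>N = N r^n\<close>, every
    \<open>x\<close> in \<open>N\<close> is some \<open>y r^n\<close>, and
    \<open>x r b = y r^(n+1) b = x\<close>.\<close>
  have invertible: "\<exists>b\<in>carrier R. \<forall>x\<in>N. x \<otimes>\<^bsub>R\<^esub> r \<otimes>\<^bsub>R\<^esub> b = x"
    if r: "r \<in> carrier R" and rN: "(\<lambda>x. x \<otimes>\<^bsub>R\<^esub> r) ` N = N" for r
  proof -
    define I where "I n = (\<lambda>a. (r [^]\<^bsub>R\<^esub> n) \<otimes>\<^bsub>R\<^esub> a) ` carrier R" for n :: nat
    have "submod R ?R (I n)" for n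
      unfolding submod_def
    proof (intro conjI ballI)
      show "I n \<subseteq> carrier ?R" using r by (auto simp: I_def)
      show "\<zero>\<^bsub>?R\<^esub> \<in> I n" using r by (auto simp: I_def intro!: rev_image_eqI[of "\<zero>\<^bsub>R\<^esub>"])
      show "x \<oplus>\<^bsub>?R\<^esub> y \<in> I n" if "x \<in> I n" "y \<in> I n" for x y
        using that r by (auto simp: I_def simp flip: r_distr)
      show "a \<odot>\<^bsub>?R\<^esub> x \<in> I n" if "a \<in> carrier R" "x \<in> I n" for a x
        using that r by (auto simp: I_def m_assoc)
    qed
    moreover have "I (Suc n) \<subseteq> I n" for n
      using r by (auto simp: I_def m_assoc)
    ultimately obtain n where n: "\<And>m. m \<ge> n \<Longrightarrow> I m = I n" using dcc[of I] to_ideal by blast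
    have "I (Suc n) = I n" by (rule n) simp
    moreover have "r [^]\<^bsub>R\<^esub> n \<in> I n" using r by (auto simp: I_def intro!: rev_image_eqI[of "\<one>\<^bsub>R\<^esub>"])
    ultimately obtain b where b: "b \<in> carrier R" "r [^]\<^bsub>R\<^esub> n = (r [^]\<^bsub>R\<^esub> Suc n) \<otimes>\<^bsub>R\<^esub> b"
      unfolding I_def by blast
    have pow: "(\<lambda>x. x \<otimes>\<^bsub>R\<^esub> (r [^]\<^bsub>R\<^esub> m)) ` N = N" for m :: nat
    proof (induction m)
      case 0
      then show ?case using NR by (auto intro!: rev_image_eqI)
    next
      case (Suc m)
      have "(\<lambda>x. x \<otimes>\<^bsub>R\<^esub> (r [^]\<^bsub>R\<^esub> Suc m)) ` N = (\<lambda>x. x \<otimes>\<^bsub>R\<^esub> r) ` ((\<lambda>x. x \<otimes>\<^bsub>R\<^esub> (r [^]\<^bsub>R\<^esub> m)) ` N)"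
        unfolding image_image using r NR by (intro image_cong) (auto simp: m_assoc)
      then show ?case using Suc rN by simp
    qed
    have "x \<otimes>\<^bsub>R\<^esub> r \<otimes>\<^bsub>R\<^esub> b = x" if x: "x \<in> N" for x
    proof -
      obtain y where y: "y \<in> N" "x = y \<otimes>\<^bsub>R\<^esub> (r [^]\<^bsub>R\<^esub> n)" using pow[of n] x by blast
      then have "x \<otimes>\<^bsub>R\<^esub> r \<otimes>\<^bsub>R\<^esub> b = y \<otimes>\<^bsub>R\<^esub> ((r [^]\<^bsub>R\<^esub> Suc n) \<otimes>\<^bsub>R\<^esub> b)"
        using r b(1) NR by (simp add: m_assoc)
      also have "\<dots> = x" unfolding b(2)[symmetric] using y by simp
      finally show ?thesis .
    qed
    then show ?thesis using b by blast
  qed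
  have "\<exists>x\<in>N. x \<notin> span R ?R F" if F: "finite F" "F \<subseteq> N" for F
  proof (rule ccontr)
    assume "\<not> ?thesis"
    then have "fg_submod R ?R N" by (intro R.fg_submodI[OF N(1) F]) blast
    then show False using N(2) by blast
  qed
  then obtain f where f: "\<And>n::nat. f n \<in> N" "\<And>n. f n \<notin> span R ?R (f ` {..<n})"
    using infinite_independent_sequence[of N R ?R] by blast
  have fR: "f ` A \<subseteq> carrier ?R" for A using f NR by auto
  note sp = R.submod_span[OF fR]
  have indep: "f n \<notin> span R ?R (f ` {n<..<m})" for n m
  proof (induction m)
    case 0
    then show ?case using f(2)[of n] span.zero[of ?R R] by auto
  next
    case (Suc m)
    show ?case
    proof
      assume h: "f n \<in> span R ?R (f ` {n<..<Suc m})"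
      show False
      proof (cases "n < m")
        case False
        then have "{n<..<Suc m} = {n<..<m}" by auto
        then show False using h Suc by simp
      next
        case True
        then have "{n<..<Suc m} = insert m {n<..<m}" by auto
        then have "f n \<in> span R ?R (insert (f m) (f ` {n<..<m}))" using h by simp
        moreover have "insert (f m) (f ` {n<..<m}) \<subseteq> carrier ?R" using fR[of "insert m {n<..<m}"] by simp
        ultimately obtain a y where ay: "a \<in> carrier R" "y \<in> span R ?R (f ` {n<..<m})" "f n = (a \<odot>\<^bsub>?R\<^esub> f m) \<oplus>\<^bsub>?R\<^esub> y"
          by (rule R.span_insertE)
        have y: "y \<in> carrier R" using ay(2) submodD(1)[OF sp] by fastforce
        have fm: "f m \<in> carrier R" "f n \<in> carrier R" using f NR by auto
        show False
        proof (cases "\<forall>x\<in>N. x \<otimes>\<^bsub>R\<^esub> a = \<zero>\<^bsub>R\<^esub>")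
          case True
          then have "f n = y" using ay y f by simp
          then show False using ay Suc by simp
        next
          case False
          then obtain b where b: "b \<in> carrier R" "\<And>x. x \<in> N \<Longrightarrow> x \<otimes>\<^bsub>R\<^esub> a \<otimes>\<^bsub>R\<^esub> b = x"
            using image_or_zero invertible ay by meson
          have "f m \<otimes>\<^bsub>R\<^esub> a = f n \<ominus>\<^bsub>?R\<^esub> y"
            using ay(1,3) y fm R.add_diff_eq[of y "f m \<otimes>\<^bsub>R\<^esub> a"] by (simp add: a_comm)
          then have eq: "f m = b \<odot>\<^bsub>?R\<^esub> (f n \<ominus>\<^bsub>?R\<^esub> y)"
            using b(2)[of "f m"] f(1) by simp
          have "f ` {n<..<m} \<subseteq> f ` {..<m}" by auto
          then have "f n \<in> span R ?R (f ` {..<m})" "y \<in> span R ?R (f ` {..<m})"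
            using \<open>n < m\<close> ay(2) span_mono[of "f ` {n<..<m}" "f ` {..<m}" R ?R] R.span_superset[OF fR]
            by auto
          then have "f m \<in> span R ?R (f ` {..<m})"
            unfolding eq using b R.submod_minus[OF sp] submodD(4)[OF sp] by blast
          then show False using f(2) by blast
        qed
      qed
    qed
  qed
  \<comment> \<open>The tails of the sequence span a descending chain of ideals. Where it
    stabilises, \<open>f n\<close> lies in the span of later terms, against
    \<open>indep\<close>.\<close>
  have "span R ?R (f ` {Suc k..}) \<subseteq> span R ?R (f ` {k..})" for k
    by (intro span_mono image_mono) auto
  then obtain n where n: "\<And>m. m \<ge> n \<Longrightarrow> span R ?R (f ` {m..}) = span R ?R (f ` {n..})"
    using dcc[of "\<lambda>n. span R ?R (f ` {n..})"] to_ideal[OF sp] by blast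
  have "span R ?R (f ` {Suc n..}) = span R ?R (f ` {n..})" by (rule n) simp
  moreover have "f n \<in> span R ?R (f ` {n..})" by (intro R.span_superset fR) simp
  ultimately have "f n \<in> span R ?R (f ` {Suc n..})" by blast
  then obtain F where F: "finite F" "F \<subseteq> f ` {Suc n..}" "f n \<in> span R ?R F"
    using span_finite_support by metis
  then obtain A where A: "finite A" "A \<subseteq> {Suc n..}" "F = f ` A" by (meson finite_subset_image)
  obtain m where "\<And>k. k \<in> A \<Longrightarrow> k < m" using A(1)[unfolded finite_nat_set_iff_bounded] by blast
  then have "A \<subseteq> {n<..<m}" using A(2) by auto
  then have "F \<subseteq> f ` {n<..<m}" using A(3) by blast
  then show False using F(3) indep span_mono by blast
qed

text \<open>\<open>M\<close> is regarded as a module over \<open>R\<close>, which acts centrally.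
  Products of generators of \<open>L\<close> and of \<open>M\<close> generate it over
  \<open>R\<close>, and \<open>R\<close> is noetherian; generators of \<open>H\<close> over
  \<open>R\<close> also generate it over \<open>L\<close>.\<close>

lemma artin_algebra_fg_submod:
  assumes "artin_algebra R L" "rmod L M" "fg_submod L M (carrier M)" "submod L M H"
  shows "fg_submod L M H"
proof -
  have R: "artinian_cring R" "module R L" and L: "ring L" and fgL: "finitely_generated_module R L"
    and bal: "\<And>r x y. r \<in> carrier R \<Longrightarrow> x \<in> carrier L \<Longrightarrow> y \<in> carrier L \<Longrightarrow> (r \<odot>\<^bsub>L\<^esub> x) \<otimes>\<^bsub>L\<^esub> y = r \<odot>\<^bsub>L\<^esub> (x \<otimes>\<^bsub>L\<^esub> y)"
      "\<And>r x y. r \<in> carrier R \<Longrightarrow> x \<in> carrier L \<Longrightarrow> y \<in> carrier L \<Longrightarrow> x \<otimes>\<^bsub>L\<^esub> (r \<odot>\<^bsub>L\<^esub> y) = r \<odot>\<^bsub>L\<^esub> (x \<otimes>\<^bsub>L\<^esub> y)"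
    using assms(1) unfolding artin_algebra_def by blast+
  interpret L: ring L by fact
  interpret RL: module R L by fact
  interpret M: rmod L M by fact
  \<comment> \<open>Restriction of scalars along the map that sends \<open>r\<close> to
    \<open>r\<close> times the unit of \<open>L\<close>.\<close>
  define M' where "M' = \<lparr>carrier = carrier M, mult = mult M, one = one M, zero = zero M, add = add M,
    smult = (\<lambda>r x. (r \<odot>\<^bsub>L\<^esub> \<one>\<^bsub>L\<^esub>) \<odot>\<^bsub>M\<^esub> x)\<rparr>"
  have M' [simp]: "carrier M' = carrier M" "zero M' = zero M" "add M' = add M"
    "\<And>r x. r \<odot>\<^bsub>M'\<^esub> x = (r \<odot>\<^bsub>L\<^esub> \<one>\<^bsub>L\<^esub>) \<odot>\<^bsub>M\<^esub> x"
    by (simp_all add: M'_def)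
  have "abelian_group M'"
    by (rule abelian_groupI) (auto simp: M.M.a_ac intro: M.M.l_neg bexI[of _ "\<ominus>\<^bsub>M\<^esub> _"])
  moreover have "((a \<otimes>\<^bsub>R\<^esub> b) \<odot>\<^bsub>L\<^esub> \<one>\<^bsub>L\<^esub>) = (a \<odot>\<^bsub>L\<^esub> \<one>\<^bsub>L\<^esub>) \<otimes>\<^bsub>L\<^esub> (b \<odot>\<^bsub>L\<^esub> \<one>\<^bsub>L\<^esub>)"
    if "a \<in> carrier R" "b \<in> carrier R" for a b
    using that by (simp add: bal(1) RL.smult_assoc1)
  ultimately have "rmod R M'"
    unfolding rmod_def rmod_axioms_def
    using RL.R.ring_axioms
    by (auto simp: RL.smult_l_distr M.smult_l_distr M.smult_r_distr M.smult_assoc)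
  then interpret M': rmod R M' .
  \<comment> \<open>Commutativity of \<open>R\<close> reconciles the left action of the locale
    \<open>module\<close> with the reversed product in \<open>rmod\<close>.\<close>
  have "rmod R L"
    unfolding rmod_def rmod_axioms_def
    using RL.R.ring_axioms L.abelian_group_axioms
    by (auto simp: RL.smult_l_distr RL.smult_r_distr RL.smult_assoc1[symmetric] RL.R.m_comm)
  then interpret L': rmod R L .
  obtain B where B: "finite B" "B \<subseteq> carrier L" "carrier L = span R L B"
    using fgL unfolding L'.finitely_generated_module_iff fg_submod_def by blast
  obtain S where S: "finite S" "S \<subseteq> carrier M" "carrier M = span L M S"
    using assms(3) unfolding fg_submod_def by blast
  define T where "T = (\<lambda>(b, s). b \<odot>\<^bsub>M\<^esub> s) ` (B \<times> S)"
  have T: "finite T" "T \<subseteq> carrier M'" using B(1,2) S(1,2) by (auto simp: T_def)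
  note spT = M'.submod_span[OF T(2)]
  have smult_span: "a \<odot>\<^bsub>M\<^esub> s \<in> span R M' T" if s: "s \<in> S" and a: "a \<in> span R L B" for a s
    using a
  proof induction
    case zero
    then show ?case using s S span.zero[of M' R T] by (auto simp: subset_eq)
  next
    case (step b r x)
    have in': "b \<in> carrier L" "x \<in> carrier L" "s \<in> carrier M" using step B(2,3) s S(2) by auto
    \<comment> \<open>With the scalar as right factor, \<open>smult_assoc\<close> lets
      \<open>b\<close> act on \<open>s\<close> before \<open>r\<close> does, so that a generator
      from \<open>T\<close> appears.\<close>
    have "r \<odot>\<^bsub>L\<^esub> b = b \<otimes>\<^bsub>L\<^esub> (r \<odot>\<^bsub>L\<^esub> \<one>\<^bsub>L\<^esub>)" using bal in' step by simp
    then have "((r \<odot>\<^bsub>L\<^esub> b) \<oplus>\<^bsub>L\<^esub> x) \<odot>\<^bsub>M\<^esub> s = (r \<odot>\<^bsub>M'\<^esub> (b \<odot>\<^bsub>M\<^esub> s)) \<oplus>\<^bsub>M'\<^esub> (x \<odot>\<^bsub>M\<^esub> s)"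
      using in' step by (simp add: M.smult_l_distr M.smult_assoc)
    also have "\<dots> \<in> span R M' T" using step s by (intro span.step) (auto simp: T_def)
    finally show ?case .
  qed
  have "carrier M \<subseteq> span R M' T"
  proof
    fix x assume "x \<in> carrier M"
    then have "x \<in> span L M S" using S by simp
    then show "x \<in> span R M' T"
    proof induction
      case zero
      then show ?case using span.zero[of M' R T] by simp
    next
      case (step s a x)
      then show ?case using smult_span[of s a] submodD(3)[OF spT] B(3) by simp
    qed
  qed
  moreover have HR: "submod R M' H"
    using assms(4) by (auto simp: submod_def)
  ultimately have "fg_submod R M' H"
    using submodD(1)[OF assms(4)]
    by (intro fg_submod_of_noetherian[OF artinian_imp_noetherian[OF R(1)] M'.rmod_axioms T HR]) blast
  then obtain F where F: "finite F" "F \<subseteq> H" "H = span R M' F" by (rule M'.fg_submodE)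
  show ?thesis
  proof (rule M.fg_submodI[OF assms(4) F(1,2)])
    have "F \<subseteq> carrier M" using F(2) submodD(1)[OF assms(4)] by blast
    \<comment> \<open>The span over \<open>L\<close> is in particular stable under \<open>R\<close>,
      so it contains the span of \<open>F\<close> over \<open>R\<close>, which is
      \<open>H\<close>.\<close>
    then have "submod R M' (span L M F)" "F \<subseteq> span L M F"
      using M.submod_span[of F] M.span_superset by (auto simp: submod_def)
    then show "H \<subseteq> span L M F" unfolding F(3) using span_subset_submod by blast
  qed
qed

section \<open>Homomorphisms, direct sums and projective modules\<close>

lemma mod_cat_simps [simp]:
  "cat_hom (mod_cat L) = module_hom L" "cat_id (mod_cat L) X = restrict id (carrier X)"
  "cat_comp (mod_cat L) X Y Z g f = compose (carrier X) g f"
  by (simp_all add: mod_cat_def)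

lemma mod_cat_obj_iff: "M \<in> cat_obj (mod_cat L) \<longleftrightarrow> rmod L M \<and> fg_submod L M (carrier M)"
  using rmod.finitely_generated_module_iff by (auto simp: mod_cat_def right_module_iff)

lemma compose_eq_iff:
  "compose A g f = compose A g' f' \<longleftrightarrow> (\<forall>x\<in>A. g (f x) = g' (f' x))"
  by (auto simp: compose_def fun_eq_iff)

lemma module_homI:
  assumes "\<And>x. x \<in> carrier M \<Longrightarrow> f x \<in> carrier N"
    and "\<And>x y. x \<in> carrier M \<Longrightarrow> y \<in> carrier M \<Longrightarrow> f (x \<oplus>\<^bsub>M\<^esub> y) = f x \<oplus>\<^bsub>N\<^esub> f y"
    and "\<And>a x. a \<in> carrier L \<Longrightarrow> x \<in> carrier M \<Longrightarrow> f (a \<odot>\<^bsub>M\<^esub> x) = a \<odot>\<^bsub>N\<^esub> f x"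
    and "rmod L M"
  shows "restrict f (carrier M) \<in> module_hom L M N"
proof -
  interpret rmod L M by fact
  show ?thesis using assms by (auto simp: module_hom_def)
qed

lemma hom_in: "f \<in> module_hom L M N \<Longrightarrow> x \<in> carrier M \<Longrightarrow> f x \<in> carrier N"
  by (auto simp: module_hom_def)

lemma hom_add: "f \<in> module_hom L M N \<Longrightarrow> x \<in> carrier M \<Longrightarrow> y \<in> carrier M \<Longrightarrow> f (x \<oplus>\<^bsub>M\<^esub> y) = f x \<oplus>\<^bsub>N\<^esub> f y"
  by (auto simp: module_hom_def)

lemma hom_smult: "f \<in> module_hom L M N \<Longrightarrow> a \<in> carrier L \<Longrightarrow> x \<in> carrier M \<Longrightarrow> f (a \<odot>\<^bsub>M\<^esub> x) = a \<odot>\<^bsub>N\<^esub> f x"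
  by (auto simp: module_hom_def)

lemma hom_ext:
  assumes "f \<in> module_hom L M N" "g \<in> module_hom L M N'" "\<And>x. x \<in> carrier M \<Longrightarrow> f x = g x"
  shows "f = g"
  using assms by (intro extensionalityI[of f "carrier M" g]) (auto simp: module_hom_def PiE_iff)

lemma compose_eq_hom_iff:
  assumes "h \<in> module_hom L X Z"
  shows "compose (carrier X) g f = h \<longleftrightarrow> (\<forall>x\<in>carrier X. g (f x) = h x)"
  using assms by (auto simp: compose_def fun_eq_iff module_hom_def PiE_iff extensional_def)

lemma compose_apply [simp]: "x \<in> A \<Longrightarrow> compose A g f x = g (f x)"
  by (simp add: compose_def)

locale rmod_hom = M: rmod L M + N: rmod L N
  for L :: "('a, 'y) ring_scheme" and M :: "('a, 'm, 'u) module_scheme" and N :: "('a, 'n, 'v) module_scheme" +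
  fixes f
  assumes hom: "f \<in> module_hom L M N"
begin

lemma closed [simp]: "x \<in> carrier M \<Longrightarrow> f x \<in> carrier N"
  using hom by (rule hom_in)

lemma add: "x \<in> carrier M \<Longrightarrow> y \<in> carrier M \<Longrightarrow> f (x \<oplus>\<^bsub>M\<^esub> y) = f x \<oplus>\<^bsub>N\<^esub> f y"
  using hom by (rule hom_add)

lemma smult: "a \<in> carrier L \<Longrightarrow> x \<in> carrier M \<Longrightarrow> f (a \<odot>\<^bsub>M\<^esub> x) = a \<odot>\<^bsub>N\<^esub> f x"
  using hom by (rule hom_smult)

lemma zero [simp]: "f \<zero>\<^bsub>M\<^esub> = \<zero>\<^bsub>N\<^esub>"
  using add[of "\<zero>\<^bsub>M\<^esub>" "\<zero>\<^bsub>M\<^esub>"] N.M.add.r_cancel_one'[of "f \<zero>\<^bsub>M\<^esub>" "f \<zero>\<^bsub>M\<^esub>"] by simp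

lemma neg: "x \<in> carrier M \<Longrightarrow> f (\<ominus>\<^bsub>M\<^esub> x) = \<ominus>\<^bsub>N\<^esub> f x"
  using add[of "\<ominus>\<^bsub>M\<^esub> x" x] N.M.minus_equality[of "f (\<ominus>\<^bsub>M\<^esub> x)" "f x"] by (simp add: M.M.l_neg)

lemma minus: "x \<in> carrier M \<Longrightarrow> y \<in> carrier M \<Longrightarrow> f (x \<ominus>\<^bsub>M\<^esub> y) = f x \<ominus>\<^bsub>N\<^esub> f y"
  by (simp add: M.M.minus_eq N.M.minus_eq add neg)

lemma submod_kernel: "submod L M {x \<in> carrier M. f x = \<zero>\<^bsub>N\<^esub>}"
  by (auto simp: submod_def add smult)

lemma submod_image:
  assumes "submod L M H"
  shows "submod L N (f ` H)"
  unfolding submod_def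
proof (intro conjI ballI)
  note H = submodD[OF assms]
  show "f ` H \<subseteq> carrier N" using H(1) by auto
  show "\<zero>\<^bsub>N\<^esub> \<in> f ` H" using H(2) zero by (metis imageI)
  show "x \<oplus>\<^bsub>N\<^esub> y \<in> f ` H" if "x \<in> f ` H" "y \<in> f ` H" for x y
    using that H(1,3) by (auto simp flip: add)
  show "a \<odot>\<^bsub>N\<^esub> x \<in> f ` H" if "a \<in> carrier L" "x \<in> f ` H" for a x
    using that H(1,4) by (auto simp flip: smult)
qed

lemma fg_image:
  assumes "fg_submod L M H"
  shows "fg_submod L N (f ` H)"
proof -
  obtain S where S: "finite S" "S \<subseteq> H" "S \<subseteq> carrier M" "H = span L M S" using assms by (rule M.fg_submodE)
  have "f x \<in> span L N (f ` S)" if "x \<in> span L M S" for x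
    using that
  proof induction
    case zero
    then show ?case by (simp add: span.zero)
  next
    case (step s a x)
    then have "s \<in> carrier M" "x \<in> carrier M" using S M.span_in_carrier by auto
    then show ?case using step by (auto simp: add smult intro!: span.step)
  qed
  moreover have "submod L N (f ` H)" using submod_image M.submod_span S by simp
  ultimately show ?thesis
    using S by (intro N.fg_submodI[of _ "f ` S"]) auto
qed

end

lemma rmod_homI: "M \<in> cat_obj (mod_cat L) \<Longrightarrow> N \<in> cat_obj (mod_cat L) \<Longrightarrow> f \<in> module_hom L M N \<Longrightarrow> rmod_hom L M N f"
  by (simp add: rmod_hom_def rmod_hom_axioms_def mod_cat_obj_iff)

lemma span_submodule: "span L (M\<lparr>carrier := H\<rparr>) S = span L M S"
proof
  show "span L (M\<lparr>carrier := H\<rparr>) S \<subseteq> span L M S"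
  proof
    fix x assume "x \<in> span L (M\<lparr>carrier := H\<rparr>) S"
    then show "x \<in> span L M S"
      by induction (simp_all add: span.zero span.step)
  qed
  show "span L M S \<subseteq> span L (M\<lparr>carrier := H\<rparr>) S"
  proof
    fix x assume "x \<in> span L M S"
    then show "x \<in> span L (M\<lparr>carrier := H\<rparr>) S"
      using span.zero[of "M\<lparr>carrier := H\<rparr>" L S] span.step[of _ S _ L _ "M\<lparr>carrier := H\<rparr>"]
      by induction simp_all
  qed
qed

lemma submod_in_mod_cat:
  assumes "M \<in> cat_obj (mod_cat L)" "submod L M H" "fg_submod L M H"
  shows "M\<lparr>carrier := H\<rparr> \<in> cat_obj (mod_cat L)"
proof -
  interpret M: rmod L M using assms(1) by (simp add: mod_cat_obj_iff)
  note H = submodD[OF assms(2)]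
  have neg: "\<exists>y\<in>H. y \<oplus>\<^bsub>M\<^esub> x = \<zero>\<^bsub>M\<^esub>" if "x \<in> H" for x
    using M.submod_neg[OF assms(2) that] H(1)[OF that] by (intro bexI[of _ "\<ominus>\<^bsub>M\<^esub> x"]) (simp_all add: M.M.l_neg)
  have "abelian_group (M\<lparr>carrier := H\<rparr>)"
    by (rule abelian_groupI) (use H neg in \<open>auto simp: M.M.a_ac\<close>)
  then have "rmod L (M\<lparr>carrier := H\<rparr>)"
    unfolding rmod_def rmod_axioms_def
    using H M.L.ring_axioms by (simp add: M.smult_l_distr M.smult_r_distr M.smult_assoc)
  moreover obtain S where "finite S" "S \<subseteq> H" "H = span L M S" using assms(3) by (rule M.fg_submodE)
  ultimately show ?thesis
    by (auto simp: mod_cat_obj_iff fg_submod_def span_submodule)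
qed

lemma hom_into_submodule:
  assumes "f \<in> module_hom L X M" "f ` carrier X \<subseteq> H"
  shows "f \<in> module_hom L X (M\<lparr>carrier := H\<rparr>)"
  using assms by (auto simp: module_hom_def PiE_iff)

text \<open>Cosets are represented by chosen elements of \<open>M\<close>, so that the quotient is
  again carried by lists. Its operations are those of \<open>M\<close> followed by the choice of a
  representative.\<close>

lemma quotient_exists:
  fixes L :: "('a, 'y) ring_scheme"
  assumes M: "M \<in> cat_obj (mod_cat L)" and H: "submod L M H"
  shows "\<exists>N\<in>cat_obj (mod_cat L). \<exists>e\<in>module_hom L M N. e ` carrier M = carrier N \<and> {x \<in> carrier M. e x = \<zero>\<^bsub>N\<^esub>} = H"
proof -
  interpret M: rmod L M using M by (simp add: mod_cat_obj_iff)
  note HD = submodD[OF H]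
  \<comment> \<open>Elements congruent modulo \<open>H\<close> give the same predicate under
    \<open>SOME\<close>, hence the same representative.\<close>
  define e where "e x = (SOME y. y \<in> carrier M \<and> y \<ominus>\<^bsub>M\<^esub> x \<in> H)" for x
  have e: "e x \<in> carrier M" "e x \<ominus>\<^bsub>M\<^esub> x \<in> H" if "x \<in> carrier M" for x
  proof -
    have "x \<in> carrier M \<and> x \<ominus>\<^bsub>M\<^esub> x \<in> H" using that HD by (simp add: M.M.minus_eq M.M.r_neg)
    then have "e x \<in> carrier M \<and> e x \<ominus>\<^bsub>M\<^esub> x \<in> H" unfolding e_def by (rule someI)
    then show "e x \<in> carrier M" "e x \<ominus>\<^bsub>M\<^esub> x \<in> H" by simp_all
  qed
  have diff_add: "(x \<ominus>\<^bsub>M\<^esub> y) \<oplus>\<^bsub>M\<^esub> (y \<ominus>\<^bsub>M\<^esub> z) = x \<ominus>\<^bsub>M\<^esub> z" "\<ominus>\<^bsub>M\<^esub> (x \<ominus>\<^bsub>M\<^esub> y) = y \<ominus>\<^bsub>M\<^esub> x"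
    if "x \<in> carrier M" "y \<in> carrier M" "z \<in> carrier M" for x y z
    using that by (simp_all add: M.M.minus_eq M.M.minus_add M.M.a_ac M.M.r_neg2 M.M.r_neg1 M.M.r_neg)
  have e_cong: "e x = e y" if "x \<in> carrier M" "y \<in> carrier M" "x \<ominus>\<^bsub>M\<^esub> y \<in> H" for x y
  proof -
    have "z \<ominus>\<^bsub>M\<^esub> x \<in> H \<longleftrightarrow> z \<ominus>\<^bsub>M\<^esub> y \<in> H" if "z \<in> carrier M" for z
      using diff_add(1)[of z x y] diff_add(1)[of z y x] diff_add(2)[of x y] HD(3) M.submod_neg[OF H] that
        \<open>x \<in> carrier M\<close> \<open>y \<in> carrier M\<close> \<open>x \<ominus>\<^bsub>M\<^esub> y \<in> H\<close> by metis
    then show ?thesis unfolding e_def by (metis (no_types, lifting))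
  qed
  have e_eq: "x \<ominus>\<^bsub>M\<^esub> y \<in> H" if "x \<in> carrier M" "y \<in> carrier M" "e x = e y" for x y
    using diff_add(1)[of x "e x" y] diff_add(2)[of "e x" x x] e[of x] e[of y] HD(3) M.submod_neg[OF H] that by metis
  define N :: "('a, 'a list) module" where "N = \<lparr>carrier = e ` carrier M, mult = undefined, one = undefined, zero = e \<zero>\<^bsub>M\<^esub>,
      add = (\<lambda>x y. e (x \<oplus>\<^bsub>M\<^esub> y)), smult = (\<lambda>a x. e (a \<odot>\<^bsub>M\<^esub> x))\<rparr>"
  have N: "carrier N = e ` carrier M" "zero N = e \<zero>\<^bsub>M\<^esub>"
    "\<And>x y. x \<oplus>\<^bsub>N\<^esub> y = e (x \<oplus>\<^bsub>M\<^esub> y)" "\<And>a x. a \<odot>\<^bsub>N\<^esub> x = e (a \<odot>\<^bsub>M\<^esub> x)"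
    by (simp_all add: N_def)
  have e_add: "e (e x \<oplus>\<^bsub>M\<^esub> y) = e (x \<oplus>\<^bsub>M\<^esub> y)" if "x \<in> carrier M" "y \<in> carrier M" for x y
  proof (rule e_cong)
    have "e x \<oplus>\<^bsub>M\<^esub> y \<ominus>\<^bsub>M\<^esub> (x \<oplus>\<^bsub>M\<^esub> y) = (e x \<ominus>\<^bsub>M\<^esub> x) \<oplus>\<^bsub>M\<^esub> (y \<oplus>\<^bsub>M\<^esub> \<ominus>\<^bsub>M\<^esub> y)"
      using that e(1) by (simp add: M.M.minus_eq M.M.minus_add M.M.a_ac)
    then have "e x \<oplus>\<^bsub>M\<^esub> y \<ominus>\<^bsub>M\<^esub> (x \<oplus>\<^bsub>M\<^esub> y) = e x \<ominus>\<^bsub>M\<^esub> x"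
      using that e(1) by (simp add: M.M.r_neg)
    then show "e x \<oplus>\<^bsub>M\<^esub> y \<ominus>\<^bsub>M\<^esub> (x \<oplus>\<^bsub>M\<^esub> y) \<in> H" using e that by simp
  qed (use that e in auto)
  have e_add': "e (y \<oplus>\<^bsub>M\<^esub> e x) = e (y \<oplus>\<^bsub>M\<^esub> x)" if "x \<in> carrier M" "y \<in> carrier M" for x y
    using e_add[OF that] that e(1) by (simp add: M.M.a_comm)
  have e_add'': "e (y \<oplus>\<^bsub>M\<^esub> (z \<oplus>\<^bsub>M\<^esub> e x)) = e (y \<oplus>\<^bsub>M\<^esub> (z \<oplus>\<^bsub>M\<^esub> x))"
    if "x \<in> carrier M" "y \<in> carrier M" "z \<in> carrier M" for x y z
    using e_add'[of x "y \<oplus>\<^bsub>M\<^esub> z"] that e(1) by (simp add: M.M.a_assoc)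
  have e_idem: "e (e x) = e x" if "x \<in> carrier M" for x
    using e_add[of x "\<zero>\<^bsub>M\<^esub>"] that e(1) by simp
  have e_smult: "e (a \<odot>\<^bsub>M\<^esub> e x) = e (a \<odot>\<^bsub>M\<^esub> x)" if "x \<in> carrier M" "a \<in> carrier L" for x a
  proof (rule e_cong)
    have "(a \<odot>\<^bsub>M\<^esub> e x) \<ominus>\<^bsub>M\<^esub> (a \<odot>\<^bsub>M\<^esub> x) = a \<odot>\<^bsub>M\<^esub> (e x \<ominus>\<^bsub>M\<^esub> x)"
      using that e(1) by (simp add: M.M.minus_eq M.smult_r_distr M.smult_neg)
    then show "(a \<odot>\<^bsub>M\<^esub> e x) \<ominus>\<^bsub>M\<^esub> (a \<odot>\<^bsub>M\<^esub> x) \<in> H" using e that HD(4) by simp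
  qed (use that e in auto)
  have abN: "abelian_group N"
  proof (rule abelian_groupI)
    show "\<exists>y\<in>carrier N. y \<oplus>\<^bsub>N\<^esub> x = \<zero>\<^bsub>N\<^esub>" if x: "x \<in> carrier N" for x
    proof -
      from x obtain z where z: "z \<in> carrier M" "x = e z" by (auto simp: N)
      then show ?thesis
        by (intro bexI[of _ "e (\<ominus>\<^bsub>M\<^esub> z)"]) (auto simp: N e e_add e_add' M.M.l_neg)
    qed
  qed (auto simp: N e e_add e_add' e_add'' e_idem M.M.a_ac)
  have rN: "rmod L N"
    unfolding rmod_def rmod_axioms_def using abN M.L.ring_axioms
    by (auto simp: N e e_add e_add' e_idem e_smult) (simp_all add: M.smult_l_distr M.smult_r_distr M.smult_assoc)
  define f where "f = restrict e (carrier M)"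
  have f: "f \<in> module_hom L M N"
    unfolding f_def by (rule module_homI) (auto simp: N e_add e_add' e_smult e e_idem M.rmod_axioms)
  interpret f: rmod_hom L M N f using f rN M.rmod_axioms by (simp add: rmod_hom_def rmod_hom_axioms_def)
  have im: "f ` carrier M = carrier N" by (auto simp: f_def N)
  have "N \<in> cat_obj (mod_cat L)"
    using f.fg_image[of "carrier M"] M rN by (simp add: mod_cat_obj_iff im)
  moreover have "{x \<in> carrier M. f x = \<zero>\<^bsub>N\<^esub>} = H"
  proof -
    have "x \<ominus>\<^bsub>M\<^esub> \<zero>\<^bsub>M\<^esub> = x" if "x \<in> carrier M" for x using that by (simp add: M.M.minus_eq)
    then have "e x = e \<zero>\<^bsub>M\<^esub> \<longleftrightarrow> x \<in> H" if "x \<in> carrier M" for x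
      using e_cong[of x "\<zero>\<^bsub>M\<^esub>"] e_eq[of x "\<zero>\<^bsub>M\<^esub>"] that by auto
    then show ?thesis using HD(1) by (auto simp: f_def N)
  qed
  ultimately show ?thesis using f im by blast
qed

lemma hom_inverse:
  assumes "rmod L M" "rmod L N" "f \<in> module_hom L M N" "bij_betw f (carrier M) (carrier N)"
  shows "restrict (inv_into (carrier M) f) (carrier N) \<in> module_hom L N M"
proof -
  interpret f: rmod_hom L M N f using assms by (simp add: rmod_hom_def rmod_hom_axioms_def)
  let ?g = "inv_into (carrier M) f"
  have g: "?g y \<in> carrier M" "f (?g y) = y" if "y \<in> carrier N" for y
    using that assms(4) by (auto simp: bij_betw_def inv_into_into f_inv_into_f)
  have gf: "?g (f x) = x" if "x \<in> carrier M" for x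
    using that assms(4) by (simp add: bij_betw_def)
  show ?thesis
  proof (rule module_homI)
    show "?g (x \<oplus>\<^bsub>N\<^esub> y) = ?g x \<oplus>\<^bsub>M\<^esub> ?g y" if "x \<in> carrier N" "y \<in> carrier N" for x y
      using gf[of "?g x \<oplus>\<^bsub>M\<^esub> ?g y"] g that by (simp add: f.add)
    show "?g (a \<odot>\<^bsub>N\<^esub> x) = a \<odot>\<^bsub>M\<^esub> ?g x" if "a \<in> carrier L" "x \<in> carrier N" for a x
      using gf[of "a \<odot>\<^bsub>M\<^esub> ?g x"] g that by (simp add: f.smult)
  qed (use g assms in simp_all)
qed

lemma hom_compose:
  assumes "rmod L X" "f \<in> module_hom L X Y" "g \<in> module_hom L Y Z"
  shows "compose (carrier X) g f \<in> module_hom L X Z"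
  using module_hom_compose assms by (metis right_module_iff)

lemma hom_plus:
  assumes "rmod L X" "rmod L Y" "f \<in> module_hom L X Y" "g \<in> module_hom L X Y"
  shows "(\<lambda>x\<in>carrier X. f x \<oplus>\<^bsub>Y\<^esub> g x) \<in> module_hom L X Y"
proof -
  interpret Y: rmod L Y by fact
  show ?thesis
    by (rule module_homI)
      (use assms in \<open>simp_all add: hom_add[OF assms(3)] hom_add[OF assms(4)]
        hom_smult[OF assms(3)] hom_smult[OF assms(4)] hom_in[OF assms(3)] hom_in[OF assms(4)] Y.smult_r_distr Y.M.a_ac\<close>)
qed

lemma hom_minus:
  assumes "rmod L X" "rmod L Y" "f \<in> module_hom L X Y" "g \<in> module_hom L X Y"
  shows "(\<lambda>x\<in>carrier X. f x \<ominus>\<^bsub>Y\<^esub> g x) \<in> module_hom L X Y"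
proof -
  interpret Y: rmod L Y by fact
  show ?thesis
    by (rule module_homI)
      (use assms in \<open>simp_all add: hom_add[OF assms(3)] hom_add[OF assms(4)]
        hom_smult[OF assms(3)] hom_smult[OF assms(4)] hom_in[OF assms(3)] hom_in[OF assms(4)]
        Y.smult_r_distr Y.M.a_ac Y.M.minus_eq Y.M.minus_add Y.smult_neg\<close>)
qed

lemma hom_const_zero:
  assumes "rmod L X" "rmod L Y"
  shows "(\<lambda>x\<in>carrier X. \<zero>\<^bsub>Y\<^esub>) \<in> module_hom L X Y"
proof -
  interpret Y: rmod L Y by fact
  show ?thesis by (rule module_homI) (use assms in simp_all)
qed

section \<open>Direct sums of two modules\<close>

text \<open>The sum is any module whose two projections identify it with the product set. It is
  characterised rather than fixed because pairs of lists are not lists; the injections come from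
  \<open>direct_sum_pair\<close>.\<close>

definition direct_sum ::
    "('a, 'y) ring_scheme \<Rightarrow> ('a, 'a list) module \<Rightarrow> ('a, 'a list) module \<Rightarrow> ('a, 'a list) module \<Rightarrow>
     ('a list \<Rightarrow> 'a list) \<Rightarrow> ('a list \<Rightarrow> 'a list) \<Rightarrow> bool" where
  "direct_sum L M N S p q \<longleftrightarrow> S \<in> cat_obj (mod_cat L) \<and> p \<in> module_hom L S M \<and> q \<in> module_hom L S N \<and>
     bij_betw (\<lambda>z. (p z, q z)) (carrier S) (carrier M \<times> carrier N)"

text \<open>The module of pairs is an extension of \<open>N\<close> by a copy of \<open>M\<close>,
  hence finitely generated, and \<open>mod_cat_universe\<close> moves it to a carrier of
  lists.\<close>

lemma direct_sum_exists:
  fixes L :: "('a, 'y) ring_scheme"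
  assumes M: "M \<in> cat_obj (mod_cat L)" and N: "N \<in> cat_obj (mod_cat L)"
  shows "\<exists>S p q. direct_sum L M N S p q"
proof -
  interpret M: rmod L M using M by (simp add: mod_cat_obj_iff)
  interpret N: rmod L N using N by (simp add: mod_cat_obj_iff)
  define P :: "('a, 'a list \<times> 'a list) module" where
    "P = \<lparr>carrier = carrier M \<times> carrier N, mult = undefined, one = undefined, zero = (\<zero>\<^bsub>M\<^esub>, \<zero>\<^bsub>N\<^esub>),
      add = (\<lambda>x y. (fst x \<oplus>\<^bsub>M\<^esub> fst y, snd x \<oplus>\<^bsub>N\<^esub> snd y)), smult = (\<lambda>a x. (a \<odot>\<^bsub>M\<^esub> fst x, a \<odot>\<^bsub>N\<^esub> snd x))\<rparr>"
  have P [simp]: "carrier P = carrier M \<times> carrier N" "zero P = (\<zero>\<^bsub>M\<^esub>, \<zero>\<^bsub>N\<^esub>)"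
    "\<And>x y. x \<oplus>\<^bsub>P\<^esub> y = (fst x \<oplus>\<^bsub>M\<^esub> fst y, snd x \<oplus>\<^bsub>N\<^esub> snd y)"
    "\<And>a x. a \<odot>\<^bsub>P\<^esub> x = (a \<odot>\<^bsub>M\<^esub> fst x, a \<odot>\<^bsub>N\<^esub> snd x)"
    by (simp_all add: P_def)
  have "abelian_group P"
  proof (rule abelian_groupI)
    show "\<exists>y\<in>carrier P. y \<oplus>\<^bsub>P\<^esub> x = \<zero>\<^bsub>P\<^esub>" if "x \<in> carrier P" for x
      using that by (intro bexI[of _ "(\<ominus>\<^bsub>M\<^esub> fst x, \<ominus>\<^bsub>N\<^esub> snd x)"]) (auto simp: M.M.l_neg N.M.l_neg)
  qed (auto simp: M.M.a_ac N.M.a_ac)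
  then have rP: "rmod L P"
    unfolding rmod_def rmod_axioms_def using M.L.ring_axioms
    by (auto simp: M.smult_l_distr M.smult_r_distr M.smult_assoc N.smult_l_distr N.smult_r_distr N.smult_assoc)
  interpret P: rmod L P by (rule rP)
  have inc: "(\<lambda>x\<in>carrier M. (x, \<zero>\<^bsub>N\<^esub>)) \<in> module_hom L M P"
    by (rule module_homI) (use M.rmod_axioms in simp_all)
  interpret inc: rmod_hom L M P "\<lambda>x\<in>carrier M. (x, \<zero>\<^bsub>N\<^esub>)"
    using inc rP M.rmod_axioms by (simp add: rmod_hom_def rmod_hom_axioms_def)
  have fst_hom: "restrict fst (carrier P) \<in> module_hom L P M" and snd_hom: "restrict snd (carrier P) \<in> module_hom L P N"
    by (rule module_homI; use rP in auto)+
  have fgP: "fg_submod L P (carrier P)"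
  proof (rule fg_submod_extension[where \<rho> = "\<lambda>z r. r = snd z" and J = "carrier N", OF rP N.rmod_axioms P.submod_carrier])
    show "fg_submod L N (carrier N)" using N by (simp add: mod_cat_obj_iff)
    have "{z \<in> carrier P. \<zero>\<^bsub>N\<^esub> = snd z} = (\<lambda>x\<in>carrier M. (x, \<zero>\<^bsub>N\<^esub>)) ` carrier M" by (auto simp: image_iff)
    then show "fg_submod L P {z \<in> carrier P. \<zero>\<^bsub>N\<^esub> = snd z}"
      using inc.fg_image[of "carrier M"] M by (simp add: mod_cat_obj_iff)
  qed auto
  then obtain S j where S: "S \<in> cat_obj (mod_cat L)" and j: "j \<in> module_hom L P S" "bij_betw j (carrier P) (carrier S)"
    using mod_cat_universe[of L P] rP P.finitely_generated_module_iff by (auto simp: right_module_iff)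
  interpret S: rmod L S using S by (simp add: mod_cat_obj_iff)
  let ?k = "restrict (inv_into (carrier P) j) (carrier S)"
  have k: "?k \<in> module_hom L S P" using hom_inverse[OF rP S.rmod_axioms j] .
  have kbij: "bij_betw ?k (carrier S) (carrier M \<times> carrier N)"
    using bij_betw_inv_into[OF j(2)] by simp
  have kin: "?k z \<in> carrier P" if "z \<in> carrier S" for z using that k by (rule hom_in[rotated])
  show ?thesis
    unfolding direct_sum_def
  proof (intro exI conjI)
    show "compose (carrier S) (restrict fst (carrier P)) ?k \<in> module_hom L S M"
      "compose (carrier S) (restrict snd (carrier P)) ?k \<in> module_hom L S N"
      using hom_compose[OF S.rmod_axioms k] fst_hom snd_hom by blast+
    have "(compose (carrier S) (restrict fst (carrier P)) ?k z, compose (carrier S) (restrict snd (carrier P)) ?k z) = ?k z"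
      if "z \<in> carrier S" for z
      using that kin[OF that] by simp
    then show "bij_betw (\<lambda>z. (compose (carrier S) (restrict fst (carrier P)) ?k z,
        compose (carrier S) (restrict snd (carrier P)) ?k z)) (carrier S) (carrier M \<times> carrier N)"
      using kbij by (subst bij_betw_cong[of _ _ ?k])
  qed (rule S)
qed

lemma direct_sum_ext:
  assumes "direct_sum L M N S p q" "z \<in> carrier S" "z' \<in> carrier S" "p z = p z'" "q z = q z'"
  shows "z = z'"
  using assms unfolding direct_sum_def bij_betw_def inj_on_def by simp

text \<open>The value of \<open>h\<close> at \<open>x\<close> is chosen with the prescribed
  components; linearity is checked after both projections, which are jointly injective.\<close>

lemma direct_sum_pair:
  assumes S: "direct_sum L M N S p q" and X: "rmod L X" and f: "f \<in> module_hom L X M" and g: "g \<in> module_hom L X N"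
  shows "\<exists>h\<in>module_hom L X S. \<forall>x\<in>carrier X. p (h x) = f x \<and> q (h x) = g x"
proof -
  have *: "S \<in> cat_obj (mod_cat L)" "p \<in> module_hom L S M" "q \<in> module_hom L S N"
    "bij_betw (\<lambda>z. (p z, q z)) (carrier S) (carrier M \<times> carrier N)"
    using S by (simp_all add: direct_sum_def)
  interpret S: rmod L S using * by (simp add: mod_cat_obj_iff)
  interpret X: rmod L X by fact
  have "\<forall>x\<in>carrier X. \<exists>z\<in>carrier S. p z = f x \<and> q z = g x"
  proof
    fix x assume "x \<in> carrier X"
    then have "(f x, g x) \<in> carrier M \<times> carrier N" using f g by (simp add: hom_in)
    then show "\<exists>z\<in>carrier S. p z = f x \<and> q z = g x"
      using *(4) unfolding bij_betw_def by (auto simp: image_iff set_eq_iff) (metis prod.inject)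
  qed
  then obtain h where h: "\<And>x. x \<in> carrier X \<Longrightarrow> h x \<in> carrier S" "\<And>x. x \<in> carrier X \<Longrightarrow> p (h x) = f x"
    "\<And>x. x \<in> carrier X \<Longrightarrow> q (h x) = g x" by metis
  have "restrict h (carrier X) \<in> module_hom L X S"
    by (rule module_homI; (rule direct_sum_ext[OF S])?)
      (use h f g *(2,3) in \<open>simp_all add: hom_add[OF f] hom_add[OF g] hom_add[OF *(2)] hom_add[OF *(3)]
        hom_smult[OF f] hom_smult[OF g] hom_smult[OF *(2)] hom_smult[OF *(3)] X.rmod_axioms\<close>)
  then show ?thesis using h by (intro bexI[of _ "restrict h (carrier X)"]) simp_all
qed

lemma direct_sum_copair:
  assumes S: "direct_sum L M N S p q" and "rmod L X" "f \<in> module_hom L M X" "g \<in> module_hom L N X"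
  shows "(\<lambda>z\<in>carrier S. f (p z) \<oplus>\<^bsub>X\<^esub> g (q z)) \<in> module_hom L S X"
proof -
  have *: "rmod L S" "p \<in> module_hom L S M" "q \<in> module_hom L S N"
    using S by (simp_all add: direct_sum_def mod_cat_obj_iff)
  have "(\<lambda>z\<in>carrier S. f (p z) \<oplus>\<^bsub>X\<^esub> g (q z)) =
      (\<lambda>z\<in>carrier S. compose (carrier S) f p z \<oplus>\<^bsub>X\<^esub> compose (carrier S) g q z)"
    by (intro restrict_ext) simp
  then show ?thesis
    using hom_plus[OF *(1) assms(2) hom_compose[OF *(1,2) assms(3)] hom_compose[OF *(1,3) assms(4)]] by simp
qed

text \<open>Lifting against \<open>g\<close> only needs the image of \<open>f\<close> in that of \<open>g\<close>, since \<open>g\<close> is onto its image.\<close>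

lemma projective_lift:
  assumes P: "projective_module L P" and M: "M \<in> cat_obj (mod_cat L)" and N: "N \<in> cat_obj (mod_cat L)"
    and g: "g \<in> module_hom L M N" and f: "f \<in> module_hom L P N" and sub: "f ` carrier P \<subseteq> g ` carrier M"
  shows "\<exists>h\<in>module_hom L P M. \<forall>x\<in>carrier P. g (h x) = f x"
proof -
  interpret g: rmod_hom L M N g using rmod_homI[OF M N g] .
  let ?N = "N\<lparr>carrier := g ` carrier M\<rparr>"
  have N': "?N \<in> cat_obj (mod_cat L)"
    using N M g.submod_image[OF g.M.submod_carrier] g.fg_image[of "carrier M"]
    by (intro submod_in_mod_cat) (simp_all add: mod_cat_obj_iff)
  have g': "g \<in> module_hom L M ?N" and f': "f \<in> module_hom L P ?N"
    using hom_into_submodule g f sub by blast+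
  have "g ` carrier M = carrier ?N" by simp
  then obtain h where "h \<in> module_hom L P M" "compose (carrier P) g h = f"
    using P[unfolded projective_module_def, THEN conjunct2, rule_format, OF M N' g' f'] by blast
  then show ?thesis by (intro bexI[of _ h]) auto
qed

text \<open>A map out of the sum is lifted on each summand and the lifts are added, since every
  element is the sum of its two components.\<close>

lemma direct_sum_projective:
  assumes S: "direct_sum L M N S p q" and M: "projective_module L M" and N: "projective_module L N"
  shows "projective_module L S"
  unfolding projective_module_def
proof (intro conjI ballI impI)
  show Sob: "S \<in> cat_obj (mod_cat L)" using S by (simp add: direct_sum_def)
  fix A B g f assume AB: "A \<in> cat_obj (mod_cat L)" "B \<in> cat_obj (mod_cat L)"
    and g: "g \<in> module_hom L A B" and f: "f \<in> module_hom L S B" and surj: "g ` carrier A = carrier B"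
  have Mob: "M \<in> cat_obj (mod_cat L)" and Nob: "N \<in> cat_obj (mod_cat L)"
    using M N by (simp_all add: projective_module_def)
  then have rM: "rmod L M" "rmod L N" "rmod L S" "rmod L A" "rmod L B" using Sob AB by (simp_all add: mod_cat_obj_iff)
  have pq: "p \<in> module_hom L S M" "q \<in> module_hom L S N" using S by (simp_all add: direct_sum_def)
  obtain i where i: "i \<in> module_hom L M S" "\<And>x. x \<in> carrier M \<Longrightarrow> p (i x) = x" "\<And>x. x \<in> carrier M \<Longrightarrow> q (i x) = \<zero>\<^bsub>N\<^esub>"
    using direct_sum_pair[OF S rM(1) module_hom_id hom_const_zero[OF rM(1,2)]] rM by (auto simp: right_module_iff)
  obtain j where j: "j \<in> module_hom L N S" "\<And>x. x \<in> carrier N \<Longrightarrow> q (j x) = x" "\<And>x. x \<in> carrier N \<Longrightarrow> p (j x) = \<zero>\<^bsub>M\<^esub>"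
    using direct_sum_pair[OF S rM(2) hom_const_zero[OF rM(2,1)] module_hom_id] rM by (auto simp: right_module_iff)
  have "compose (carrier M) f i \<in> module_hom L M B" "compose (carrier N) f j \<in> module_hom L N B"
    using hom_compose rM i j f by blast+
  then have hk: "\<exists>h\<in>module_hom L M A. compose (carrier M) g h = compose (carrier M) f i"
    "\<exists>k\<in>module_hom L N A. compose (carrier N) g k = compose (carrier N) f j"
    using M N AB g surj unfolding projective_module_def by simp_all
  obtain h where h: "h \<in> module_hom L M A" "\<And>x. x \<in> carrier M \<Longrightarrow> g (h x) = f (i x)"
    using hk(1) unfolding compose_eq_iff by blast
  obtain k where k: "k \<in> module_hom L N A" "\<And>x. x \<in> carrier N \<Longrightarrow> g (k x) = f (j x)"
    using hk(2) unfolding compose_eq_iff by blast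
  let ?h = "\<lambda>z\<in>carrier S. h (p z) \<oplus>\<^bsub>A\<^esub> k (q z)"
  interpret M: rmod L M by fact
  interpret N: rmod L N by fact
  interpret S: rmod L S by fact
  have split: "i (p z) \<oplus>\<^bsub>S\<^esub> j (q z) = z" if z: "z \<in> carrier S" for z
  proof (rule direct_sum_ext[OF S])
  qed (use z i(2,3) j(2,3) in \<open>simp_all add: hom_add[OF pq(1)] hom_add[OF pq(2)] hom_in[OF pq(1)] hom_in[OF pq(2)]
      hom_in[OF i(1)] hom_in[OF j(1)]\<close>)
  show "\<exists>h\<in>module_hom L S A. compose (carrier S) g h = f"
  proof (intro bexI)
    show "?h \<in> module_hom L S A" using direct_sum_copair[OF S rM(4) h(1) k(1)] .
    have "g (h (p z) \<oplus>\<^bsub>A\<^esub> k (q z)) = f z" if z: "z \<in> carrier S" for z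
    proof -
      have "g (h (p z) \<oplus>\<^bsub>A\<^esub> k (q z)) = f (i (p z) \<oplus>\<^bsub>S\<^esub> j (q z))"
        using z h k by (simp add: hom_add[OF g] hom_add[OF f] hom_in[OF pq(1)] hom_in[OF pq(2)] hom_in[OF i(1)] hom_in[OF j(1)] hom_in[OF h(1)] hom_in[OF k(1)])
      then show ?thesis using split z by simp
    qed
    then show "compose (carrier S) g ?h = f" unfolding compose_eq_hom_iff[OF f] by simp
  qed
qed

section \<open>Enough projectives\<close>

text \<open>The free module of rank one, moved to lists, with \<open>u\<close> the image of 1. Every
  element is a multiple of \<open>u\<close>, and the value of a map at \<open>u\<close> is
  arbitrary, so lifting a map means lifting one value.\<close>

lemma regular_projective:
  fixes L :: "('a, 'y) ring_scheme"
  assumes "ring L"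
  shows "\<exists>Q u. projective_module L Q \<and> u \<in> carrier Q \<and>
    (\<forall>M\<in>cat_obj (mod_cat L). \<forall>m\<in>carrier M. \<exists>h\<in>module_hom L Q M. h u = m)"
proof -
  interpret L: ring L by fact
  interpret R: rmod L "regular_module L" by (rule rmod_regular) fact
  have "carrier (regular_module L) \<subseteq> span L (regular_module L) {\<one>\<^bsub>L\<^esub>}"
  proof
    fix a assume "a \<in> carrier (regular_module L)"
    then show "a \<in> span L (regular_module L) {\<one>\<^bsub>L\<^esub>}"
      using span.step[of "\<one>\<^bsub>L\<^esub>" "{\<one>\<^bsub>L\<^esub>}" a L "\<zero>\<^bsub>L\<^esub>" "regular_module L"] span.zero[of "regular_module L" L "{\<one>\<^bsub>L\<^esub>}"]
      by simp
  qed
  then have "fg_submod L (regular_module L) (carrier (regular_module L))"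
    by (intro R.fg_submodI[OF R.submod_carrier, of "{\<one>\<^bsub>L\<^esub>}"]) simp_all
  then obtain Q j where Q: "Q \<in> cat_obj (mod_cat L)" and j: "j \<in> module_hom L (regular_module L) Q"
    "bij_betw j (carrier (regular_module L)) (carrier Q)"
    using mod_cat_universe[of L "regular_module L"] R.rmod_axioms R.finitely_generated_module_iff
    by (auto simp: right_module_iff)
  interpret Q: rmod L Q using Q by (simp add: mod_cat_obj_iff)
  define u where "u = j \<one>\<^bsub>L\<^esub>"
  have u: "u \<in> carrier Q" using hom_in[OF j(1)] by (simp add: u_def)
  have ju: "j a = a \<odot>\<^bsub>Q\<^esub> u" if "a \<in> carrier L" for a
    using hom_smult[OF j(1), of a "\<one>\<^bsub>L\<^esub>"] that by (simp add: u_def)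
  have gen: "\<exists>a\<in>carrier L. x = a \<odot>\<^bsub>Q\<^esub> u" if "x \<in> carrier Q" for x
    using j(2) ju that unfolding bij_betw_def by auto
  have free: "\<exists>h\<in>module_hom L Q M. h u = m" if M: "M \<in> cat_obj (mod_cat L)" and m: "m \<in> carrier M" for M m
  proof -
    interpret M: rmod L M using M by (simp add: mod_cat_obj_iff)
    have "(\<lambda>a\<in>carrier (regular_module L). a \<odot>\<^bsub>M\<^esub> m) \<in> module_hom L (regular_module L) M"
      by (rule module_homI) (use m R.rmod_axioms in \<open>simp_all add: M.smult_l_distr M.smult_assoc\<close>)
    then have "compose (carrier Q) (\<lambda>a\<in>carrier (regular_module L). a \<odot>\<^bsub>M\<^esub> m)
        (restrict (inv_into (carrier (regular_module L)) j) (carrier Q)) \<in> module_hom L Q M"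
      using hom_compose[OF Q.rmod_axioms hom_inverse[OF R.rmod_axioms Q.rmod_axioms j]] by blast
    moreover have "inv_into (carrier L) j u = \<one>\<^bsub>L\<^esub>"
      using j(2) unfolding u_def bij_betw_def by simp
    ultimately show ?thesis using u m by (intro bexI) auto
  qed
  have "projective_module L Q"
    unfolding projective_module_def
  proof (intro conjI ballI impI Q)
    fix M N g f assume MN: "M \<in> cat_obj (mod_cat L)" "N \<in> cat_obj (mod_cat L)"
      and g: "g \<in> module_hom L M N" and f: "f \<in> module_hom L Q N" and surj: "g ` carrier M = carrier N"
    have "f u \<in> g ` carrier M" using hom_in[OF f u] surj by simp
    then obtain m where m: "m \<in> carrier M" "f u = g m" by blast
    obtain h where h: "h \<in> module_hom L Q M" "h u = m" using free[OF MN(1) m(1)] by blast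
    have "g (h x) = f x" if "x \<in> carrier Q" for x
      using gen[OF that] u m h by (auto simp: hom_smult[OF h(1)] hom_smult[OF f] hom_smult[OF g])
    then show "\<exists>h\<in>module_hom L Q M. compose (carrier Q) g h = f"
      using h(1) compose_eq_hom_iff[OF f] by blast
  qed
  then show ?thesis using u free by blast
qed

text \<open>One copy of the free module of rank one is added for each generator. No minimality is
  claimed in spite of the name: the result is a surjection from a projective.\<close>

lemma projective_cover_exists:
  assumes M: "M \<in> cat_obj (mod_cat L)"
  shows "\<exists>Q e. projective_module L Q \<and> e \<in> module_hom L Q M \<and> e ` carrier Q = carrier M"
proof -
  interpret M: rmod L M using M by (simp add: mod_cat_obj_iff)
  obtain F u where F: "projective_module L F" "u \<in> carrier F"
    and free: "\<And>m. m \<in> carrier M \<Longrightarrow> \<exists>h\<in>module_hom L F M. h u = m"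
    using regular_projective[OF M.L.ring_axioms] M by blast
  have Fob: "F \<in> cat_obj (mod_cat L)" using F by (simp add: projective_module_def)
  obtain S where S: "finite S" "S \<subseteq> carrier M" "carrier M = span L M S"
    using M unfolding mod_cat_obj_iff fg_submod_def by blast
  from S(1,2) have "\<exists>Q e. projective_module L Q \<and> e \<in> module_hom L Q M \<and> S \<subseteq> e ` carrier Q"
  proof (induction S rule: finite_induct)
    case empty
    \<comment> \<open>Without generators any map from a projective will do; the one that sends
      \<open>u\<close> to zero is at hand.\<close>
    then show ?case using F(1) free[OF M.M.zero_closed] by blast
  next
    case (insert s S)
    then obtain Q e where Q: "projective_module L Q" "e \<in> module_hom L Q M" "S \<subseteq> e ` carrier Q" by blast
    have Qob: "Q \<in> cat_obj (mod_cat L)" using Q by (simp add: projective_module_def)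
    interpret Q: rmod_hom L Q M e using rmod_homI[OF Qob M Q(2)] .
    obtain h where h: "h \<in> module_hom L F M" "h u = s" using free insert.prems by auto
    interpret h: rmod_hom L F M h using rmod_homI[OF Fob M h(1)] .
    obtain T p q where T: "direct_sum L Q F T p q" using direct_sum_exists[OF Qob Fob] by blast
    let ?e = "\<lambda>z\<in>carrier T. e (p z) \<oplus>\<^bsub>M\<^esub> h (q z)"
    have "\<exists>z\<in>carrier T. p z = x \<and> q z = y" if "x \<in> carrier Q" "y \<in> carrier F" for x y
    proof -
      have "(x, y) \<in> (\<lambda>z. (p z, q z)) ` carrier T" using T that by (simp add: direct_sum_def bij_betw_def)
      then show ?thesis by auto
    qed
    then have mem: "e x \<oplus>\<^bsub>M\<^esub> h y \<in> ?e ` carrier T" if "x \<in> carrier Q" "y \<in> carrier F" for x y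
      using that by (auto simp: image_iff)
    \<comment> \<open>The pair \<open>(0, u)\<close> reaches the new generator, and pairs
      \<open>(x, 0)\<close> keep the old image.\<close>
    have "t \<in> ?e ` carrier T" if t: "t \<in> insert s S" for t
    proof (cases "t = s")
      case True
      then show ?thesis using mem[of "\<zero>\<^bsub>Q\<^esub>" u] F(2) h insert.prems by simp
    next
      case False
      then obtain x where "x \<in> carrier Q" "t = e x" using Q(3) t by blast
      then show ?thesis using mem[of x "\<zero>\<^bsub>F\<^esub>"] by simp
    qed
    then show ?case
      using direct_sum_projective[OF T Q(1) F(1)] direct_sum_copair[OF T M.rmod_axioms Q(2) h(1)] by blast
  qed
  then obtain Q e where Q: "projective_module L Q" "e \<in> module_hom L Q M" "S \<subseteq> e ` carrier Q" by blast
  interpret Q: rmod_hom L Q M e using Q by (intro rmod_homI M) (simp_all add: projective_module_def)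
  have "e ` carrier Q = carrier M"
    using span_subset_submod[OF Q.submod_image[OF Q.M.submod_carrier] Q(3)] S(3) by auto
  then show ?thesis using Q by blast
qed

section \<open>Injective objects of the category of maps between projectives\<close>

lemma projective_obj: "projective_module L P \<Longrightarrow> P \<in> cat_obj (mod_cat L)"
  by (simp add: projective_module_def)

lemma projective_rmod: "projective_module L P \<Longrightarrow> rmod L P"
  by (simp add: projective_module_def mod_cat_obj_iff)

lemma proj_cat_obj_iff:
  "(P, Q, f) \<in> cat_obj (proj_cat L) \<longleftrightarrow> projective_module L P \<and> projective_module L Q \<and> f \<in> module_hom L P Q"
  by (auto simp: proj_cat_def full_exact_subcategory_def morphism_cat_def projective_obj)

lemma proj_cat_hom_iff:
  "\<sigma> \<in> cat_hom (proj_cat L) (P, Q, f) (P', Q', f') \<longleftrightarrow>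
     fst \<sigma> \<in> module_hom L P P' \<and> snd \<sigma> \<in> module_hom L Q Q' \<and> (\<forall>x\<in>carrier P. snd \<sigma> (f x) = f' (fst \<sigma> x))"
  by (auto simp: proj_cat_def full_exact_subcategory_def morphism_cat_def compose_eq_iff split: prod.splits)

lemma proj_cat_comp:
  "cat_comp (proj_cat L) (P, Q, f) Y Z \<tau> \<sigma> =
     (compose (carrier P) (fst \<tau>) (fst \<sigma>), compose (carrier Q) (snd \<tau>) (snd \<sigma>))"
  by (auto simp: proj_cat_def full_exact_subcategory_def morphism_cat_def split: prod.splits)

lemma proj_cat_id: "cat_id (proj_cat L) (P, Q, f) = (restrict id (carrier P), restrict id (carrier Q))"
  by (auto simp: proj_cat_def full_exact_subcategory_def morphism_cat_def)

lemma short_exactD: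
  assumes "short_exact L A i B p C"
  shows "A \<in> cat_obj (mod_cat L)" "B \<in> cat_obj (mod_cat L)" "C \<in> cat_obj (mod_cat L)"
    "i \<in> module_hom L A B" "p \<in> module_hom L B C" "inj_on i (carrier A)"
    "i ` carrier A = {b \<in> carrier B. p b = \<zero>\<^bsub>C\<^esub>}" "p ` carrier B = carrier C"
  using assms unfolding short_exact_def by blast+

lemma proj_cat_conflation_iff:
  "conflation (proj_cat L) X i Y p Z \<longleftrightarrow>
     X \<in> cat_obj (proj_cat L) \<and> Y \<in> cat_obj (proj_cat L) \<and> Z \<in> cat_obj (proj_cat L) \<and>
     i \<in> cat_hom (proj_cat L) X Y \<and> p \<in> cat_hom (proj_cat L) Y Z \<and>
     short_exact L (fst X) (fst i) (fst Y) (fst p) (fst Z) \<and>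
     short_exact L (fst (snd X)) (snd i) (fst (snd Y)) (snd p) (fst (snd Z))"
  by (cases X; cases Y; cases Z; cases i; cases p)
    (auto simp: proj_cat_obj_iff proj_cat_hom_iff proj_cat_def full_exact_subcategory_def morphism_cat_def compose_eq_iff
      dest: short_exactD)

text \<open>Images are carried along by the bijections. Linearity of \<open>w\<close> makes zero
  correspond to zero, and thereby the kernel of \<open>p\<close> to that of
  \<open>p'\<close>.\<close>

lemma short_exact_iso:
  assumes se: "short_exact L A i B p C"
    and ob: "A' \<in> cat_obj (mod_cat L)" "B' \<in> cat_obj (mod_cat L)" "C' \<in> cat_obj (mod_cat L)"
    and i': "i' \<in> module_hom L A' B'" and p': "p' \<in> module_hom L B' C'"
    and u: "bij_betw u (carrier A) (carrier A')" and v: "bij_betw v (carrier B) (carrier B')"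
    and w: "w \<in> module_hom L C C'" "bij_betw w (carrier C) (carrier C')"
    and vi: "\<And>x. x \<in> carrier A \<Longrightarrow> v (i x) = i' (u x)" and wp: "\<And>x. x \<in> carrier B \<Longrightarrow> w (p x) = p' (v x)"
  shows "short_exact L A' i' B' p' C'"
proof -
  note D = short_exactD[OF se]
  interpret w: rmod_hom L C C' w using rmod_homI[OF D(3) ob(3) w(1)] .
  have A': "carrier A' = u ` carrier A" and B': "carrier B' = v ` carrier B" and C': "carrier C' = w ` carrier C"
    using u v w(2) by (simp_all add: bij_betw_def)
  have w0: "w (p x) = \<zero>\<^bsub>C'\<^esub> \<longleftrightarrow> p x = \<zero>\<^bsub>C\<^esub>" if "x \<in> carrier B" for x
    using w(2) hom_in[OF D(5) that] w.zero w.M.M.zero_closed unfolding bij_betw_def inj_on_def by metis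
  have "inj_on i' (carrier A')"
  proof (rule inj_onI)
    fix x y assume "x \<in> carrier A'" "y \<in> carrier A'" and eq: "i' x = i' y"
    then obtain a b where ab: "a \<in> carrier A" "b \<in> carrier A" "x = u a" "y = u b" unfolding A' by blast
    then have "v (i a) = v (i b)" using eq vi by simp
    then have "i a = i b" using v ab hom_in[OF D(4)] unfolding bij_betw_def inj_on_def by blast
    then show "x = y" using D(6) ab unfolding inj_on_def by blast
  qed
  moreover have "i' ` carrier A' = {b \<in> carrier B'. p' b = \<zero>\<^bsub>C'\<^esub>}"
  proof -
    have "i' ` carrier A' = v ` (i ` carrier A)" unfolding A' image_image using vi by (intro image_cong) auto
    also have "\<dots> = {b \<in> carrier B'. p' b = \<zero>\<^bsub>C'\<^esub>}"
      unfolding D(7) B' using w0 wp by auto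
    finally show ?thesis .
  qed
  moreover have "p' ` carrier B' = carrier C'"
  proof -
    have "p' ` carrier B' = w ` (p ` carrier B)" unfolding B' image_image using wp by (intro image_cong) auto
    then show ?thesis unfolding D(8) C' .
  qed
  ultimately show ?thesis unfolding short_exact_def using ob i' p' by blast
qed

lemma restrict_id_apply: "compose A g f = restrict id A \<longleftrightarrow> (\<forall>x\<in>A. g (f x) = x)"
  by (auto simp: compose_def restrict_def fun_eq_iff)

lemma proj_cat_iso_bij:
  assumes "cat_iso (proj_cat L) (P, Q, f) (P', Q', f') u"
  shows "bij_betw (fst u) (carrier P) (carrier P')" "bij_betw (snd u) (carrier Q) (carrier Q')"
proof -
  obtain v where u: "fst u \<in> module_hom L P P'" "snd u \<in> module_hom L Q Q'"
    and v: "fst v \<in> module_hom L P' P" "snd v \<in> module_hom L Q' Q"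
    and vu: "\<And>x. x \<in> carrier P \<Longrightarrow> fst v (fst u x) = x" "\<And>x. x \<in> carrier Q \<Longrightarrow> snd v (snd u x) = x"
    and uv: "\<And>x. x \<in> carrier P' \<Longrightarrow> fst u (fst v x) = x" "\<And>x. x \<in> carrier Q' \<Longrightarrow> snd u (snd v x) = x"
    using assms unfolding cat_iso_def Bex_def proj_cat_hom_iff proj_cat_comp proj_cat_id prod.inject restrict_id_apply
    Ball_def by blast
  show "bij_betw (fst u) (carrier P) (carrier P')"
    by (rule bij_betw_byWitness[where f' = "fst v"]) (use vu uv hom_in[OF u(1)] hom_in[OF v(1)] in auto)
  show "bij_betw (snd u) (carrier Q) (carrier Q')"
    by (rule bij_betw_byWitness[where f' = "snd v"]) (use vu uv hom_in[OF u(2)] hom_in[OF v(2)] in auto)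
qed

text \<open>Isomorphisms are bijective in both components, so closure of the conflations under
  isomorphism reduces to \<open>short_exact_iso\<close> in each component.\<close>

lemma conflation_cat_proj_cat: "conflation_cat (proj_cat L)"
proof (unfold_locales, rule is_category_proj_cat)
  show "X \<in> cat_obj (proj_cat L) \<and> Y \<in> cat_obj (proj_cat L) \<and> Z \<in> cat_obj (proj_cat L) \<and>
      i \<in> cat_hom (proj_cat L) X Y \<and> p \<in> cat_hom (proj_cat L) Y Z"
    if "conflation (proj_cat L) X i Y p Z" for X Y Z i p
    using that by (simp add: proj_cat_conflation_iff)
next
  fix X i Y p Z X' Y' Z' u v w i' p'
  assume conf: "conflation (proj_cat L) X i Y p Z"
    and ob: "X' \<in> cat_obj (proj_cat L)" "Y' \<in> cat_obj (proj_cat L)" "Z' \<in> cat_obj (proj_cat L)"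
    and iso: "cat_iso (proj_cat L) X X' u" "cat_iso (proj_cat L) Y Y' v" "cat_iso (proj_cat L) Z Z' w"
    and h: "i' \<in> cat_hom (proj_cat L) X' Y'" "p' \<in> cat_hom (proj_cat L) Y' Z'"
    and eq: "cat_comp (proj_cat L) X Y Y' v i = cat_comp (proj_cat L) X X' Y' i' u"
      "cat_comp (proj_cat L) Y Z Z' w p = cat_comp (proj_cat L) Y Y' Z' p' v"
  obtain X1 X2 f Y1 Y2 g Z1 Z2 k where X: "X = (X1, X2, f)" and Y: "Y = (Y1, Y2, g)" and Z: "Z = (Z1, Z2, k)"
    by (cases X; cases Y; cases Z)
  obtain X1' X2' f' Y1' Y2' g' Z1' Z2' k' where X': "X' = (X1', X2', f')" and Y': "Y' = (Y1', Y2', g')" and Z': "Z' = (Z1', Z2', k')"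
    by (cases X'; cases Y'; cases Z')
  have se: "short_exact L X1 (fst i) Y1 (fst p) Z1" "short_exact L X2 (snd i) Y2 (snd p) Z2"
    using conf by (simp_all add: proj_cat_conflation_iff X Y Z)
  have w: "fst w \<in> module_hom L Z1 Z1'" "snd w \<in> module_hom L Z2 Z2'"
    using iso(3) by (simp_all add: cat_iso_def Z Z' proj_cat_hom_iff)
  have ob': "X1' \<in> cat_obj (mod_cat L)" "X2' \<in> cat_obj (mod_cat L)" "Y1' \<in> cat_obj (mod_cat L)" "Y2' \<in> cat_obj (mod_cat L)"
    "Z1' \<in> cat_obj (mod_cat L)" "Z2' \<in> cat_obj (mod_cat L)"
    using ob by (simp_all add: X' Y' Z' proj_cat_obj_iff projective_obj)
  have h': "fst i' \<in> module_hom L X1' Y1'" "snd i' \<in> module_hom L X2' Y2'" "fst p' \<in> module_hom L Y1' Z1'" "snd p' \<in> module_hom L Y2' Z2'"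
    using h by (simp_all add: X' Y' Z' proj_cat_hom_iff)
  note bij = proj_cat_iso_bij[OF iso(1)[unfolded X X']] proj_cat_iso_bij[OF iso(2)[unfolded Y Y']]
    proj_cat_iso_bij[OF iso(3)[unfolded Z Z']]
  note eq' = eq[unfolded X Y Z X' Y' Z' proj_cat_comp prod.inject compose_eq_iff]
  have "short_exact L X1' (fst i') Y1' (fst p') Z1'"
    by (rule short_exact_iso[OF se(1) ob'(1,3,5) h'(1,3) bij(1,3) w(1) bij(5)]) (use eq' in blast)+
  moreover have "short_exact L X2' (snd i') Y2' (snd p') Z2'"
    by (rule short_exact_iso[OF se(2) ob'(2,4,6) h'(2,4) bij(2,4) w(2) bij(6)]) (use eq' in blast)+
  ultimately show "conflation (proj_cat L) X' i' Y' p' Z'"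
    unfolding proj_cat_conflation_iff using ob h by (simp add: X' Y' Z')
qed

text \<open>Projectivity of \<open>C\<close> gives the section \<open>s\<close>. The map
  \<open>b - s (p b)\<close> has values in the kernel of \<open>p\<close>, which is the image of
  \<open>i\<close>; lifting it along \<open>i\<close> by projectivity of \<open>B\<close> yields a
  linear retraction.\<close>

lemma short_exact_split:
  assumes se: "short_exact L A i B p C" and B: "projective_module L B" and C: "projective_module L C"
  shows "\<exists>s\<in>module_hom L C B. \<exists>r\<in>module_hom L B A.
     (\<forall>c\<in>carrier C. p (s c) = c) \<and> (\<forall>a\<in>carrier A. r (i a) = a) \<and> (\<forall>b\<in>carrier B. i (r b) = b \<ominus>\<^bsub>B\<^esub> s (p b))"
proof -
  note D = short_exactD[OF se]
  interpret i: rmod_hom L A B i using rmod_homI[OF D(1,2,4)] .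
  interpret p: rmod_hom L B C p using rmod_homI[OF D(2,3,5)] .
  have "restrict id (carrier C) \<in> module_hom L C C" using module_hom_id p.N.rmod_axioms right_module_iff by metis
  then obtain s where s: "s \<in> module_hom L C B" "\<And>c. c \<in> carrier C \<Longrightarrow> p (s c) = c"
    using projective_lift[OF C D(2,3,5), of "restrict id (carrier C)"] D(8) by auto
  interpret s: rmod_hom L C B s using rmod_homI[OF D(3,2) s(1)] .
  let ?d = "\<lambda>b\<in>carrier B. restrict id (carrier B) b \<ominus>\<^bsub>B\<^esub> compose (carrier B) s p b"
  have id: "restrict id (carrier B) \<in> module_hom L B B" using module_hom_id i.N.rmod_axioms right_module_iff by metis
  have d: "?d \<in> module_hom L B B"
    using hom_minus[OF i.N.rmod_axioms i.N.rmod_axioms id hom_compose[OF i.N.rmod_axioms D(5) s(1)]] .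
  have "p (b \<ominus>\<^bsub>B\<^esub> s (p b)) = \<zero>\<^bsub>C\<^esub>" if "b \<in> carrier B" for b
    using that s by (simp add: p.minus p.N.minus_eq_zero_iff)
  then have "?d ` carrier B \<subseteq> i ` carrier A" unfolding D(7) by auto
  then obtain r where r: "r \<in> module_hom L B A" "\<forall>b\<in>carrier B. i (r b) = ?d b"
    using projective_lift[OF B D(1,2,4) d] by blast
  have ir: "i (r b) = b \<ominus>\<^bsub>B\<^esub> s (p b)" if "b \<in> carrier B" for b using r(2) that by simp
  have "r (i a) = a" if a: "a \<in> carrier A" for a
  proof -
    have "p (i a) = \<zero>\<^bsub>C\<^esub>" using D(7) a by auto
    then have "i (r (i a)) = i a" using ir a by (simp add: i.N.M.minus_eq)
    then show ?thesis using D(6) a hom_in[OF r(1)] by (simp add: inj_on_def)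
  qed
  then show ?thesis using s r(1) ir by blast
qed

text \<open>Both components split, but the retractions \<open>\<rho>\<close> and \<open>r\<close>
  need not commute with \<open>h\<close> and \<open>f\<close>. The defect vanishes on the image of
  \<open>P\<close>, so it factors through \<open>C1\<close>; there it lifts along the surjection
  \<open>f\<close>, and the lift is subtracted from \<open>\<rho>\<close>.\<close>

lemma weakly_injective_if_surjective:
  assumes X: "(P, Q, f) \<in> cat_obj (proj_cat L)" and surj: "f ` carrier P = carrier Q"
  shows "weakly_injective (proj_cat L) (P, Q, f)"
  unfolding weakly_injective_def
proof (intro conjI allI impI X)
  fix B i p C assume conf: "conflation (proj_cat L) (P, Q, f) i B p C"
  obtain B1 B2 h where B: "B = (B1, B2, h)" by (cases B)
  obtain C1 C2 k where C: "C = (C1, C2, k)" by (cases C)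
  note conf' = conf[unfolded B C proj_cat_conflation_iff proj_cat_obj_iff proj_cat_hom_iff fst_conv snd_conv]
  have pr: "projective_module L P" "projective_module L Q" "projective_module L B1" "projective_module L B2"
    "projective_module L C1" "projective_module L C2"
    and hom: "f \<in> module_hom L P Q" "h \<in> module_hom L B1 B2" "fst i \<in> module_hom L P B1" "snd i \<in> module_hom L Q B2" "fst p \<in> module_hom L B1 C1"
    and comm: "\<And>x. x \<in> carrier P \<Longrightarrow> snd i (f x) = h (fst i x)"
    and se: "short_exact L P (fst i) B1 (fst p) C1" "short_exact L Q (snd i) B2 (snd p) C2"
    using conf' by blast+
  note ob = pr[THEN projective_obj] and rm = pr[THEN projective_rmod]
  obtain s \<rho> where s: "s \<in> module_hom L C1 B1" "\<And>c. c \<in> carrier C1 \<Longrightarrow> fst p (s c) = c"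
    and \<rho>: "\<rho> \<in> module_hom L B1 P" "\<And>a. a \<in> carrier P \<Longrightarrow> \<rho> (fst i a) = a"
      "\<And>b. b \<in> carrier B1 \<Longrightarrow> fst i (\<rho> b) = b \<ominus>\<^bsub>B1\<^esub> s (fst p b)"
    using short_exact_split[OF se(1) pr(3,5)] by blast
  obtain r where r: "r \<in> module_hom L B2 Q" "\<And>a. a \<in> carrier Q \<Longrightarrow> r (snd i a) = a"
    using short_exact_split[OF se(2) pr(4,6)] by blast
  interpret f: rmod_hom L P Q f using rmod_homI[OF ob(1,2) hom(1)] .
  interpret i1: rmod_hom L P B1 "fst i" using rmod_homI[OF ob(1,3) hom(3)] .
  interpret p1: rmod_hom L B1 C1 "fst p" using rmod_homI[OF ob(3,5) hom(5)] .
  interpret s: rmod_hom L C1 B1 s using rmod_homI[OF ob(5,3) s(1)] .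
  interpret \<rho>: rmod_hom L B1 P \<rho> using rmod_homI[OF ob(3,1) \<rho>(1)] .
  \<comment> \<open>The defect of commutativity, \<open>f \<rho> - r h\<close>.\<close>
  let ?d = "\<lambda>b\<in>carrier B1. compose (carrier B1) f \<rho> b \<ominus>\<^bsub>Q\<^esub> compose (carrier B1) r h b"
  have d: "?d \<in> module_hom L B1 Q"
    using hom_minus[OF rm(3,2) hom_compose[OF rm(3) \<rho>(1) hom(1)] hom_compose[OF rm(3) hom(2) r(1)]] .
  interpret d: rmod_hom L B1 Q ?d using rmod_homI[OF ob(3,2) d] .
  have ds: "compose (carrier C1) ?d s \<in> module_hom L C1 Q" using hom_compose[OF rm(5) s(1) d] .
  then have "compose (carrier C1) ?d s ` carrier C1 \<subseteq> f ` carrier P" unfolding surj using hom_in[OF ds] by blast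
  then obtain u where u: "u \<in> module_hom L C1 P" "\<forall>c\<in>carrier C1. f (u c) = compose (carrier C1) ?d s c"
    using projective_lift[OF pr(5) ob(1,2) hom(1) ds] by blast
  interpret u: rmod_hom L C1 P u using rmod_homI[OF ob(5,1) u(1)] .
  have di: "?d (fst i x) = \<zero>\<^bsub>Q\<^esub>" if x: "x \<in> carrier P" for x
    using x comm[OF x, symmetric] r(2)[of "f x"] \<rho>(2) by (simp add: f.N.minus_eq_zero_iff)
  \<comment> \<open>\<open>b - s (p b)\<close> comes from \<open>P\<close>, where the defect
    vanishes, so the defect has the same value at \<open>b\<close> and at
    \<open>s (p b)\<close>.\<close>
  have fu: "f (u (fst p b)) = ?d b" if b: "b \<in> carrier B1" for b
  proof -
    have "?d (b \<ominus>\<^bsub>B1\<^esub> s (fst p b)) = \<zero>\<^bsub>Q\<^esub>" using di[of "\<rho> b"] \<rho>(3) b by simp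
    moreover have "?d (b \<ominus>\<^bsub>B1\<^esub> s (fst p b)) = ?d b \<ominus>\<^bsub>Q\<^esub> ?d (s (fst p b))"
      using b by (intro d.minus) simp_all
    ultimately have "?d b \<ominus>\<^bsub>Q\<^esub> ?d (s (fst p b)) = \<zero>\<^bsub>Q\<^esub>" by (rule back_subst[of "\<lambda>x. x = \<zero>\<^bsub>Q\<^esub>"])
    then have "?d b = ?d (s (fst p b))"
      using b f.N.minus_eq_zero_iff[OF d.closed d.closed, of b "s (fst p b)"] s.closed[OF p1.closed[OF b]] by blast
    then show ?thesis using u(2) b by simp
  qed
  \<comment> \<open>Subtracting the lift cancels the defect. The values on the image of
    \<open>P\<close> do not change, since \<open>p\<close> vanishes there.\<close>
  let ?r = "\<lambda>b\<in>carrier B1. \<rho> b \<ominus>\<^bsub>P\<^esub> compose (carrier B1) u (fst p) b"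
  have r1: "?r \<in> module_hom L B1 P" using hom_minus[OF rm(3,1) \<rho>(1) hom_compose[OF rm(3) hom(5) u(1)]] .
  have minus_minus: "x \<ominus>\<^bsub>Q\<^esub> (x \<ominus>\<^bsub>Q\<^esub> y) = y" if "x \<in> carrier Q" "y \<in> carrier Q" for x y
    using that by (simp add: f.N.M.minus_eq f.N.M.minus_add f.N.M.r_neg2)
  have "r (h b) = f (?r b)" if b: "b \<in> carrier B1" for b
    using b fu[OF b] hom_in[OF r(1) hom_in[OF hom(2) b]] by (simp add: f.minus minus_minus)
  moreover have "?r (fst i x) = x" if x: "x \<in> carrier P" for x
  proof -
    have "fst p (fst i x) = \<zero>\<^bsub>C1\<^esub>" using short_exactD(7)[OF se(1)] x by auto
    then show ?thesis using x \<rho>(2) by (simp add: f.M.M.minus_eq)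
  qed
  ultimately show "\<exists>r\<in>cat_hom (proj_cat L) B (P, Q, f). cat_comp (proj_cat L) (P, Q, f) B (P, Q, f) r i = cat_id (proj_cat L) (P, Q, f)"
    using r r1 by (intro bexI[of _ "(?r, r)"]) (simp_all add: B proj_cat_comp proj_cat_id proj_cat_hom_iff restrict_id_apply)
qed

lemma zero_module_exists:
  assumes M: "M \<in> cat_obj (mod_cat L)"
  shows "\<exists>Z. projective_module L Z \<and> carrier Z = {\<zero>\<^bsub>Z\<^esub>}"
proof -
  interpret M: rmod L M using M by (simp add: mod_cat_obj_iff)
  let ?Z = "M\<lparr>carrier := {\<zero>\<^bsub>M\<^esub>}\<rparr>"
  have "fg_submod L M {\<zero>\<^bsub>M\<^esub>}" unfolding fg_submod_def by (intro exI[of _ "{}"]) simp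
  then have Z: "?Z \<in> cat_obj (mod_cat L)"
    by (intro submod_in_mod_cat[OF M]) (simp_all add: submod_def)
  have "projective_module L ?Z"
    unfolding projective_module_def
  proof (intro conjI ballI impI Z)
    fix A B g f assume AB: "A \<in> cat_obj (mod_cat L)" "B \<in> cat_obj (mod_cat L)"
      and g: "g \<in> module_hom L A B" and f: "f \<in> module_hom L ?Z B"
    have rm: "rmod L ?Z" "rmod L A" using Z AB by (simp_all add: mod_cat_obj_iff)
    interpret g: rmod_hom L A B g using rmod_homI[OF AB g] .
    interpret f: rmod_hom L ?Z B f using rmod_homI[OF Z AB(2) f] .
    show "\<exists>h\<in>module_hom L ?Z A. compose (carrier ?Z) g h = f"
      unfolding compose_eq_hom_iff[OF f]
      using hom_const_zero[OF rm] f.zero by (intro bexI[of _ "\<lambda>x\<in>carrier ?Z. \<zero>\<^bsub>A\<^esub>"]) simp_all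
  qed
  then show ?thesis by (intro exI[of _ ?Z]) simp
qed

text \<open>
  The test conflation embeds \<open>f : P \<rightarrow> Q\<close> into the projection \<open>P \<oplus> Q \<rightarrow> Q\<close> by the graph of \<open>f\<close>
  and the identity of \<open>Q\<close>; its cokernel is \<open>Q \<rightarrow> 0\<close>.
\<close>

lemma surjective_if_weakly_injective:
  assumes X: "weakly_injective (proj_cat L) (P, Q, f)"
  shows "f ` carrier P = carrier Q"
proof -
  have pr: "projective_module L P" "projective_module L Q" and f: "f \<in> module_hom L P Q"
    using X by (simp_all add: weakly_injective_def proj_cat_obj_iff)
  note ob = pr[THEN projective_obj] and rm = pr[THEN projective_rmod]
  interpret f: rmod_hom L P Q f using rmod_homI[OF ob f] .
  obtain S p q where S: "direct_sum L P Q S p q" using direct_sum_exists[OF ob] by blast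
  have S': "projective_module L S" "p \<in> module_hom L S P" "q \<in> module_hom L S Q"
    using S direct_sum_projective[OF S pr] by (simp_all add: direct_sum_def)
  have sur: "\<exists>z\<in>carrier S. p z = x \<and> q z = y" if "x \<in> carrier P" "y \<in> carrier Q" for x y
  proof -
    have "(x, y) \<in> (\<lambda>z. (p z, q z)) ` carrier S" using S that by (simp add: direct_sum_def bij_betw_def)
    then show ?thesis by auto
  qed
  obtain Z where Z: "projective_module L Z" "carrier Z = {\<zero>\<^bsub>Z\<^esub>}" using zero_module_exists[OF ob(1)] by blast
  have id: "restrict id (carrier P) \<in> module_hom L P P" "restrict id (carrier Q) \<in> module_hom L Q Q"
    using module_hom_id rm right_module_iff by metis+
  obtain i where i: "i \<in> module_hom L P S" "\<And>x. x \<in> carrier P \<Longrightarrow> p (i x) = x" "\<And>x. x \<in> carrier P \<Longrightarrow> q (i x) = f x"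
    using direct_sum_pair[OF S rm(1) id(1) f] by auto
  note rS = projective_rmod[OF S'(1)] and rZ = projective_rmod[OF Z(1)]
  \<comment> \<open>\<open>q - f p\<close> vanishes exactly on the graph of \<open>f\<close>, the
    image of \<open>i\<close>, and sends the pair \<open>(0, y)\<close> to \<open>y\<close>; hence
    it is a cokernel of \<open>i\<close>.\<close>
  let ?c = "\<lambda>z\<in>carrier S. q z \<ominus>\<^bsub>Q\<^esub> compose (carrier S) f p z"
  have c: "?c \<in> module_hom L S Q" using hom_minus[OF rS rm(2) S'(3) hom_compose[OF rS S'(2) f]] .
  let ?z = "\<lambda>x\<in>carrier Q. \<zero>\<^bsub>Z\<^esub>"
  have z: "?z \<in> module_hom L Q Z" using hom_const_zero[OF rm(2) rZ] .
  have c0: "?c x = \<zero>\<^bsub>Q\<^esub> \<longleftrightarrow> q x = f (p x)" if "x \<in> carrier S" for x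
    using that hom_in[OF S'(2) that] hom_in[OF S'(3) that] by (simp add: f.N.minus_eq_zero_iff)
  have "short_exact L P i S ?c Q"
    unfolding short_exact_def
  proof (intro conjI ob projective_obj[OF S'(1)] i(1) c)
    show "inj_on i (carrier P)" using i(2) by (metis inj_onI)
    show "i ` carrier P = {b \<in> carrier S. ?c b = \<zero>\<^bsub>Q\<^esub>}"
    proof (intro equalityI subsetI)
      fix y assume "y \<in> {b \<in> carrier S. ?c b = \<zero>\<^bsub>Q\<^esub>}"
      then have y: "y \<in> carrier S" "q y = f (p y)" using c0 by auto
      have "y = i (p y)"
      proof (rule direct_sum_ext[OF S])
      qed (use y i hom_in[OF S'(2) y(1)] hom_in[OF i(1)] in simp_all)
      then show "y \<in> i ` carrier P" using hom_in[OF S'(2) y(1)] by blast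
    next
      fix y assume "y \<in> i ` carrier P"
      then show "y \<in> {b \<in> carrier S. ?c b = \<zero>\<^bsub>Q\<^esub>}" using c0 i hom_in[OF i(1)] by auto
    qed
    show "?c ` carrier S = carrier Q"
    proof (intro equalityI subsetI)
      fix y assume y: "y \<in> carrier Q"
      obtain w where w: "w \<in> carrier S" "p w = \<zero>\<^bsub>P\<^esub>" "q w = y" using sur[OF _ y] by blast
      then have "?c w = y" using y by (simp add: f.N.M.minus_eq)
      then show "y \<in> ?c ` carrier S" using w by blast
    qed (use hom_in[OF c] in blast)
  qed
  moreover have "short_exact L Q (restrict id (carrier Q)) Q ?z Z"
    unfolding short_exact_def using ob projective_obj[OF Z(1)] id z Z(2) by (auto simp: inj_on_def intro: f.N.M.zero_closed)
  ultimately have "conflation (proj_cat L) (P, Q, f) (i, restrict id (carrier Q)) (S, Q, q) (?c, ?z) (Q, Z, ?z)"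
    unfolding proj_cat_conflation_iff proj_cat_obj_iff proj_cat_hom_iff fst_conv snd_conv
    using pr f S' Z i id c z hom_in[OF c] hom_in[OF S'(3)] by simp
  then obtain r where r_hom: "r \<in> cat_hom (proj_cat L) (S, Q, q) (P, Q, f)"
    and r_id: "cat_comp (proj_cat L) (P, Q, f) (S, Q, q) (P, Q, f) r (i, restrict id (carrier Q)) = cat_id (proj_cat L) (P, Q, f)"
    using X unfolding weakly_injective_def by blast
  have r: "fst r \<in> module_hom L S P" "\<And>x. x \<in> carrier S \<Longrightarrow> snd r (q x) = f (fst r x)"
    using r_hom by (simp_all add: proj_cat_hom_iff)
  have "\<forall>y\<in>carrier Q. snd r (restrict id (carrier Q) y) = y"
    using r_id by (simp add: proj_cat_comp proj_cat_id restrict_id_apply)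
  then have r3: "\<And>y. y \<in> carrier Q \<Longrightarrow> snd r y = y" by simp
  \<comment> \<open>The second component of the retraction is the identity of \<open>Q\<close>.
    Commutation with the surjection \<open>q\<close> therefore exhibits \<open>y\<close> as the
    image under \<open>f\<close> of a value of the first component.\<close>
  have "y \<in> f ` carrier P" if y: "y \<in> carrier Q" for y
  proof -
    obtain w where w: "w \<in> carrier S" "q w = y" using sur[OF f.M.M.zero_closed y] by blast
    then have "y = f (fst r w)" using r(2) r3 y by metis
    then show ?thesis using w hom_in[OF r(1)] by blast
  qed
  then show ?thesis by auto
qed

section \<open>The cokernel functor\<close>

lemma direct_sum_short_exact:
  assumes S: "direct_sum L M N S p q" and M: "M \<in> cat_obj (mod_cat L)" and N: "N \<in> cat_obj (mod_cat L)"
    and i: "i \<in> module_hom L N S" "\<And>y. y \<in> carrier N \<Longrightarrow> p (i y) = \<zero>\<^bsub>M\<^esub>" "\<And>y. y \<in> carrier N \<Longrightarrow> q (i y) = y"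
  shows "short_exact L N i S p M"
  unfolding short_exact_def
proof (intro conjI M N i(1))
  have S': "S \<in> cat_obj (mod_cat L)" "p \<in> module_hom L S M" "q \<in> module_hom L S N"
    using S by (simp_all add: direct_sum_def)
  interpret N: rmod L N using N by (simp add: mod_cat_obj_iff)
  show "S \<in> cat_obj (mod_cat L)" "p \<in> module_hom L S M" by fact+
  show "inj_on i (carrier N)" using i(3) by (metis inj_onI)
  show "i ` carrier N = {b \<in> carrier S. p b = \<zero>\<^bsub>M\<^esub>}"
  proof (intro equalityI subsetI)
    fix y assume "y \<in> {b \<in> carrier S. p b = \<zero>\<^bsub>M\<^esub>}"
    then have y: "y \<in> carrier S" "p y = \<zero>\<^bsub>M\<^esub>" by auto
    have "y = i (q y)"
    proof (rule direct_sum_ext[OF S])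
    qed (use y i(2,3) hom_in[OF S'(3) y(1)] hom_in[OF i(1)] in simp_all)
    then show "y \<in> i ` carrier N" using hom_in[OF S'(3) y(1)] by blast
  qed (use i(2) hom_in[OF i(1)] in auto)
  show "p ` carrier S = carrier M"
  proof (intro equalityI subsetI)
    fix x assume "x \<in> carrier M"
    then have "(x, \<zero>\<^bsub>N\<^esub>) \<in> (\<lambda>z. (p z, q z)) ` carrier S" using S by (simp add: direct_sum_def bij_betw_def)
    then show "x \<in> p ` carrier S" by auto
  qed (use hom_in[OF S'(2)] in blast)
qed

text \<open>Two sections of one projection differ by a map into its kernel \<open>I\<close>. The
  structure map of \<open>I\<close> is onto because \<open>I\<close> is weakly injective, so the
  difference comes from the source of \<open>I\<close>, and the commuting squares take it into the
  image of \<open>f'\<close>.\<close>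

lemma image_diff_if_stably_equal:
  assumes X: "(P, Q, f) \<in> cat_obj (proj_cat L)" and Y: "(P', Q', f') \<in> cat_obj (proj_cat L)"
    and eq: "stably_equal (proj_cat L) (P, Q, f) (P', Q', f') a b" and x: "x \<in> carrier Q"
  shows "snd a x \<ominus>\<^bsub>Q'\<^esub> snd b x \<in> f' ` carrier P'"
proof -
  obtain I i E p s t g where h: "weakly_injective (proj_cat L) I" "conflation (proj_cat L) I i E p (P, Q, f)"
     "s \<in> cat_hom (proj_cat L) (P, Q, f) E" "t \<in> cat_hom (proj_cat L) (P, Q, f) E" "g \<in> cat_hom (proj_cat L) E (P', Q', f')"
     "cat_comp (proj_cat L) (P, Q, f) E (P, Q, f) p s = cat_id (proj_cat L) (P, Q, f)"
     "cat_comp (proj_cat L) (P, Q, f) E (P, Q, f) p t = cat_id (proj_cat L) (P, Q, f)"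
     "cat_comp (proj_cat L) (P, Q, f) E (P', Q', f') g s = a" "cat_comp (proj_cat L) (P, Q, f) E (P', Q', f') g t = b"
    using eq unfolding stably_equal_def by blast
  obtain I1 I2 u where I: "I = (I1, I2, u)" by (cases I)
  obtain E1 E2 v where E: "E = (E1, E2, v)" by (cases E)
  note conf = h(2)[unfolded I E proj_cat_conflation_iff proj_cat_obj_iff proj_cat_hom_iff fst_conv snd_conv]
  have ob: "E2 \<in> cat_obj (mod_cat L)" "Q \<in> cat_obj (mod_cat L)" "Q' \<in> cat_obj (mod_cat L)"
    using conf Y by (simp_all add: proj_cat_obj_iff projective_obj)
  have se: "short_exact L I2 (snd i) E2 (snd p) Q" and i: "fst i \<in> module_hom L I1 E1"
    "\<And>x. x \<in> carrier I1 \<Longrightarrow> snd i (u x) = v (fst i x)" and p: "snd p \<in> module_hom L E2 Q" using conf by blast+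
  have g: "fst g \<in> module_hom L E1 P'" "snd g \<in> module_hom L E2 Q'" "\<And>x. x \<in> carrier E1 \<Longrightarrow> snd g (v x) = f' (fst g x)"
    and s: "snd s \<in> module_hom L Q E2" and t: "snd t \<in> module_hom L Q E2"
    using h(3-5) by (simp_all add: E proj_cat_hom_iff)
  interpret p: rmod_hom L E2 Q "snd p" using rmod_homI[OF ob(1,2) p] .
  interpret g: rmod_hom L E2 Q' "snd g" using rmod_homI[OF ob(1,3) g(2)] .
  have st: "snd s x \<in> carrier E2" "snd t x \<in> carrier E2" using x hom_in s t by metis+
  have "snd p (snd s x) = x" "snd p (snd t x) = x"
    using h(6,7) x by (simp_all add: proj_cat_comp proj_cat_id restrict_id_apply)
  then have "snd p (snd s x \<ominus>\<^bsub>E2\<^esub> snd t x) = \<zero>\<^bsub>Q\<^esub>"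
    using x st by (simp add: p.minus p.N.minus_eq_zero_iff)
  then have "snd s x \<ominus>\<^bsub>E2\<^esub> snd t x \<in> snd i ` carrier I2"
    using short_exactD(7)[OF se] st by simp
  moreover have "carrier I2 = u ` carrier I1"
    using surjective_if_weakly_injective[OF h(1)[unfolded I]] by (rule sym)
  ultimately have "snd s x \<ominus>\<^bsub>E2\<^esub> snd t x \<in> snd i ` u ` carrier I1" by simp
  then obtain w where w: "w \<in> carrier I1" "snd s x \<ominus>\<^bsub>E2\<^esub> snd t x = snd i (u w)" by blast
  have "snd a x \<ominus>\<^bsub>Q'\<^esub> snd b x = snd g (snd s x) \<ominus>\<^bsub>Q'\<^esub> snd g (snd t x)"
    using h(8,9) x by (auto simp: proj_cat_comp)
  also have "\<dots> = snd g (snd s x \<ominus>\<^bsub>E2\<^esub> snd t x)" using st by (simp add: g.minus)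
  also have "\<dots> = f' (fst g (fst i w))" using w i(2) g(3) hom_in[OF i(1)] by simp
  finally show ?thesis using w hom_in[OF i(1)] hom_in[OF g(1)] by simp
qed

text \<open>
  The conflation used here is the split one \<open>I \<rightarrow> X \<oplus> I \<rightarrow> X\<close> for the projection \<open>I\<close> of \<open>P \<oplus> Q\<close> to \<open>Q\<close>;
  the two sections are \<open>(1, (1, f))\<close> and \<open>(1, 0)\<close>.
\<close>

lemma stably_equal_if_image_diff:
  assumes X: "(P, Q, f) \<in> cat_obj (proj_cat L)" and Y: "(P', Q', f') \<in> cat_obj (proj_cat L)"
    and a: "a \<in> cat_hom (proj_cat L) (P, Q, f) (P', Q', f')" and b: "b \<in> cat_hom (proj_cat L) (P, Q, f) (P', Q', f')"
    and diff: "\<And>x. x \<in> carrier Q \<Longrightarrow> snd a x \<ominus>\<^bsub>Q'\<^esub> snd b x \<in> f' ` carrier P'"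
  shows "stably_equal (proj_cat L) (P, Q, f) (P', Q', f') a b"
proof -
  obtain a1 a2 b1 b2 where ab: "a = (a1, a2)" "b = (b1, b2)" by (cases a; cases b)
  have pr: "projective_module L P" "projective_module L Q" "projective_module L P'" "projective_module L Q'"
    and f: "f \<in> module_hom L P Q" and f': "f' \<in> module_hom L P' Q'"
    using X Y by (simp_all add: proj_cat_obj_iff)
  note ob = pr[THEN projective_obj] and rm = pr[THEN projective_rmod]
  have a1: "a1 \<in> module_hom L P P'" and a2: "a2 \<in> module_hom L Q Q'" and a_comm: "\<And>x. x \<in> carrier P \<Longrightarrow> a2 (f x) = f' (a1 x)"
    and b1: "b1 \<in> module_hom L P P'" and b2: "b2 \<in> module_hom L Q Q'" and b_comm: "\<And>x. x \<in> carrier P \<Longrightarrow> b2 (f x) = f' (b1 x)"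
    using a b by (simp_all add: ab proj_cat_hom_iff)
  interpret f: rmod_hom L P Q f using rmod_homI[OF ob(1,2) f] .
  interpret f': rmod_hom L P' Q' f' using rmod_homI[OF ob(3,4) f'] .
  interpret a1: rmod_hom L P P' a1 using rmod_homI[OF ob(1,3) a1] .
  interpret b1: rmod_hom L P P' b1 using rmod_homI[OF ob(1,3) b1] .
  interpret a2: rmod_hom L Q Q' a2 using rmod_homI[OF ob(2,4) a2] .
  interpret b2: rmod_hom L Q Q' b2 using rmod_homI[OF ob(2,4) b2] .
  \<comment> \<open>\<open>d\<close> is the difference of the second components and \<open>l\<close>
    its lift along \<open>f'\<close>. The map \<open>k\<close> below is the part of the first
    difference that \<open>l\<close> does not account for; it has values in the kernel of
    \<open>f'\<close>.\<close>
  define d where "d = (\<lambda>x\<in>carrier Q. a2 x \<ominus>\<^bsub>Q'\<^esub> b2 x)"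
  have d: "d \<in> module_hom L Q Q'" unfolding d_def using hom_minus[OF rm(2,4) a2 b2] .
  have d_apply: "d x = a2 x \<ominus>\<^bsub>Q'\<^esub> b2 x" if "x \<in> carrier Q" for x using that by (simp add: d_def)
  interpret d: rmod_hom L Q Q' d using rmod_homI[OF ob(2,4) d] .
  have "d ` carrier Q \<subseteq> f' ` carrier P'" using diff by (auto simp: d_apply ab)
  then obtain l where l: "l \<in> module_hom L Q P'" "\<And>x. x \<in> carrier Q \<Longrightarrow> f' (l x) = d x"
    using projective_lift[OF pr(2) ob(3,4) f' d] by blast
  interpret l: rmod_hom L Q P' l using rmod_homI[OF ob(2,3) l(1)] .
  define k where "k = (\<lambda>x\<in>carrier P. (\<lambda>x\<in>carrier P. a1 x \<ominus>\<^bsub>P'\<^esub> b1 x) x \<ominus>\<^bsub>P'\<^esub> compose (carrier P) l f x)"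
  have k: "k \<in> module_hom L P P'"
    unfolding k_def using hom_minus[OF rm(1,3) hom_minus[OF rm(1,3) a1 b1] hom_compose[OF rm(1) f l(1)]] .
  have k_apply: "k x = (a1 x \<ominus>\<^bsub>P'\<^esub> b1 x) \<ominus>\<^bsub>P'\<^esub> l (f x)" if "x \<in> carrier P" for x using that by (simp add: k_def)
  interpret k: rmod_hom L P P' k using rmod_homI[OF ob(1,3) k] .
  have f'k: "f' (k x) = \<zero>\<^bsub>Q'\<^esub>" if "x \<in> carrier P" for x
    using that l(2)[of "f x"] by (simp add: k_apply f'.minus d_apply a_comm b_comm f'.N.minus_eq_zero_iff)
  obtain S p q where S: "direct_sum L P Q S p q" using direct_sum_exists[OF ob(1,2)] by blast
  have S': "projective_module L S" "p \<in> module_hom L S P" "q \<in> module_hom L S Q"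
    using S direct_sum_projective[OF S pr(1,2)] by (simp_all add: direct_sum_def)
  note Sob = projective_obj[OF S'(1)] and rS = projective_rmod[OF S'(1)]
  interpret p: rmod_hom L S P p using rmod_homI[OF Sob ob(1) S'(2)] .
  interpret q: rmod_hom L S Q q using rmod_homI[OF Sob ob(2) S'(3)] .
  obtain T1 p1 q1 where T1: "direct_sum L P S T1 p1 q1" using direct_sum_exists[OF ob(1) Sob] by blast
  have T1': "projective_module L T1" "p1 \<in> module_hom L T1 P" "q1 \<in> module_hom L T1 S"
    using T1 direct_sum_projective[OF T1 pr(1) S'(1)] by (simp_all add: direct_sum_def)
  note T1ob = projective_obj[OF T1'(1)] and rT1 = projective_rmod[OF T1'(1)]
  interpret p1: rmod_hom L T1 P p1 using rmod_homI[OF T1ob ob(1) T1'(2)] .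
  interpret q1: rmod_hom L T1 S q1 using rmod_homI[OF T1ob Sob T1'(3)] .
  obtain T2 p2 q2 where T2: "direct_sum L Q Q T2 p2 q2" using direct_sum_exists[OF ob(2,2)] by blast
  have T2': "projective_module L T2" "p2 \<in> module_hom L T2 Q" "q2 \<in> module_hom L T2 Q"
    using T2 direct_sum_projective[OF T2 pr(2,2)] by (simp_all add: direct_sum_def)
  note T2ob = projective_obj[OF T2'(1)] and rT2 = projective_rmod[OF T2'(1)]
  interpret p2: rmod_hom L T2 Q p2 using rmod_homI[OF T2ob ob(2) T2'(2)] .
  interpret q2: rmod_hom L T2 Q q2 using rmod_homI[OF T2ob ob(2) T2'(3)] .
  have idP: "restrict id (carrier P) \<in> module_hom L P P" and idQ: "restrict id (carrier Q) \<in> module_hom L Q Q"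
    and idS: "restrict id (carrier S) \<in> module_hom L S S"
    using module_hom_id rm rS right_module_iff by metis+
  \<comment> \<open>The structure map of \<open>X \<oplus> I\<close>, which is the direct sum of
    \<open>f\<close> and \<open>q\<close>.\<close>
  obtain h where h: "h \<in> module_hom L T1 T2" "\<And>z. z \<in> carrier T1 \<Longrightarrow> p2 (h z) = f (p1 z)" "\<And>z. z \<in> carrier T1 \<Longrightarrow> q2 (h z) = q (q1 z)"
    using direct_sum_pair[OF T2 rT1 hom_compose[OF rT1 T1'(2) f] hom_compose[OF rT1 T1'(3) S'(3)]] by auto
  obtain i1 where i1: "i1 \<in> module_hom L S T1" "\<And>z. z \<in> carrier S \<Longrightarrow> p1 (i1 z) = \<zero>\<^bsub>P\<^esub>" "\<And>z. z \<in> carrier S \<Longrightarrow> q1 (i1 z) = z"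
    using direct_sum_pair[OF T1 rS hom_const_zero[OF rS rm(1)] idS] by auto
  obtain i2 where i2: "i2 \<in> module_hom L Q T2" "\<And>z. z \<in> carrier Q \<Longrightarrow> p2 (i2 z) = \<zero>\<^bsub>Q\<^esub>" "\<And>z. z \<in> carrier Q \<Longrightarrow> q2 (i2 z) = z"
    using direct_sum_pair[OF T2 rm(2) hom_const_zero[OF rm(2,2)] idQ] by auto
  obtain \<sigma> where \<sigma>: "\<sigma> \<in> module_hom L P S" "\<And>x. x \<in> carrier P \<Longrightarrow> p (\<sigma> x) = x" "\<And>x. x \<in> carrier P \<Longrightarrow> q (\<sigma> x) = f x"
    using direct_sum_pair[OF S rm(1) idP f] by auto
  obtain s1 where s1: "s1 \<in> module_hom L P T1" "\<And>x. x \<in> carrier P \<Longrightarrow> p1 (s1 x) = x" "\<And>x. x \<in> carrier P \<Longrightarrow> q1 (s1 x) = \<sigma> x"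
    using direct_sum_pair[OF T1 rm(1) idP \<sigma>(1)] by auto
  obtain s2 where s2: "s2 \<in> module_hom L Q T2" "\<And>x. x \<in> carrier Q \<Longrightarrow> p2 (s2 x) = x" "\<And>x. x \<in> carrier Q \<Longrightarrow> q2 (s2 x) = x"
    using direct_sum_pair[OF T2 rm(2) idQ idQ] by auto
  obtain t1 where t1: "t1 \<in> module_hom L P T1" "\<And>x. x \<in> carrier P \<Longrightarrow> p1 (t1 x) = x" "\<And>x. x \<in> carrier P \<Longrightarrow> q1 (t1 x) = \<zero>\<^bsub>S\<^esub>"
    using direct_sum_pair[OF T1 rm(1) idP hom_const_zero[OF rm(1) rS]] by auto
  obtain t2 where t2: "t2 \<in> module_hom L Q T2" "\<And>x. x \<in> carrier Q \<Longrightarrow> p2 (t2 x) = x" "\<And>x. x \<in> carrier Q \<Longrightarrow> q2 (t2 x) = \<zero>\<^bsub>Q\<^esub>"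
    using direct_sum_pair[OF T2 rm(2) idQ hom_const_zero[OF rm(2,2)]] by auto
  \<comment> \<open>The map out of \<open>X \<oplus> I\<close> is \<open>b\<close> on
    \<open>X\<close> and has components \<open>k p + l q\<close> and \<open>d\<close> on
    \<open>I\<close>. Along the section that involves \<open>(1, f)\<close>, the part on
    \<open>I\<close> contributes \<open>k + l f\<close>, the whole difference of the first
    components; along the other section it contributes zero.\<close>
  define c where "c = (\<lambda>z\<in>carrier S. k (p z) \<oplus>\<^bsub>P'\<^esub> l (q z))"
  have c: "c \<in> module_hom L S P'" unfolding c_def by (rule direct_sum_copair[OF S rm(3) k l(1)])
  have c_apply: "c z = k (p z) \<oplus>\<^bsub>P'\<^esub> l (q z)" if "z \<in> carrier S" for z using that by (simp add: c_def)
  interpret c: rmod_hom L S P' c using rmod_homI[OF Sob ob(3) c] .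
  define g1 where "g1 = (\<lambda>z\<in>carrier T1. b1 (p1 z) \<oplus>\<^bsub>P'\<^esub> c (q1 z))"
  have g1: "g1 \<in> module_hom L T1 P'" unfolding g1_def by (rule direct_sum_copair[OF T1 rm(3) b1 c])
  have g1_apply: "g1 z = b1 (p1 z) \<oplus>\<^bsub>P'\<^esub> c (q1 z)" if "z \<in> carrier T1" for z using that by (simp add: g1_def)
  define g2 where "g2 = (\<lambda>z\<in>carrier T2. b2 (p2 z) \<oplus>\<^bsub>Q'\<^esub> d (q2 z))"
  have g2: "g2 \<in> module_hom L T2 Q'" unfolding g2_def by (rule direct_sum_copair[OF T2 rm(4) b2 d])
  have g2_apply: "g2 z = b2 (p2 z) \<oplus>\<^bsub>Q'\<^esub> d (q2 z)" if "z \<in> carrier T2" for z using that by (simp add: g2_def)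
  have I: "(S, Q, q) \<in> cat_obj (proj_cat L)" using S' pr by (simp add: proj_cat_obj_iff)
  have E: "(T1, T2, h) \<in> cat_obj (proj_cat L)" using T1' T2' h by (simp add: proj_cat_obj_iff)
  have "q ` carrier S = carrier Q"
  proof (intro equalityI subsetI)
    fix y assume "y \<in> carrier Q"
    then have "(\<zero>\<^bsub>P\<^esub>, y) \<in> (\<lambda>z. (p z, q z)) ` carrier S" using S by (simp add: direct_sum_def bij_betw_def)
    then show "y \<in> q ` carrier S" by auto
  qed auto
  then have winj: "weakly_injective (proj_cat L) (S, Q, q)" by (rule weakly_injective_if_surjective[OF I])
  have i: "(i1, i2) \<in> cat_hom (proj_cat L) (S, Q, q) (T1, T2, h)"
    unfolding proj_cat_hom_iff fst_conv snd_conv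
  proof (intro conjI ballI i1(1) i2(1))
    fix x assume x: "x \<in> carrier S"
    show "i2 (q x) = h (i1 x)"
    proof (rule direct_sum_ext[OF T2])
    qed (use x i1 i2 h hom_in[OF i1(1) x] hom_in[OF h(1)] hom_in[OF i2(1)] in simp_all)
  qed
  have pE: "(p1, p2) \<in> cat_hom (proj_cat L) (T1, T2, h) (P, Q, f)"
    using T1' T2' h by (simp add: proj_cat_hom_iff)
  have conf: "conflation (proj_cat L) (S, Q, q) (i1, i2) (T1, T2, h) (p1, p2) (P, Q, f)"
    unfolding proj_cat_conflation_iff fst_conv snd_conv
    by (intro conjI I E X i pE direct_sum_short_exact[OF T1 ob(1) Sob] direct_sum_short_exact[OF T2 ob(2,2)] i1 i2)
  have s: "(s1, s2) \<in> cat_hom (proj_cat L) (P, Q, f) (T1, T2, h)"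
    unfolding proj_cat_hom_iff fst_conv snd_conv
  proof (intro conjI ballI s1(1) s2(1))
    fix x assume x: "x \<in> carrier P"
    show "s2 (f x) = h (s1 x)"
    proof (rule direct_sum_ext[OF T2])
    qed (use x s1 s2 h \<sigma> hom_in[OF s1(1) x] hom_in[OF h(1)] hom_in[OF s2(1)] in simp_all)
  qed
  have t: "(t1, t2) \<in> cat_hom (proj_cat L) (P, Q, f) (T1, T2, h)"
    unfolding proj_cat_hom_iff fst_conv snd_conv
  proof (intro conjI ballI t1(1) t2(1))
    fix x assume x: "x \<in> carrier P"
    show "t2 (f x) = h (t1 x)"
    proof (rule direct_sum_ext[OF T2])
    qed (use x t1 t2 h hom_in[OF t1(1) x] hom_in[OF h(1)] hom_in[OF t2(1)] in simp_all)
  qed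
  have g: "(g1, g2) \<in> cat_hom (proj_cat L) (T1, T2, h) (P', Q', f')"
    unfolding proj_cat_hom_iff fst_conv snd_conv
  proof (intro conjI ballI g1 g2)
    fix z assume z: "z \<in> carrier T1"
    have "f' (g1 z) = f' (b1 (p1 z)) \<oplus>\<^bsub>Q'\<^esub> (f' (k (p (q1 z))) \<oplus>\<^bsub>Q'\<^esub> f' (l (q (q1 z))))"
      using z by (simp add: g1_apply c_apply f'.add)
    also have "\<dots> = b2 (f (p1 z)) \<oplus>\<^bsub>Q'\<^esub> d (q (q1 z))"
      using z by (simp add: f'k l(2) b_comm)
    also have "\<dots> = g2 (h z)" using z h hom_in[OF h(1) z] by (simp add: g2_apply)
    finally show "g2 (h z) = f' (g1 z)" by simp
  qed
  have ps: "cat_comp (proj_cat L) (P, Q, f) (T1, T2, h) (P, Q, f) (p1, p2) (s1, s2) = cat_id (proj_cat L) (P, Q, f)"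
    using s1 s2 by (simp add: proj_cat_comp proj_cat_id restrict_id_apply)
  have pt: "cat_comp (proj_cat L) (P, Q, f) (T1, T2, h) (P, Q, f) (p1, p2) (t1, t2) = cat_id (proj_cat L) (P, Q, f)"
    using t1 t2 by (simp add: proj_cat_comp proj_cat_id restrict_id_apply)
  have "g1 (s1 x) = a1 x" if x: "x \<in> carrier P" for x
  proof -
    have "k x \<oplus>\<^bsub>P'\<^esub> l (f x) = a1 x \<ominus>\<^bsub>P'\<^esub> b1 x"
      using x f'.M.add_minus_cancel[of "a1 x \<ominus>\<^bsub>P'\<^esub> b1 x" "l (f x)"] by (simp add: k_apply f'.M.M.a_comm)
    then show ?thesis
      using x s1 \<sigma> hom_in[OF s1(1) x] hom_in[OF \<sigma>(1) x] by (simp add: g1_apply c_apply f'.M.add_minus_cancel)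
  qed
  moreover have "g2 (s2 x) = a2 x" if x: "x \<in> carrier Q" for x
    using x s2 hom_in[OF s2(1) x] by (simp add: g2_apply d_apply f'.N.add_minus_cancel)
  ultimately have gs: "cat_comp (proj_cat L) (P, Q, f) (T1, T2, h) (P', Q', f') (g1, g2) (s1, s2) = a"
    by (simp add: proj_cat_comp ab compose_eq_hom_iff[OF a1] compose_eq_hom_iff[OF a2])
  have "g1 (t1 x) = b1 x" if x: "x \<in> carrier P" for x
    using x t1 hom_in[OF t1(1) x] by (simp add: g1_apply)
  moreover have "g2 (t2 x) = b2 x" if x: "x \<in> carrier Q" for x
    using x t2 hom_in[OF t2(1) x] by (simp add: g2_apply)
  ultimately have gt: "cat_comp (proj_cat L) (P, Q, f) (T1, T2, h) (P', Q', f') (g1, g2) (t1, t2) = b"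
    by (simp add: proj_cat_comp ab compose_eq_hom_iff[OF b1] compose_eq_hom_iff[OF b2])
  show ?thesis
    unfolding stably_equal_def using winj conf s t g ps pt gs gt by blast
qed

section \<open>Construction of the cokernel functor\<close>

text \<open>\<open>k\<close> takes the same value at all preimages of a point under
  \<open>e\<close>, so it can be evaluated at any chosen one.\<close>

lemma hom_factor:
  assumes M: "rmod L M" and Q: "rmod L Q" and N: "rmod L N"
    and e: "e \<in> module_hom L Q M" "e ` carrier Q = carrier M" and k: "k \<in> module_hom L Q N"
    and ker: "\<And>x. x \<in> carrier Q \<Longrightarrow> e x = \<zero>\<^bsub>M\<^esub> \<Longrightarrow> k x = \<zero>\<^bsub>N\<^esub>"
  shows "\<exists>h\<in>module_hom L M N. \<forall>x\<in>carrier Q. h (e x) = k x"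
proof -
  interpret e: rmod_hom L Q M e using M Q e by (simp add: rmod_hom_def rmod_hom_axioms_def)
  interpret k: rmod_hom L Q N k using N Q k by (simp add: rmod_hom_def rmod_hom_axioms_def)
  have cong: "k x = k y" if "x \<in> carrier Q" "y \<in> carrier Q" "e x = e y" for x y
    using ker[of "x \<ominus>\<^bsub>Q\<^esub> y"] that by (simp add: e.minus k.minus e.N.minus_eq_zero_iff k.N.minus_eq_zero_iff)
  define r where "r = inv_into (carrier Q) e"
  have r: "r y \<in> carrier Q" "e (r y) = y" if "y \<in> carrier M" for y
    using that e(2) by (auto simp: r_def inv_into_into f_inv_into_f)
  have "(\<lambda>y\<in>carrier M. k (r y)) \<in> module_hom L M N"
  proof (rule module_homI[OF _ _ _ M])
    show "k (r (x \<oplus>\<^bsub>M\<^esub> y)) = k (r x) \<oplus>\<^bsub>N\<^esub> k (r y)" if "x \<in> carrier M" "y \<in> carrier M" for x y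
      using cong[of "r (x \<oplus>\<^bsub>M\<^esub> y)" "r x \<oplus>\<^bsub>Q\<^esub> r y"] r that by (simp add: e.add k.add)
    show "k (r (a \<odot>\<^bsub>M\<^esub> x)) = a \<odot>\<^bsub>N\<^esub> k (r x)" if "a \<in> carrier L" "x \<in> carrier M" for a x
      using cong[of "r (a \<odot>\<^bsub>M\<^esub> x)" "a \<odot>\<^bsub>Q\<^esub> r x"] r that by (simp add: e.smult k.smult)
  qed (use r in simp)
  moreover have "k (r (e x)) = k x" if "x \<in> carrier Q" for x
    using that r by (intro cong) simp_all
  ultimately show ?thesis by (intro bexI[of _ "\<lambda>y\<in>carrier M. k (r y)"]) simp_all
qed

definition is_coker ::
    "('a, 'y) ring_scheme \<Rightarrow> 'a morphism_obj \<Rightarrow> ('a, 'a list) module \<Rightarrow> ('a list \<Rightarrow> 'a list) \<Rightarrow> bool" where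
  "is_coker L X M e \<longleftrightarrow> (case X of (P, Q, f) \<Rightarrow> M \<in> cat_obj (mod_cat L) \<and> e \<in> module_hom L Q M \<and>
     e ` carrier Q = carrier M \<and> {x \<in> carrier Q. e x = \<zero>\<^bsub>M\<^esub>} = f ` carrier P)"

text \<open>Object and map are chosen together as a pair. \<open>coker_map\<close> projects from the
  same \<open>SOME\<close> term, so that the two match.\<close>

definition coker_obj :: "('a, 'y) ring_scheme \<Rightarrow> 'a morphism_obj \<Rightarrow> ('a, 'a list) module" where
  "coker_obj L X = fst (SOME Me. is_coker L X (fst Me) (snd Me))"

definition coker_map :: "('a, 'y) ring_scheme \<Rightarrow> 'a morphism_obj \<Rightarrow> 'a list \<Rightarrow> 'a list" where
  "coker_map L X = snd (SOME Me. is_coker L X (fst Me) (snd Me))"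

text \<open>The action on maps is selected by compatibility with the cokernel maps; these are
  surjective, so there is only one candidate.\<close>

definition coker_functor ::
    "('a, 'y) ring_scheme \<Rightarrow> ('a morphism_obj, 'a morphism_hom, ('a, 'a list) module, 'a list \<Rightarrow> 'a list) cat_map" where
  "coker_functor L = \<lparr>on_obj = coker_obj L, on_hom = (\<lambda>X Y a. SOME h. h \<in> module_hom L (coker_obj L X) (coker_obj L Y) \<and>
     (\<forall>x\<in>carrier (fst (snd X)). h (coker_map L X x) = coker_map L Y (snd a x)))\<rparr>"

lemma is_coker:
  assumes X: "(P, Q, f) \<in> cat_obj (proj_cat L)"
  shows "is_coker L (P, Q, f) (coker_obj L (P, Q, f)) (coker_map L (P, Q, f))"
proof -
  have pr: "projective_module L P" "projective_module L Q" and f: "f \<in> module_hom L P Q"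
    using X by (simp_all add: proj_cat_obj_iff)
  interpret f: rmod_hom L P Q f using rmod_homI[OF pr[THEN projective_obj] f] .
  obtain M e where "is_coker L (P, Q, f) M e"
    using quotient_exists[OF projective_obj[OF pr(2)] f.submod_image[OF f.M.submod_carrier]]
    by (auto simp: is_coker_def)
  then have "\<exists>Me. is_coker L (P, Q, f) (fst Me) (snd Me)" by auto
  from someI_ex[OF this] show ?thesis unfolding coker_obj_def coker_map_def .
qed

lemma coker_functor_obj: "X \<in> cat_obj (proj_cat L) \<Longrightarrow> on_obj (coker_functor L) X \<in> cat_obj (mod_cat L)"
  using is_coker by (cases X) (auto simp: coker_functor_def is_coker_def)

lemma coker_functor_hom:
  assumes X: "X \<in> cat_obj (proj_cat L)" and Y: "Y \<in> cat_obj (proj_cat L)" and a: "a \<in> cat_hom (proj_cat L) X Y"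
  shows "on_hom (coker_functor L) X Y a \<in> module_hom L (on_obj (coker_functor L) X) (on_obj (coker_functor L) Y)"
    and "\<And>x. x \<in> carrier (fst (snd X)) \<Longrightarrow> on_hom (coker_functor L) X Y a (coker_map L X x) = coker_map L Y (snd a x)"
proof -
  obtain P Q f P' Q' f' where XY: "X = (P, Q, f)" "Y = (P', Q', f')" by (cases X; cases Y)
  have pr: "projective_module L P" "projective_module L Q" "projective_module L P'" "projective_module L Q'"
    and f: "f \<in> module_hom L P Q" and f': "f' \<in> module_hom L P' Q'"
    using X Y by (simp_all add: XY proj_cat_obj_iff)
  note rm = pr[THEN projective_rmod]
  have cX: "coker_obj L X \<in> cat_obj (mod_cat L)" "coker_map L X \<in> module_hom L Q (coker_obj L X)"
    "coker_map L X ` carrier Q = carrier (coker_obj L X)" "{x \<in> carrier Q. coker_map L X x = \<zero>\<^bsub>coker_obj L X\<^esub>} = f ` carrier P"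
    using is_coker X unfolding XY is_coker_def by blast+
  have cY: "coker_obj L Y \<in> cat_obj (mod_cat L)" "coker_map L Y \<in> module_hom L Q' (coker_obj L Y)"
    "{x \<in> carrier Q'. coker_map L Y x = \<zero>\<^bsub>coker_obj L Y\<^esub>} = f' ` carrier P'"
    using is_coker Y unfolding XY is_coker_def by blast+
  have a': "fst a \<in> module_hom L P P'" "snd a \<in> module_hom L Q Q'" "\<And>x. x \<in> carrier P \<Longrightarrow> snd a (f x) = f' (fst a x)"
    using a by (simp_all add: XY proj_cat_hom_iff)
  have "\<exists>h\<in>module_hom L (coker_obj L X) (coker_obj L Y). \<forall>x\<in>carrier Q. h (coker_map L X x) = compose (carrier Q) (coker_map L Y) (snd a) x"
  proof (rule hom_factor[OF _ rm(2) _ cX(2,3) hom_compose[OF rm(2) a'(2) cY(2)]])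
    fix x assume x: "x \<in> carrier Q" "coker_map L X x = \<zero>\<^bsub>coker_obj L X\<^esub>"
    then obtain y where y: "y \<in> carrier P" "x = f y" using cX(4) by blast
    then have "snd a x \<in> f' ` carrier P'" using a' hom_in[OF a'(1)] by simp
    then show "compose (carrier Q) (coker_map L Y) (snd a) x = \<zero>\<^bsub>coker_obj L Y\<^esub>" using x cY(3) by auto
  qed (use cX cY in \<open>simp_all add: mod_cat_obj_iff\<close>)
  then have "\<exists>h. h \<in> module_hom L (coker_obj L X) (coker_obj L Y) \<and>
     (\<forall>x\<in>carrier (fst (snd X)). h (coker_map L X x) = coker_map L Y (snd a x))"
    by (auto simp: XY)
  from someI_ex[OF this]
  show "on_hom (coker_functor L) X Y a \<in> module_hom L (on_obj (coker_functor L) X) (on_obj (coker_functor L) Y)"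
    and "\<And>x. x \<in> carrier (fst (snd X)) \<Longrightarrow> on_hom (coker_functor L) X Y a (coker_map L X x) = coker_map L Y (snd a x)"
    by (simp_all add: coker_functor_def)
qed

text \<open>The cokernel map is surjective, hence equality of maps out of the cokernel can be tested
  on \<open>Q\<close>. Functor laws, kernel and fullness are all verified in this way.\<close>

lemma coker_hom_eq:
  assumes X: "(P, Q, f) \<in> cat_obj (proj_cat L)"
    and "h \<in> module_hom L (on_obj (coker_functor L) (P, Q, f)) N" "h' \<in> module_hom L (on_obj (coker_functor L) (P, Q, f)) N"
    and "\<And>x. x \<in> carrier Q \<Longrightarrow> h (coker_map L (P, Q, f) x) = h' (coker_map L (P, Q, f) x)"
  shows "h = h'"
proof (rule hom_ext[OF assms(2,3)])
  fix y assume "y \<in> carrier (on_obj (coker_functor L) (P, Q, f))"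
  then have "y \<in> coker_map L (P, Q, f) ` carrier Q"
    using is_coker[OF X] by (simp add: is_coker_def coker_functor_def)
  then show "h y = h' y" using assms(4) by blast
qed

lemma cat_functor_coker: "cat_functor (proj_cat L) (mod_cat L) (coker_functor L)"
proof (unfold_locales, rule is_category_proj_cat, rule is_category_mod_cat)
  interpret P: cat "proj_cat L" by unfold_locales (rule is_category_proj_cat)
  interpret M: cat "mod_cat L" by unfold_locales (rule is_category_mod_cat)
  let ?K = "coker_functor L"
  note obj = coker_functor_obj and hom = coker_functor_hom(1) and app = coker_functor_hom(2)
  have map_in: "coker_map L (P, Q, f) x \<in> carrier (on_obj ?K (P, Q, f))"
    if "(P, Q, f) \<in> cat_obj (proj_cat L)" "x \<in> carrier Q" for P Q f x
    using is_coker[OF that(1)] that(2) hom_in by (fastforce simp: is_coker_def coker_functor_def)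
  show "is_functor (proj_cat L) (mod_cat L) ?K"
    unfolding is_functor_def
  proof (intro conjI ballI)
    fix X assume X: "X \<in> cat_obj (proj_cat L)"
    obtain P Q f where X': "X = (P, Q, f)" by (cases X)
    have id: "cat_id (mod_cat L) (on_obj ?K X) \<in> module_hom L (on_obj ?K X) (on_obj ?K X)"
      using M.id_in[OF obj[OF X]] by simp
    show "on_hom ?K X X (cat_id (proj_cat L) X) = cat_id (mod_cat L) (on_obj ?K X)"
      unfolding X'
    proof (rule coker_hom_eq[OF X[unfolded X'] hom[OF X X P.id_in[OF X], unfolded X'] id[unfolded X']])
      fix x assume x: "x \<in> carrier Q"
      show "on_hom ?K (P, Q, f) (P, Q, f) (cat_id (proj_cat L) (P, Q, f)) (coker_map L (P, Q, f) x) =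
         cat_id (mod_cat L) (on_obj ?K (P, Q, f)) (coker_map L (P, Q, f) x)"
        using app[OF X X P.id_in[OF X]] x map_in X by (simp add: X' proj_cat_id)
    qed
  next
    fix X Y Z a b assume X: "X \<in> cat_obj (proj_cat L)" and Y: "Y \<in> cat_obj (proj_cat L)" and Z: "Z \<in> cat_obj (proj_cat L)"
      and a: "a \<in> cat_hom (proj_cat L) X Y" and b: "b \<in> cat_hom (proj_cat L) Y Z"
    obtain P Q f P' Q' f' where XY: "X = (P, Q, f)" "Y = (P', Q', f')" by (cases X; cases Y)
    have ba: "cat_comp (proj_cat L) X Y Z b a \<in> cat_hom (proj_cat L) X Z" using X Y Z a b by simp
    have KK: "cat_comp (mod_cat L) (on_obj ?K X) (on_obj ?K Y) (on_obj ?K Z) (on_hom ?K Y Z b) (on_hom ?K X Y a)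
        \<in> module_hom L (on_obj ?K X) (on_obj ?K Z)"
      using M.comp_in[OF obj[OF X] obj[OF Y] obj[OF Z]] hom[OF X Y a] hom[OF Y Z b] by simp
    have a2: "snd a x \<in> carrier Q'" if "x \<in> carrier Q" for x
      using a that hom_in by (fastforce simp: XY proj_cat_hom_iff)
    show "on_hom ?K X Z (cat_comp (proj_cat L) X Y Z b a) =
       cat_comp (mod_cat L) (on_obj ?K X) (on_obj ?K Y) (on_obj ?K Z) (on_hom ?K Y Z b) (on_hom ?K X Y a)"
    proof (rule coker_hom_eq[OF X[unfolded XY] hom[OF X Z ba, unfolded XY(1)] KK[unfolded XY(1)], folded XY(1)])
      fix x assume x: "x \<in> carrier Q"
      show "on_hom ?K X Z (cat_comp (proj_cat L) X Y Z b a) (coker_map L X x) =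
         cat_comp (mod_cat L) (on_obj ?K X) (on_obj ?K Y) (on_obj ?K Z) (on_hom ?K Y Z b) (on_hom ?K X Y a) (coker_map L X x)"
        using app[OF X Z ba] app[OF X Y a] app[OF Y Z b] x a2[OF x] map_in[OF X[unfolded XY(1)] x]
        by (simp add: XY proj_cat_comp)
    qed
  qed (use obj hom in simp_all)
qed

section \<open>Kernel, fullness and density of the cokernel functor\<close>

text \<open>Both sides mean that \<open>snd a x\<close> and \<open>snd b x\<close> differ by an
  element of the image of \<open>f'\<close> for every \<open>x\<close> in the target
  \<open>Q\<close> of \<open>X\<close>.\<close>

lemma coker_functor_eq_iff:
  assumes X: "X \<in> cat_obj (proj_cat L)" and Y: "Y \<in> cat_obj (proj_cat L)"
    and a: "a \<in> cat_hom (proj_cat L) X Y" and b: "b \<in> cat_hom (proj_cat L) X Y"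
  shows "on_hom (coker_functor L) X Y a = on_hom (coker_functor L) X Y b \<longleftrightarrow> stably_equal (proj_cat L) X Y a b"
proof -
  obtain P Q f P' Q' f' where XY: "X = (P, Q, f)" "Y = (P', Q', f')" by (cases X; cases Y)
  have cY: "coker_obj L Y \<in> cat_obj (mod_cat L)" "coker_map L Y \<in> module_hom L Q' (coker_obj L Y)"
    "{x \<in> carrier Q'. coker_map L Y x = \<zero>\<^bsub>coker_obj L Y\<^esub>} = f' ` carrier P'"
    using is_coker Y unfolding XY is_coker_def by blast+
  have Q': "Q' \<in> cat_obj (mod_cat L)" using Y by (simp add: XY proj_cat_obj_iff projective_obj)
  interpret c: rmod_hom L Q' "coker_obj L Y" "coker_map L Y" using rmod_homI[OF Q' cY(1,2)] .
  have ab: "snd a x \<in> carrier Q'" "snd b x \<in> carrier Q'" if "x \<in> carrier Q" for x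
    using a b that hom_in by (fastforce simp: XY proj_cat_hom_iff)+
  have diff: "snd a x \<ominus>\<^bsub>Q'\<^esub> snd b x \<in> f' ` carrier P' \<longleftrightarrow> coker_map L Y (snd a x) = coker_map L Y (snd b x)"
    if x: "x \<in> carrier Q" for x
    unfolding cY(3)[symmetric] using ab[OF x] by (simp add: c.minus c.N.minus_eq_zero_iff)
  note app = coker_functor_hom(2)[OF X Y a] coker_functor_hom(2)[OF X Y b]
  show ?thesis
  proof
    assume eq: "on_hom (coker_functor L) X Y a = on_hom (coker_functor L) X Y b"
    have "snd a x \<ominus>\<^bsub>Q'\<^esub> snd b x \<in> f' ` carrier P'" if x: "x \<in> carrier Q" for x
      using diff[OF x] app[of x] x eq by (simp add: XY)
    then show "stably_equal (proj_cat L) X Y a b"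
      using stably_equal_if_image_diff X Y a b unfolding XY by blast
  next
    assume "stably_equal (proj_cat L) X Y a b"
    then have eq: "coker_map L Y (snd a x) = coker_map L Y (snd b x)" if "x \<in> carrier Q" for x
      using image_diff_if_stably_equal X Y diff that unfolding XY by blast
    show "on_hom (coker_functor L) X Y a = on_hom (coker_functor L) X Y b"
    proof (rule coker_hom_eq[OF X[unfolded XY(1)] coker_functor_hom(1)[OF X Y a, unfolded XY(1)]
          coker_functor_hom(1)[OF X Y b, unfolded XY(1)], folded XY(1)])
      fix x assume "x \<in> carrier Q"
      then show "on_hom (coker_functor L) X Y a (coker_map L X x) = on_hom (coker_functor L) X Y b (coker_map L X x)"
        using app[of x] eq[of x] by (simp add: XY)
    qed
  qed
qed

text \<open>The usual lifting to projective presentations: projectivity of \<open>Q\<close> lifts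
  \<open>h\<close> to \<open>a2\<close>; then \<open>a2 f\<close> lands in the kernel of the
  cokernel map, which is the image of \<open>f'\<close>, and projectivity of \<open>P\<close> gives
  \<open>a1\<close>.\<close>

lemma full_coker_functor: "full_functor (proj_cat L) (mod_cat L) (coker_functor L)"
  unfolding full_functor_def
proof (intro ballI)
  fix X Y h assume X: "X \<in> cat_obj (proj_cat L)" and Y: "Y \<in> cat_obj (proj_cat L)"
    and "h \<in> cat_hom (mod_cat L) (on_obj (coker_functor L) X) (on_obj (coker_functor L) Y)"
  then have h: "h \<in> module_hom L (coker_obj L X) (coker_obj L Y)" by (simp add: coker_functor_def)
  obtain P Q f P' Q' f' where XY: "X = (P, Q, f)" "Y = (P', Q', f')" by (cases X; cases Y)
  have pr: "projective_module L P" "projective_module L Q" "projective_module L P'" "projective_module L Q'"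
    and f: "f \<in> module_hom L P Q" and f': "f' \<in> module_hom L P' Q'"
    using X Y by (simp_all add: XY proj_cat_obj_iff)
  note ob = pr[THEN projective_obj] and rm = pr[THEN projective_rmod]
  have cX: "coker_obj L X \<in> cat_obj (mod_cat L)" "coker_map L X \<in> module_hom L Q (coker_obj L X)"
    "{x \<in> carrier Q. coker_map L X x = \<zero>\<^bsub>coker_obj L X\<^esub>} = f ` carrier P"
    using is_coker X unfolding XY is_coker_def by blast+
  have cY: "coker_obj L Y \<in> cat_obj (mod_cat L)" "coker_map L Y \<in> module_hom L Q' (coker_obj L Y)"
    "coker_map L Y ` carrier Q' = carrier (coker_obj L Y)"
    "{x \<in> carrier Q'. coker_map L Y x = \<zero>\<^bsub>coker_obj L Y\<^esub>} = f' ` carrier P'"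
    using is_coker Y unfolding XY is_coker_def by blast+
  interpret h: rmod_hom L "coker_obj L X" "coker_obj L Y" h using rmod_homI[OF cX(1) cY(1) h] .
  have hc: "compose (carrier Q) h (coker_map L X) \<in> module_hom L Q (coker_obj L Y)"
    using hom_compose[OF rm(2) cX(2) h] .
  then have "compose (carrier Q) h (coker_map L X) ` carrier Q \<subseteq> coker_map L Y ` carrier Q'"
    unfolding cY(3) using hom_in[OF hc] by blast
  then obtain a2 where a2: "a2 \<in> module_hom L Q Q'" "\<forall>x\<in>carrier Q. coker_map L Y (a2 x) = compose (carrier Q) h (coker_map L X) x"
    using projective_lift[OF pr(2) ob(4) cY(1,2) hc] by blast
  have a2f: "compose (carrier P) a2 f \<in> module_hom L P Q'" using hom_compose[OF rm(1) f a2(1)] .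
  have "a2 (f x) \<in> f' ` carrier P'" if x: "x \<in> carrier P" for x
  proof -
    have fx: "f x \<in> carrier Q" using hom_in[OF f x] .
    have "coker_map L X (f x) = \<zero>\<^bsub>coker_obj L X\<^esub>" using cX(3) x by blast
    then have "coker_map L Y (a2 (f x)) = \<zero>\<^bsub>coker_obj L Y\<^esub>" using a2(2) fx by simp
    then show ?thesis using cY(4) hom_in[OF a2(1) fx] by blast
  qed
  then have "compose (carrier P) a2 f ` carrier P \<subseteq> f' ` carrier P'" by auto
  then obtain a1 where a1: "a1 \<in> module_hom L P P'" "\<forall>x\<in>carrier P. f' (a1 x) = compose (carrier P) a2 f x"
    using projective_lift[OF pr(1) ob(3,4) f' a2f] by blast
  have a: "(a1, a2) \<in> cat_hom (proj_cat L) X Y" using a1 a2 by (simp add: XY proj_cat_hom_iff)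
  have h': "h \<in> module_hom L (on_obj (coker_functor L) X) (on_obj (coker_functor L) Y)"
    using h by (simp add: coker_functor_def)
  have "on_hom (coker_functor L) X Y (a1, a2) = h"
  proof (rule coker_hom_eq[OF X[unfolded XY(1)] coker_functor_hom(1)[OF X Y a, unfolded XY(1)] h'[unfolded XY(1)], folded XY(1)])
    fix x assume "x \<in> carrier Q"
    then show "on_hom (coker_functor L) X Y (a1, a2) (coker_map L X x) = h (coker_map L X x)"
      using coker_functor_hom(2)[OF X Y a] a2(2) by (simp add: XY)
  qed
  then show "\<exists>a\<in>cat_hom (proj_cat L) X Y. on_hom (coker_functor L) X Y a = h" using a by blast
qed

text \<open>Each of the two maps factors through the other. The composites of the factorisations fix
  all images of elements of \<open>Q\<close>, and these exhaust the cokernels.\<close>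

lemma is_coker_unique:
  assumes Q: "Q \<in> cat_obj (mod_cat L)" and M: "is_coker L (P, Q, f) M e" and M': "is_coker L (P, Q, f) M' e'"
  shows "\<exists>u. cat_iso (mod_cat L) M M' u"
proof -
  have m: "M \<in> cat_obj (mod_cat L)" "e \<in> module_hom L Q M" "e ` carrier Q = carrier M" "{x \<in> carrier Q. e x = \<zero>\<^bsub>M\<^esub>} = f ` carrier P"
    using M by (simp_all add: is_coker_def)
  have m': "M' \<in> cat_obj (mod_cat L)" "e' \<in> module_hom L Q M'" "e' ` carrier Q = carrier M'" "{x \<in> carrier Q. e' x = \<zero>\<^bsub>M'\<^esub>} = f ` carrier P"
    using M' by (simp_all add: is_coker_def)
  have rm: "rmod L Q" "rmod L M" "rmod L M'" using Q m m' by (simp_all add: mod_cat_obj_iff)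
  obtain u where u: "u \<in> module_hom L M M'" "\<And>x. x \<in> carrier Q \<Longrightarrow> u (e x) = e' x"
    using hom_factor[OF rm(2,1,3) m(2,3) m'(2)] m(4) m'(4) by blast
  obtain v where v: "v \<in> module_hom L M' M" "\<And>x. x \<in> carrier Q \<Longrightarrow> v (e' x) = e x"
    using hom_factor[OF rm(3,1,2) m'(2,3) m(2)] m(4) m'(4) by blast
  have "v (u y) = y" if "y \<in> carrier M" for y using that u v unfolding m(3)[symmetric] by auto
  moreover have "u (v y) = y" if "y \<in> carrier M'" for y using that u v unfolding m'(3)[symmetric] by auto
  ultimately have "cat_iso (mod_cat L) M M' u"
    unfolding cat_iso_def using u v by (simp add: restrict_id_apply) blast
  then show ?thesis by blast
qed

text \<open>Some projective surjects onto \<open>M\<close>; its kernel is finitely generated by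
  \<open>noeth\<close> and so is itself the image of a projective. The chain condition of an Artin
  algebra enters as \<open>noeth\<close>.\<close>

lemma dense_coker_functor:
  assumes noeth: "\<And>M H. M \<in> cat_obj (mod_cat L) \<Longrightarrow> submod L M H \<Longrightarrow> fg_submod L M H"
  shows "dense_functor (proj_cat L) (mod_cat L) (coker_functor L)"
  unfolding dense_functor_def
proof
  fix M assume M: "M \<in> cat_obj (mod_cat L)"
  obtain Q e where Q: "projective_module L Q" and e: "e \<in> module_hom L Q M" "e ` carrier Q = carrier M"
    using projective_cover_exists[OF M] by blast
  note Qob = projective_obj[OF Q]
  interpret e: rmod_hom L Q M e using rmod_homI[OF Qob M e(1)] .
  let ?H = "{x \<in> carrier Q. e x = \<zero>\<^bsub>M\<^esub>}"
  have H: "Q\<lparr>carrier := ?H\<rparr> \<in> cat_obj (mod_cat L)"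
    using submod_in_mod_cat[OF Qob e.submod_kernel noeth[OF Qob e.submod_kernel]] .
  obtain P f where P: "projective_module L P" and f: "f \<in> module_hom L P (Q\<lparr>carrier := ?H\<rparr>)" "f ` carrier P = ?H"
    using projective_cover_exists[OF H] by auto
  have "f \<in> module_hom L P Q" using f(1) by (auto simp: module_hom_def PiE_iff)
  then have X: "(P, Q, f) \<in> cat_obj (proj_cat L)" using P Q by (simp add: proj_cat_obj_iff)
  have "is_coker L (P, Q, f) M e" using M e f(2) by (simp add: is_coker_def)
  then show "\<exists>X\<in>cat_obj (proj_cat L). \<exists>u. cat_iso (mod_cat L) (on_obj (coker_functor L) X) M u"
    using is_coker_unique[OF Qob is_coker[OF X], of M e] X
    by (intro bexI[of _ "(P, Q, f)"]) (simp_all add: coker_functor_def)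
qed

lemma dense_coker_functor_artin_algebra:
  assumes "artin_algebra R L"
  shows "dense_functor (proj_cat L) (mod_cat L) (coker_functor L)"
  using artin_algebra_fg_submod[OF assms] by (intro dense_coker_functor) (auto simp: mod_cat_obj_iff)

theorem proposition4p4:
  fixes R :: "('r, 'x) ring_scheme" and \<Lambda> :: "('r, 'a, 'y) module_scheme"
    and R' :: "('s, 'u) ring_scheme" and \<Lambda>' :: "('s, 'b, 'v) module_scheme"
  assumes "artin_algebra R \<Lambda>" and "artin_algebra R' \<Lambda>'"
    and "equivalent_exact_categories (proj_cat \<Lambda>) (proj_cat \<Lambda>')"
  shows "equivalent_categories (mod_cat \<Lambda>) (mod_cat \<Lambda>')"
proof -
  obtain F where F: "is_exact_equivalence (proj_cat \<Lambda>) (proj_cat \<Lambda>') F"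
    using assms(3) unfolding equivalent_exact_categories_def by blast
  show ?thesis
    by (rule equivalent_stable_quotients[OF conflation_cat_proj_cat conflation_cat_proj_cat F
          cat_functor_coker full_coker_functor dense_coker_functor_artin_algebra[OF assms(1)]
          cat_functor_coker full_coker_functor dense_coker_functor_artin_algebra[OF assms(2)]
          coker_functor_eq_iff coker_functor_eq_iff])
qed

end
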